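(* Let $(M,g)$ be a semi-Riemannian manifold of dimension $n$, let $\gamma:[a,b]\to M$ be a geodesic, and let $\mathcal P\subset M$ be a smooth connected submanifold with $\gamma(a)\in\mathcal P$, $\dot\gamma(a)\in T_{\gamma(a)}\mathcal P^\perp$, and such that $g$ restricted to $T_{\gamma(a)}\mathcal P$ is nondegenerate. Let $\ell:[a,b]\to\Lambda$ be the curve of Lagrangians associated with $\gamma$ and let $L_0$, $L_{\mathcal P}$ be the Lagrangians associated with $\{\gamma(a)\}$ and $\mathcal P$ (see context). (1) If $\gamma$ has no conjugate instant, then $\big|\mu_{L_{\mathcal P}}\big(\ell|_{[\alpha,\beta]}\big)\big|\le\dim(\mathcal P)$ for every interval $[\alpha,\beta]\subset\left]a,b\right]$. (2) If $\gamma$ has no $\mathcal P$-focal instant, then $\big|\mu_{L_0}\big(\ell|_{[\alpha,\beta]}\big)\big|\le\dim(\mathcal P)$ for every interval $[\alpha,\beta]\subset\left]a,b\right]$.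
   Context: Maslov index. Let $(V,\omega)$ be a $2n$-dimensional real symplectic space and $\Lambda$ the set of its Lagrangian subspaces. For $L_1\in\Lambda$, $\Lambda^0(L_1)$ is the set of Lagrangians transverse to $L_1$. If $L_0,L_1$ are transverse Lagrangians, $\varphi_{L_0,L_1}:\Lambda^0(L_1)\to\mathrm{B}_{\mathrm{sym}}(L_0)$ (symmetric bilinear forms on $L_0$) is $\varphi_{L_0,L_1}(L)=\omega(T\cdot,\cdot)|_{L_0\times L_0}$, where $T:L_0\to L_1$ is the linear map whose graph is $L$. For a symmetric bilinear form $B$, $n_-(B)$ is the maximal dimension of a subspace on which $B$ is negative definite and $n_+(B)=n_-(-B)$. For a continuous path $\ell:[a,b]\to\Lambda$ and $L_0\in\Lambda$, $\mu_{L_0}(\ell)\in\mathbb Z$ is characterized by: fixed-endpoint homotopy invariance; additivity under concatenation; and, if $\ell([a,b])\subset\Lambda^0(L_1)$ for some $L_1$ transverse to $L_0$, $\mu_{L_0}(\ell)=n_+[\varphi_{L_0,L_1}(\ell(b))]-n_+[\varphi_{L_0,L_1}(\ell(a))]$. Geometric setting. $\perp$ denotes $g$-orthogonality. Jacobi fields along $\gamma$ are solutions of $\frac{\mathrm D^2}{\mathrm dt^2}J-R(\dot\gamma,J)\dot\gamma=0$, with $R(X,Y)=[\nabla_X,\nabla_Y]-\nabla_{[X,Y]}$. Let $V=T_{\gamma(a)}M\oplus T_{\gamma(a)}M$ with symplectic form $\omega\big((v_1,w_1),(v_2,w_2)\big)=g(v_2,w_1)-g(v_1,w_2)$. For $(v,w)\in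 V$ let $J_{v,w}$ be the Jacobi field along $\gamma$ with $J(a)=v$, $\frac{\mathrm D}{\mathrm dt}J(a)=w$. The smooth curve $\ell:[a,b]\to\Lambda$ is $\ell(t)=\{(v,w)\in V: J_{v,w}(t)=0\}$. Set $L_0=\{0\}\oplus T_{\gamma(a)}M=\ell(a)$. Let $S:T_{\gamma(a)}\mathcal P\to T_{\gamma(a)}\mathcal P$ be the $g$-symmetric operator representing the second fundamental form of $\mathcal P$ at $\gamma(a)$ in the normal direction $\dot\gamma(a)$, i.e. $g(S(v),v')=g(\nabla_vV',\dot\gamma(a))$ for any local extension $V'$ of $v'$ to a field tangent to $\mathcal P$. Set $L_{\mathcal P}=\{(v,w)\in V: v\in T_{\gamma(a)}\mathcal P,\ w+S(v)\in T_{\gamma(a)}\mathcal P^\perp\}$, a Lagrangian subspace. An instant $t\in\left]a,b\right]$ is $\mathcal P$-focal if $\ell(t)\cap L_{\mathcal P}\ne\{0\}$, and conjugate if $\ell(t)\cap L_0\neq\{0\}$. *)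

theory Defs
  imports "HOL-Analysis.Analysis" "HOL-Library.Function_Algebras"
begin

text \<open>Tangent vectors below are families of components, added and scaled pointwise.\<close>

instantiation "fun" :: (type, real_vector) real_vector
begin

definition scaleR_fun_def: "r *\<^sub>R f = (\<lambda>x. r *\<^sub>R f x)"

instance
  by standard (auto simp: scaleR_fun_def fun_eq_iff scaleR_add_right scaleR_add_left)

end


section \<open>Symplectic linear algebra and the Maslov index\<close>

text \<open>A finite-dimensional symplectic space is given by a carrier subspace \<open>V\<close> of a real vector
  space, and a form \<open>w\<close> of which only the values on \<open>V\<close> matter.\<close>

definition lagrangians :: "'v::real_vector set \<Rightarrow> ('v \<Rightarrow> 'v \<Rightarrow> real) \<Rightarrow> 'v set set" where
  "lagrangians V w = {L. subspace L \<and> L \<subseteq> V \<and> L = {v \<in> V. \<forall>u\<in>L. w v u = 0}}"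

definition transverse :: "'v::real_vector set \<Rightarrow> 'v set \<Rightarrow> bool" where
  "transverse L L' \<longleftrightarrow> L \<inter> L' = {0}"

text \<open>The form \<open>\<phi>\<^bsub>L0,L1\<^esub>(L) = w (T u) v\<close> for \<open>u, v \<in> L0\<close>, where \<open>L = {u + T u | u \<in> L0}\<close> is the graph
  of \<open>T : L0 \<rightarrow> L1\<close>.\<close>

definition lag_chart ::
  "('v::real_vector \<Rightarrow> 'v \<Rightarrow> real) \<Rightarrow> 'v set \<Rightarrow> 'v set \<Rightarrow> 'v set \<Rightarrow> 'v \<Rightarrow> 'v \<Rightarrow> real" where
  "lag_chart w L0 L1 L = (\<lambda>u v. w (THE x. x \<in> L1 \<and> u + x \<in> L) v)"

definition n_minus :: "'v::real_vector set \<Rightarrow> ('v \<Rightarrow> 'v \<Rightarrow> real) \<Rightarrow> nat" where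
  "n_minus W B = Max {dim U | U. subspace U \<and> U \<subseteq> W \<and> (\<forall>u\<in>U. u \<noteq> 0 \<longrightarrow> B u u < 0)}"

definition n_plus :: "'v::real_vector set \<Rightarrow> ('v \<Rightarrow> 'v \<Rightarrow> real) \<Rightarrow> nat" where
  "n_plus W B = n_minus W (\<lambda>u v. - B u v)"

text \<open>The manifold topology of the Lagrangian Grassmannian, for which the maps \<open>\<phi>\<^bsub>L0,L1\<^esub>\<close> form an
  atlas; the finite-dimensional space of bilinear forms on \<open>L0\<close> carries the topology of pointwise
  convergence.\<close>

definition lagrangian_topology ::
  "'v::real_vector set \<Rightarrow> ('v \<Rightarrow> 'v \<Rightarrow> real) \<Rightarrow> 'v set topology" where
  "lagrangian_topology V w = topology_generated_by
     {{L \<in> lagrangians V w. transverse L L1 \<and> lag_chart w L0 L1 L u v \<in> S} | L0 L1 u v S.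
        L0 \<in> lagrangians V w \<and> L1 \<in> lagrangians V w \<and> transverse L0 L1 \<and>
        u \<in> L0 \<and> v \<in> L0 \<and> open S}"

definition lagrangian_path ::
  "'v::real_vector set \<Rightarrow> ('v \<Rightarrow> 'v \<Rightarrow> real) \<Rightarrow> real \<Rightarrow> real \<Rightarrow> (real \<Rightarrow> 'v set) \<Rightarrow> bool" where
  "lagrangian_path V w a b l \<longleftrightarrow>
     continuous_map (top_of_set {a..b}) (lagrangian_topology V w) l"

text \<open>The three characteristic properties of the Maslov index; \<open>\<mu> L0 a b l\<close> stands for
  \<open>\<mu>\<^bsub>L0\<^esub>\<close> of the restriction of \<open>l\<close> to \<open>[a,b]\<close>. Homotopy invariance also says that
  \<open>\<mu> L0 a b l\<close> depends only on this restriction.\<close>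

definition is_maslov_index ::
  "'v::real_vector set \<Rightarrow> ('v \<Rightarrow> 'v \<Rightarrow> real) \<Rightarrow>
    ('v set \<Rightarrow> real \<Rightarrow> real \<Rightarrow> (real \<Rightarrow> 'v set) \<Rightarrow> int) \<Rightarrow> bool" where
  "is_maslov_index V w \<mu> \<longleftrightarrow>
    (\<forall>L0 \<in> lagrangians V w.
      (\<forall>a b l l'. a \<le> b \<longrightarrow>
         homotopic_with (\<lambda>h. h a = l a \<and> h b = l b)
           (top_of_set {a..b}) (lagrangian_topology V w) l l' \<longrightarrow>
         \<mu> L0 a b l = \<mu> L0 a b l') \<and>
      (\<forall>a b c l. a \<le> c \<longrightarrow> c \<le> b \<longrightarrow> lagrangian_path V w a b l \<longrightarrow>
         \<mu> L0 a b l = \<mu> L0 a c l + \<mu> L0 c b l) \<and>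
      (\<forall>a b l. \<forall>L1 \<in> lagrangians V w.
         a \<le> b \<longrightarrow> lagrangian_path V w a b l \<longrightarrow> transverse L1 L0 \<longrightarrow>
         (\<forall>t\<in>{a..b}. transverse (l t) L1) \<longrightarrow>
         \<mu> L0 a b l = int (n_plus L0 (lag_chart w L0 L1 (l b)))
                       - int (n_plus L0 (lag_chart w L0 L1 (l a)))))"


section \<open>Smooth manifolds\<close>

text \<open>Differentiability class \<open>C\<^sup>k\<close> on an open set.\<close>

primrec Ck_on :: "nat \<Rightarrow> 'a::euclidean_space set \<Rightarrow> ('a \<Rightarrow> 'b::real_normed_vector) \<Rightarrow> bool" where
  "Ck_on 0 S f \<longleftrightarrow> continuous_on S f"
| "Ck_on (Suc k) S f \<longleftrightarrow>
     (\<forall>x\<in>S. f differentiable (at x)) \<and> (\<forall>v. Ck_on k S (\<lambda>x. frechet_derivative f (at x) v))"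

definition smooth_on :: "'a::euclidean_space set \<Rightarrow> ('a \<Rightarrow> 'b::real_normed_vector) \<Rightarrow> bool" where
  "smooth_on S f \<longleftrightarrow> (\<forall>k. Ck_on k S f)"

text \<open>The manifold is a whole type \<open>'m\<close>; a chart is a pair of a domain and a coordinate map whose
  values outside of the domain are irrelevant.\<close>

type_synonym ('m, 'n) chart = "'m set \<times> ('m \<Rightarrow> real ^ 'n)"

abbreviation dom_of :: "('m, 'n) chart \<Rightarrow> 'm set" where "dom_of c \<equiv> fst c"
abbreviation coord :: "('m, 'n) chart \<Rightarrow> 'm \<Rightarrow> real ^ 'n" where "coord c \<equiv> snd c"
abbreviation coord_inv :: "('m, 'n) chart \<Rightarrow> real ^ 'n \<Rightarrow> 'm" where
  "coord_inv c \<equiv> inv_into (dom_of c) (coord c)"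

definition is_chart :: "('m::topological_space, 'n::finite) chart \<Rightarrow> bool" where
  "is_chart c \<longleftrightarrow> open (dom_of c) \<and> open (coord c ` dom_of c) \<and>
     homeomorphism (dom_of c) (coord c ` dom_of c) (coord c) (coord_inv c)"

definition transition ::
  "('m, 'n) chart \<Rightarrow> ('m, 'n) chart \<Rightarrow> real ^ 'n \<Rightarrow> real ^ 'n" where
  "transition c d = (\<lambda>y. coord d (coord_inv c y))"

definition compatible :: "('m, 'n::finite) chart \<Rightarrow> ('m, 'n) chart \<Rightarrow> bool" where
  "compatible c d \<longleftrightarrow>
     smooth_on (coord c ` (dom_of c \<inter> dom_of d)) (transition c d) \<and>
     smooth_on (coord d ` (dom_of c \<inter> dom_of d)) (transition d c)"

text \<open>A smooth structure is a maximal smooth atlas.\<close>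

definition smooth_structure :: "('m::topological_space, 'n::finite) chart set \<Rightarrow> bool" where
  "smooth_structure A \<longleftrightarrow>
     (\<forall>c\<in>A. is_chart c) \<and> (\<Union>c\<in>A. dom_of c) = UNIV \<and>
     (\<forall>c\<in>A. \<forall>d\<in>A. compatible c d) \<and>
     (\<forall>c. is_chart c \<and> (\<forall>d\<in>A. compatible c d) \<longrightarrow> c \<in> A)"

definition charts_at :: "('m, 'n) chart set \<Rightarrow> 'm \<Rightarrow> ('m, 'n) chart set" where
  "charts_at A p = {c \<in> A. p \<in> dom_of c}"

text \<open>A tangent vector at \<open>p\<close> is the family of its components in the charts around \<open>p\<close>, related to
  each other by the differentials of the transition maps; the entries at all other charts are 0.\<close>

type_synonym ('m, 'n) tangent = "('m, 'n) chart \<Rightarrow> real ^ 'n"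

definition tangent_space ::
  "('m, 'n::finite) chart set \<Rightarrow> 'm \<Rightarrow> ('m, 'n) tangent set" where
  "tangent_space A p = {v.
     (\<forall>c\<in>charts_at A p. \<forall>d\<in>charts_at A p.
        v d = frechet_derivative (transition c d) (at (coord c p)) (v c)) \<and>
     (\<forall>c. c \<notin> charts_at A p \<longrightarrow> v c = 0)}"

text \<open>The tangent vector at \<open>p\<close> with component \<open>u\<close> in the chart \<open>c\<close>.\<close>

definition tangent_of ::
  "('m, 'n::finite) chart set \<Rightarrow> 'm \<Rightarrow> ('m, 'n) chart \<Rightarrow> real ^ 'n \<Rightarrow> ('m, 'n) tangent" where
  "tangent_of A p c u =
     (\<lambda>d. if d \<in> charts_at A p
          then frechet_derivative (transition c d) (at (coord c p)) u else 0)"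

definition smooth_vector_field_on ::
  "('m, 'n::finite) chart set \<Rightarrow> 'm set \<Rightarrow> ('m \<Rightarrow> ('m, 'n) tangent) \<Rightarrow> bool" where
  "smooth_vector_field_on A U X \<longleftrightarrow>
     (\<forall>q\<in>U. X q \<in> tangent_space A q) \<and>
     (\<forall>c\<in>A. smooth_on (coord c ` (dom_of c \<inter> U)) (\<lambda>y. X (coord_inv c y) c))"


section \<open>Embedded submanifolds\<close>

text \<open>In the chart \<open>c\<close>, the set \<open>P\<close> is a slice along the linear subspace \<open>W\<close>.\<close>

definition slice_chart ::
  "('m, 'n::finite) chart set \<Rightarrow> 'm set \<Rightarrow> ('m, 'n) chart \<Rightarrow> (real ^ 'n) set \<Rightarrow> bool" where
  "slice_chart A P c W \<longleftrightarrow>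
     c \<in> A \<and> subspace W \<and> coord c ` (dom_of c \<inter> P) = coord c ` dom_of c \<inter> W"

definition submanifold ::
  "('m, 'n::finite) chart set \<Rightarrow> 'm set \<Rightarrow> nat \<Rightarrow> bool" where
  "submanifold A P k \<longleftrightarrow>
     (\<forall>p\<in>P. \<exists>c\<in>charts_at A p. \<exists>W. slice_chart A P c W \<and> dim W = k)"

definition subtangent ::
  "('m, 'n::finite) chart set \<Rightarrow> 'm set \<Rightarrow> 'm \<Rightarrow> ('m, 'n) tangent set" where
  "subtangent A P p =
     {v \<in> tangent_space A p. \<exists>c\<in>charts_at A p. \<exists>W. slice_chart A P c W \<and> v c \<in> W}"


section \<open>Semi-Riemannian geometry\<close>

type_synonym ('m, 'n) metric = "'m \<Rightarrow> ('m, 'n) tangent \<Rightarrow> ('m, 'n) tangent \<Rightarrow> real"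

definition nondegenerate_on :: "'v::real_vector set \<Rightarrow> ('v \<Rightarrow> 'v \<Rightarrow> real) \<Rightarrow> bool" where
  "nondegenerate_on W B \<longleftrightarrow> (\<forall>v\<in>W. (\<forall>w\<in>W. B v w = 0) \<longrightarrow> v = 0)"

definition metric_matrix ::
  "('m, 'n::finite) chart set \<Rightarrow> ('m, 'n) metric \<Rightarrow> ('m, 'n) chart \<Rightarrow> real ^ 'n \<Rightarrow> real ^ 'n ^ 'n" where
  "metric_matrix A g c y =
     (\<chi> i j. g (coord_inv c y) (tangent_of A (coord_inv c y) c (axis i 1))
                              (tangent_of A (coord_inv c y) c (axis j 1)))"

definition semi_riemannian_metric ::
  "('m, 'n::finite) chart set \<Rightarrow> ('m, 'n) metric \<Rightarrow> bool" where
  "semi_riemannian_metric A g \<longleftrightarrow>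
     (\<forall>p. (\<forall>u\<in>tangent_space A p. \<forall>v\<in>tangent_space A p. g p u v = g p v u) \<and>
          (\<forall>u\<in>tangent_space A p. \<forall>v\<in>tangent_space A p. \<forall>w\<in>tangent_space A p.
              g p (u + v) w = g p u w + g p v w) \<and>
          (\<forall>r. \<forall>u\<in>tangent_space A p. \<forall>v\<in>tangent_space A p. g p (r *\<^sub>R u) v = r * g p u v) \<and>
          nondegenerate_on (tangent_space A p) (g p)) \<and>
     (\<forall>c\<in>A. smooth_on (coord c ` dom_of c) (metric_matrix A g c))"

definition partial_deriv :: "'n::finite \<Rightarrow> (real ^ 'n \<Rightarrow> real) \<Rightarrow> real ^ 'n \<Rightarrow> real" where
  "partial_deriv i f y = frechet_derivative f (at y) (axis i 1)"

text \<open>Christoffel symbols \<open>\<Gamma>\<^sup>k\<^sub>i\<^sub>j\<close> of the Levi-Civita connection in the chart \<open>c\<close>, at the point with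
  coordinates \<open>y\<close>.\<close>

definition christoffel ::
  "('m, 'n::finite) chart set \<Rightarrow> ('m, 'n) metric \<Rightarrow> ('m, 'n) chart \<Rightarrow> real ^ 'n \<Rightarrow>
    'n \<Rightarrow> 'n \<Rightarrow> 'n \<Rightarrow> real" where
  "christoffel A g c y k i j =
     (1 / 2) * (\<Sum>l\<in>UNIV. matrix_inv (metric_matrix A g c y) $ k $ l *
        (partial_deriv i (\<lambda>z. metric_matrix A g c z $ j $ l) y
         + partial_deriv j (\<lambda>z. metric_matrix A g c z $ i $ l) y
         - partial_deriv l (\<lambda>z. metric_matrix A g c z $ i $ j) y))"

definition gamma_form ::
  "('m, 'n::finite) chart set \<Rightarrow> ('m, 'n) metric \<Rightarrow> ('m, 'n) chart \<Rightarrow> real ^ 'n \<Rightarrow>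
    real ^ 'n \<Rightarrow> real ^ 'n \<Rightarrow> real ^ 'n" where
  "gamma_form A g c y u v =
     (\<chi> k. \<Sum>i\<in>UNIV. \<Sum>j\<in>UNIV. christoffel A g c y k i j * u $ i * v $ j)"

text \<open>The connection and the curvature operator \<open>R(X,Y)Z = [\<nabla>\<^sub>X,\<nabla>\<^sub>Y]Z - \<nabla>\<^bsub>[X,Y]\<^esub>Z\<close> on vector
  fields written in the coordinates of the chart \<open>c\<close>.\<close>

definition nabla_coord ::
  "('m, 'n::finite) chart set \<Rightarrow> ('m, 'n) metric \<Rightarrow> ('m, 'n) chart \<Rightarrow>
    (real ^ 'n \<Rightarrow> real ^ 'n) \<Rightarrow> (real ^ 'n \<Rightarrow> real ^ 'n) \<Rightarrow> real ^ 'n \<Rightarrow> real ^ 'n" where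
  "nabla_coord A g c X Y =
     (\<lambda>y. frechet_derivative Y (at y) (X y) + gamma_form A g c y (X y) (Y y))"

definition lie_bracket ::
  "(real ^ 'n \<Rightarrow> real ^ 'n) \<Rightarrow> (real ^ 'n \<Rightarrow> real ^ 'n) \<Rightarrow> real ^ 'n \<Rightarrow> real ^ 'n::finite" where
  "lie_bracket X Y =
     (\<lambda>y. frechet_derivative Y (at y) (X y) - frechet_derivative X (at y) (Y y))"

definition curvature_coord ::
  "('m, 'n::finite) chart set \<Rightarrow> ('m, 'n) metric \<Rightarrow> ('m, 'n) chart \<Rightarrow>
    (real ^ 'n \<Rightarrow> real ^ 'n) \<Rightarrow> (real ^ 'n \<Rightarrow> real ^ 'n) \<Rightarrow> (real ^ 'n \<Rightarrow> real ^ 'n) \<Rightarrow>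
    real ^ 'n \<Rightarrow> real ^ 'n" where
  "curvature_coord A g c X Y Z =
     (\<lambda>y. nabla_coord A g c X (nabla_coord A g c Y Z) y
        - nabla_coord A g c Y (nabla_coord A g c X Z) y
        - nabla_coord A g c (lie_bracket X Y) Z y)"

text \<open>By tensoriality, \<open>R(u,v)w\<close> can be computed on the fields with constant components.\<close>

definition curvature ::
  "('m, 'n::finite) chart set \<Rightarrow> ('m, 'n) metric \<Rightarrow> 'm \<Rightarrow>
    ('m, 'n) tangent \<Rightarrow> ('m, 'n) tangent \<Rightarrow> ('m, 'n) tangent \<Rightarrow> ('m, 'n) tangent" where
  "curvature A g p u v w =
     (\<lambda>c. if c \<in> charts_at A p
          then curvature_coord A g c (\<lambda>_. u c) (\<lambda>_. v c) (\<lambda>_. w c) (coord c p) else 0)"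

text \<open>\<open>\<nabla>\<^sub>v X\<close> at \<open>p\<close>, for a vector field \<open>X\<close> defined near \<open>p\<close>.\<close>

definition nabla ::
  "('m, 'n::finite) chart set \<Rightarrow> ('m, 'n) metric \<Rightarrow> 'm \<Rightarrow>
    ('m, 'n) tangent \<Rightarrow> ('m \<Rightarrow> ('m, 'n) tangent) \<Rightarrow> ('m, 'n) tangent" where
  "nabla A g p v X =
     (\<lambda>c. if c \<in> charts_at A p
          then nabla_coord A g c (\<lambda>_. v c) (\<lambda>y. X (coord_inv c y) c) (coord c p) else 0)"


section \<open>Geodesics and Jacobi fields\<close>

text \<open>Derivatives are one-sided at the endpoints of \<open>[a,b]\<close>.\<close>

definition velocity ::
  "('m, 'n::finite) chart set \<Rightarrow> real \<Rightarrow> real \<Rightarrow> (real \<Rightarrow> 'm) \<Rightarrow> real \<Rightarrow> ('m, 'n) tangent" where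
  "velocity A a b \<gamma> t =
     (\<lambda>c. if c \<in> charts_at A (\<gamma> t)
          then vector_derivative (\<lambda>s. coord c (\<gamma> s)) (at t within {a..b}) else 0)"

text \<open>\<open>X\<close> is a differentiable vector field along \<open>\<gamma>\<close> with covariant derivative \<open>Y\<close>.\<close>

definition has_cov_deriv ::
  "('m, 'n::finite) chart set \<Rightarrow> ('m, 'n) metric \<Rightarrow> real \<Rightarrow> real \<Rightarrow> (real \<Rightarrow> 'm) \<Rightarrow>
    (real \<Rightarrow> ('m, 'n) tangent) \<Rightarrow> (real \<Rightarrow> ('m, 'n) tangent) \<Rightarrow> bool" where
  "has_cov_deriv A g a b \<gamma> X Y \<longleftrightarrow>
     (\<forall>t\<in>{a..b}. X t \<in> tangent_space A (\<gamma> t) \<and> Y t \<in> tangent_space A (\<gamma> t) \<and>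
        (\<forall>c\<in>charts_at A (\<gamma> t).
           ((\<lambda>s. X s c) has_vector_derivative
              (Y t c - gamma_form A g c (coord c (\<gamma> t)) (velocity A a b \<gamma> t c) (X t c)))
             (at t within {a..b})))"

definition geodesic ::
  "('m::topological_space, 'n::finite) chart set \<Rightarrow> ('m, 'n) metric \<Rightarrow> real \<Rightarrow> real \<Rightarrow>
    (real \<Rightarrow> 'm) \<Rightarrow> bool" where
  "geodesic A g a b \<gamma> \<longleftrightarrow>
     continuous_on {a..b} \<gamma> \<and>
     (\<forall>t\<in>{a..b}. \<forall>c\<in>charts_at A (\<gamma> t).
        (\<lambda>s. coord c (\<gamma> s)) differentiable (at t within {a..b})) \<and>
     has_cov_deriv A g a b \<gamma> (velocity A a b \<gamma>) (\<lambda>t. 0)"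

text \<open>\<open>J\<close> is a Jacobi field along \<open>\<gamma>\<close>, with covariant derivative \<open>J'\<close>.\<close>

definition jacobi_field ::
  "('m, 'n::finite) chart set \<Rightarrow> ('m, 'n) metric \<Rightarrow> real \<Rightarrow> real \<Rightarrow> (real \<Rightarrow> 'm) \<Rightarrow>
    (real \<Rightarrow> ('m, 'n) tangent) \<Rightarrow> (real \<Rightarrow> ('m, 'n) tangent) \<Rightarrow> bool" where
  "jacobi_field A g a b \<gamma> J J' \<longleftrightarrow>
     has_cov_deriv A g a b \<gamma> J J' \<and>
     has_cov_deriv A g a b \<gamma> J'
       (\<lambda>t. curvature A g (\<gamma> t) (velocity A a b \<gamma> t) (J t) (velocity A a b \<gamma> t))"


section \<open>The Lagrangians associated with a geodesic and a submanifold\<close>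

definition symp_space ::
  "('m, 'n::finite) chart set \<Rightarrow> 'm \<Rightarrow> (('m, 'n) tangent \<times> ('m, 'n) tangent) set" where
  "symp_space A p = tangent_space A p \<times> tangent_space A p"

definition symp_form ::
  "('m, 'n) metric \<Rightarrow> 'm \<Rightarrow>
    ('m, 'n) tangent \<times> ('m, 'n) tangent \<Rightarrow> ('m, 'n) tangent \<times> ('m, 'n) tangent \<Rightarrow> real" where
  "symp_form g p = (\<lambda>(v1, w1) (v2, w2). g p v2 w1 - g p v1 w2)"

text \<open>The curve \<open>\<ell>\<close>; the Jacobi field \<open>J\<close> below is the unique one with initial data \<open>(v, w)\<close>.\<close>

definition lag_curve ::
  "('m, 'n::finite) chart set \<Rightarrow> ('m, 'n) metric \<Rightarrow> real \<Rightarrow> real \<Rightarrow> (real \<Rightarrow> 'm) \<Rightarrow>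
    real \<Rightarrow> (('m, 'n) tangent \<times> ('m, 'n) tangent) set" where
  "lag_curve A g a b \<gamma> t =
     {(v, w) \<in> symp_space A (\<gamma> a).
        \<exists>J J'. jacobi_field A g a b \<gamma> J J' \<and> J a = v \<and> J' a = w \<and> J t = 0}"

definition lag_zero ::
  "('m, 'n::finite) chart set \<Rightarrow> 'm \<Rightarrow> (('m, 'n) tangent \<times> ('m, 'n) tangent) set" where
  "lag_zero A p = {0} \<times> tangent_space A p"

definition tangential_extension ::
  "('m::topological_space, 'n::finite) chart set \<Rightarrow> 'm set \<Rightarrow> 'm \<Rightarrow> ('m, 'n) tangent \<Rightarrow>
    'm set \<Rightarrow> ('m \<Rightarrow> ('m, 'n) tangent) \<Rightarrow> bool" where
  "tangential_extension A P p v U X \<longleftrightarrow>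
     open U \<and> p \<in> U \<and> smooth_vector_field_on A U X \<and>
     (\<forall>q\<in>P \<inter> U. X q \<in> subtangent A P q) \<and> X p = v"

text \<open>The operator \<open>S\<close> on the tangent space of \<open>P\<close> at \<open>p\<close> with \<open>g(S v, v') = g(\<nabla>\<^sub>v V', \<nu>)\<close>, that
  is, the second fundamental form in the normal direction \<open>\<nu>\<close>.\<close>

definition shape_operator ::
  "('m::topological_space, 'n::finite) chart set \<Rightarrow> ('m, 'n) metric \<Rightarrow> 'm set \<Rightarrow> 'm \<Rightarrow>
    ('m, 'n) tangent \<Rightarrow> ('m, 'n) tangent \<Rightarrow> ('m, 'n) tangent" where
  "shape_operator A g P p \<nu> v =
     (THE s. s \<in> subtangent A P p \<and>
        (\<forall>v'\<in>subtangent A P p. \<forall>U V'. tangential_extension A P p v' U V' \<longrightarrow>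
           g p s v' = g p (nabla A g p v V') \<nu>))"

definition normal_subspace ::
  "('m, 'n::finite) chart set \<Rightarrow> ('m, 'n) metric \<Rightarrow> 'm set \<Rightarrow> 'm \<Rightarrow> ('m, 'n) tangent set" where
  "normal_subspace A g P p = {w \<in> tangent_space A p. \<forall>v\<in>subtangent A P p. g p w v = 0}"

definition lag_submanifold ::
  "('m::topological_space, 'n::finite) chart set \<Rightarrow> ('m, 'n) metric \<Rightarrow> 'm set \<Rightarrow> 'm \<Rightarrow>
    ('m, 'n) tangent \<Rightarrow> (('m, 'n) tangent \<times> ('m, 'n) tangent) set" where
  "lag_submanifold A g P p \<nu> =
     {(v, w) \<in> symp_space A p.
        v \<in> subtangent A P p \<and> w + shape_operator A g P p \<nu> v \<in> normal_subspace A g P p}"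

definition conjugate_instant ::
  "('m, 'n::finite) chart set \<Rightarrow> ('m, 'n) metric \<Rightarrow> real \<Rightarrow> real \<Rightarrow> (real \<Rightarrow> 'm) \<Rightarrow> real \<Rightarrow> bool" where
  "conjugate_instant A g a b \<gamma> t \<longleftrightarrow>
     t \<in> {a<..b} \<and> lag_curve A g a b \<gamma> t \<inter> lag_zero A (\<gamma> a) \<noteq> {0}"

definition focal_instant ::
  "('m::topological_space, 'n::finite) chart set \<Rightarrow> ('m, 'n) metric \<Rightarrow> 'm set \<Rightarrow>
    real \<Rightarrow> real \<Rightarrow> (real \<Rightarrow> 'm) \<Rightarrow> real \<Rightarrow> bool" where
  "focal_instant A g P a b \<gamma> t \<longleftrightarrow>
     t \<in> {a<..b} \<and>
     lag_curve A g a b \<gamma> t \<inter> lag_submanifold A g P (\<gamma> a) (velocity A a b \<gamma> a) \<noteq> {0}"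

end

theory Submission
  imports Defs
begin

text \<open>Both parts are instances of one estimate. Let \<open>L0\<close> and \<open>L\<close> be Lagrangians in a symplectic space of
  dimension \<open>2n\<close> and let \<open>l\<close> be a path of Lagrangians transverse to \<open>L\<close>. Tilting \<open>L\<close> by a small definite
  form gives a Lagrangian \<open>L1\<close> that is transverse to \<open>L0\<close> and, by compactness, to all of \<open>l\<close>, so that the
  Maslov index of \<open>l\<close> is a difference of two values of \<open>n_plus\<close> in a single chart. If the sign of the tilt is
  chosen well, both forms are positive definite on \<open>L0 \<inter> L\<close>; hence both values lie between
  \<open>dim (L0 \<inter> L)\<close> and \<open>n\<close>, and the index is bounded by \<open>n - dim (L0 \<inter> L)\<close>. For the Lagrangians of the point
  and of the submanifold this number is the dimension of the submanifold, and a symplectic basis adapted to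
  both of them makes the estimate symmetric in the two.

  That the Jacobi data vanishing at \<open>t\<close> form a continuous path of Lagrangians follows from the existence of
  Jacobi fields with prescribed data at any instant (a linear equation in each chart, glued along the
  geodesic), together with the conservation of the symplectic form, which also yields uniqueness.\<close>

section \<open>Symplectic bases and a bound on the Maslov index\<close>

text \<open>Over the span of the \<open>f i\<close>, the path is a family of graphs of matrices
  whose entries are bounded by compactness, while the tilted Lagrangian is the graph of the matrix
  1/\<epsilon> times the identity. For small \<epsilon> the latter dominates every matrix of the
  path. This is why one \<open>L1\<close> serves all instants, and why the chart form has a sign on
  the whole tilted Lagrangian, whatever the path does. Two obstacles shape the rest. The topology on
  Lagrangians is generated by all charts, so continuity of the curve must be checked in charts
  unrelated to any chosen basis; each Lagrangian is therefore presented as the kernel of a linear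
  map that depends continuously on t, and Cramer's rule makes every chart entry continuous.
  Connection and curvature are given by coordinate formulas, so their independence of the chart has
  to be derived; the Koszul identity and the nondegeneracy of the metric reduce this to
  differentiating the invariance of the metric.\<close>

lemma lagrangians_sub: "L \<in> lagrangians V w \<Longrightarrow> subspace L" "L \<in> lagrangians V w \<Longrightarrow> L \<subseteq> V"
  "L \<in> lagrangians V w \<Longrightarrow> v \<in> L \<longleftrightarrow> v \<in> V \<and> (\<forall>u\<in>L. w v u = 0)"
  by (auto simp: lagrangians_def)

text \<open>The double sum is at most \<open>M\<close> times the square of the sum of the absolute
  values of \<open>a\<close>; the factor \<open>CARD('n)\<close> is Cauchy-Schwarz against the
  all-ones vector.\<close>

lemma quadratic_form_bound:
  fixes a :: "'n::finite \<Rightarrow> real"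
  assumes "\<And>i j. \<bar>q i j\<bar> \<le> M"
  shows "\<bar>\<Sum>i\<in>UNIV. \<Sum>j\<in>UNIV. a i * a j * q i j\<bar> \<le> M * CARD('n) * (\<Sum>i\<in>UNIV. (a i)\<^sup>2)"
proof -
  have M: "0 \<le> M" using assms[of undefined undefined] by linarith
  have "\<bar>\<Sum>i\<in>UNIV. \<Sum>j\<in>UNIV. a i * a j * q i j\<bar> \<le> (\<Sum>i\<in>UNIV. \<Sum>j\<in>UNIV. \<bar>a i * a j * q i j\<bar>)"
    by (intro order_trans[OF sum_abs] sum_mono order_refl)
  also have "\<dots> \<le> (\<Sum>i\<in>UNIV. \<Sum>j\<in>UNIV. M * (\<bar>a i\<bar> * \<bar>a j\<bar>))"
  proof (intro sum_mono)
    fix i j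
    show "\<bar>a i * a j * q i j\<bar> \<le> M * (\<bar>a i\<bar> * \<bar>a j\<bar>)"
      using mult_left_mono[OF assms[of i j], of "\<bar>a i\<bar> * \<bar>a j\<bar>"] by (simp add: abs_mult mult.commute)
  qed
  also have "\<dots> = M * (\<Sum>i\<in>UNIV. \<bar>a i\<bar>)\<^sup>2"
    unfolding power2_eq_square sum_product by (simp only: sum_distrib_left)
  also have "\<dots> \<le> M * (CARD('n) * (\<Sum>i\<in>UNIV. (a i)\<^sup>2))"
    using Cauchy_Schwarz_ineq_sum[of "\<lambda>_. 1::real" "\<lambda>i. \<bar>a i\<bar>" UNIV] M
    by (intro mult_left_mono) auto
  finally show ?thesis by (simp add: mult.assoc)
qed

text \<open>For the first half \<open>h = e\<close> of a symplectic basis this is the span of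
  \<open>e\<close>. Equations instead of spans make membership and transversality coordinatewise
  checks.\<close>

definition annihilator :: "'v::real_vector set \<Rightarrow> ('v \<Rightarrow> 'v \<Rightarrow> real) \<Rightarrow> ('n \<Rightarrow> 'v) \<Rightarrow> 'v set" where
  "annihilator V w h = {z \<in> V. \<forall>i. w (h i) z = 0}"

text \<open>The coordinates of \<open>z\<close> are \<open>w z (f i)\<close> along
  \<open>e i\<close> and \<open>w (e i) z\<close> along \<open>f i\<close>. Spanning is expressed by
  \<open>expand\<close>, so no dimension of \<open>V\<close> has to be mentioned.\<close>

locale symplectic_basis =
  fixes V :: "'v::real_vector set" and w :: "'v \<Rightarrow> 'v \<Rightarrow> real" and e f :: "'n::finite \<Rightarrow> 'v"
  assumes V: "subspace V"
    and w_add: "\<And>x y z. x \<in> V \<Longrightarrow> y \<in> V \<Longrightarrow> z \<in> V \<Longrightarrow> w (x + y) z = w x z + w y z"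
    and w_scale: "\<And>r x z. x \<in> V \<Longrightarrow> z \<in> V \<Longrightarrow> w (r *\<^sub>R x) z = r * w x z"
    and w_skew: "\<And>x y. x \<in> V \<Longrightarrow> y \<in> V \<Longrightarrow> w x y = - w y x"
    and e_in [simp]: "\<And>i. e i \<in> V" and f_in [simp]: "\<And>i. f i \<in> V"
    and ee: "\<And>i j. w (e i) (e j) = 0" and ff: "\<And>i j. w (f i) (f j) = 0"
    and ef: "\<And>i j. w (e i) (f j) = of_bool (i = j)"
    and expand: "\<And>z. z \<in> V \<Longrightarrow> z = (\<Sum>i\<in>UNIV. w z (f i) *\<^sub>R e i + w (e i) z *\<^sub>R f i)"
begin

lemma fe: "w (f i) (e j) = - of_bool (i = j)"
  using w_skew[of "f i" "e j"] ef[of j i] by auto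

lemma w_0 [simp]: "z \<in> V \<Longrightarrow> w 0 z = 0"
  using w_scale[of z z 0] by simp

lemma w_0_right [simp]: "z \<in> V \<Longrightarrow> w z 0 = 0"
  using w_skew[of z 0] subspace_0[OF V] by simp

lemma w_add_right: "x \<in> V \<Longrightarrow> y \<in> V \<Longrightarrow> z \<in> V \<Longrightarrow> w z (x + y) = w z x + w z y"
  using w_add[of x y z] w_skew[of z] subspace_add[OF V] by simp

lemma w_scale_right: "x \<in> V \<Longrightarrow> z \<in> V \<Longrightarrow> w z (r *\<^sub>R x) = r * w z x"
  using w_scale[of x z r] w_skew[of z] subspace_scale[OF V] by simp

lemma w_minus: "x \<in> V \<Longrightarrow> z \<in> V \<Longrightarrow> w (- x) z = - w x z"
  using w_scale[of x z "-1"] by simp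

lemma w_minus_right: "x \<in> V \<Longrightarrow> z \<in> V \<Longrightarrow> w z (- x) = - w z x"
  using w_scale_right[of x z "-1"] by simp

lemma w_diff_right: "x \<in> V \<Longrightarrow> y \<in> V \<Longrightarrow> z \<in> V \<Longrightarrow> w z (x - y) = w z x - w z y"
  using w_add_right[of x "- y" z] w_minus_right[of y z] subspace_neg[OF V] by simp

lemma w_sum: "(\<And>i. i \<in> S \<Longrightarrow> h i \<in> V) \<Longrightarrow> z \<in> V \<Longrightarrow> w (\<Sum>i\<in>S. c i *\<^sub>R h i) z = (\<Sum>i\<in>S. c i * w (h i) z)"
proof (induction S rule: infinite_finite_induct)
  case (insert x F)
  then show ?case
    by (simp add: w_add w_scale subspace_scale[OF V] subspace_sum[OF V])
qed auto

lemma w_expand: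
  assumes "x \<in> V" "y \<in> V"
  shows "w x y = (\<Sum>i\<in>UNIV. w x (f i) * w (e i) y - w (e i) x * w y (f i))"
proof -
  have "w x y = w ((\<Sum>i\<in>UNIV. w x (f i) *\<^sub>R e i) + (\<Sum>i\<in>UNIV. w (e i) x *\<^sub>R f i)) y"
    using expand[OF assms(1)] by (simp add: sum.distrib)
  also have "\<dots> = (\<Sum>i\<in>UNIV. w x (f i) * w (e i) y) + (\<Sum>i\<in>UNIV. w (e i) x * w (f i) y)"
    using assms by (simp add: w_add w_sum subspace_sum[OF V] subspace_scale[OF V])
  also have "\<dots> = (\<Sum>i\<in>UNIV. w x (f i) * w (e i) y - w (e i) x * w y (f i))"
    unfolding sum.distrib[symmetric] using assms w_skew[of y] by (intro sum.cong) auto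
  finally show ?thesis .
qed

lemma eq_0I:
  assumes "z \<in> V" "\<And>i. w (e i) z = 0" "\<And>i. w z (f i) = 0"
  shows "z = 0"
  using expand[OF assms(1)] assms(2,3) by simp

lemma annihilator_subspace: "subspace (annihilator V w e)"
  using V by (auto simp: annihilator_def subspace_def w_add_right w_scale_right)

lemma annihilator_in: "annihilator V w e \<subseteq> V"
  by (auto simp: annihilator_def)

lemma e_in_annihilator: "e i \<in> annihilator V w e"
  by (simp add: annihilator_def ee)

lemma annihilator_expand: "z \<in> annihilator V w e \<Longrightarrow> z = (\<Sum>i\<in>UNIV. w z (f i) *\<^sub>R e i)"
  using expand[of z] by (simp add: annihilator_def)

lemma annihilator_lagrangian: "annihilator V w e \<in> lagrangians V w"
proof -
  have "w v u = 0" if "v \<in> annihilator V w e" "u \<in> annihilator V w e" for u v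
    using w_expand[of v u] that by (simp add: annihilator_def)
  moreover have "v \<in> annihilator V w e" if "v \<in> V" "\<forall>u\<in>annihilator V w e. w v u = 0" for v
  proof -
    have "w (e i) v = 0" for i
      using that e_in_annihilator[of i] w_skew[OF e_in that(1), of i] by simp
    then show ?thesis using that(1) by (simp add: annihilator_def)
  qed
  ultimately have "annihilator V w e = {v \<in> V. \<forall>u\<in>annihilator V w e. w v u = 0}"
    using annihilator_in by blast
  then show ?thesis
    using annihilator_subspace annihilator_in unfolding lagrangians_def by blast
qed

text \<open>A quarter turn in the coordinate planes with index in \<open>K\<close> is symplectic. It
  yields the mixed coordinate Lagrangians, and for \<open>K = UNIV\<close> it exchanges the roles of
  \<open>e\<close> and \<open>f\<close>.\<close>

lemma swap:
  "symplectic_basis V w (\<lambda>i. if i \<in> K then f i else e i) (\<lambda>i. if i \<in> K then - e i else f i)"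
proof
  fix z assume z: "z \<in> V"
  show "z = (\<Sum>i\<in>UNIV. w z (if i \<in> K then - e i else f i) *\<^sub>R (if i \<in> K then f i else e i) +
           w (if i \<in> K then f i else e i) z *\<^sub>R (if i \<in> K then - e i else f i))"
    using w_skew[OF z] z
    by (subst expand[OF z], intro sum.cong) (auto simp: w_minus_right)
next
  fix x y assume "x \<in> V" "y \<in> V"
  then show "w x y = - w y x" by (rule w_skew)
qed (use V in \<open>auto simp: w_add w_scale w_minus w_minus_right ee ff ef fe subspace_neg\<close>)

text \<open>A shear is symplectic. The annihilator of the sheared first half consists of the vectors
  whose \<open>f\<close>-coordinates are \<epsilon> times their
  \<open>e\<close>-coordinates.\<close>

lemma tilt: "symplectic_basis V w (\<lambda>i. e i + \<epsilon> *\<^sub>R f i) f"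
proof
  fix z assume z: "z \<in> V"
  have "w (e i + \<epsilon> *\<^sub>R f i) z = w (e i) z - \<epsilon> * w z (f i)" for i
    using z w_skew[of "f i" z] by (simp add: w_add w_scale subspace_scale[OF V])
  then show "z = (\<Sum>i\<in>UNIV. w z (f i) *\<^sub>R (e i + \<epsilon> *\<^sub>R f i) + w (e i + \<epsilon> *\<^sub>R f i) z *\<^sub>R f i)"
    by (subst expand[OF z], intro sum.cong) (auto simp: scaleR_add_right scaleR_diff_left)
next
  fix x y assume "x \<in> V" "y \<in> V"
  then show "w x y = - w y x" by (rule w_skew)
qed (use V in \<open>auto simp: w_add w_scale w_add_right w_scale_right ee ff ef fe subspace_add subspace_scale\<close>)

text \<open>A vector orthogonal to the image would give a nonzero combination of the
  \<open>e i\<close> that is \<open>w\<close>-orthogonal to \<open>L\<close>; it then belongs to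
  \<open>L\<close>, which is its own annihilator, against transversality. So transverse Lagrangians
  are complementary without a count of dimensions.\<close>

lemma transverse_surj:
  assumes L: "L \<in> lagrangians V w" and tr: "transverse L (annihilator V w e)"
  obtains z where "z \<in> L" "\<And>i. w (e i) z = y i"
proof -
  define \<Phi> where "\<Phi> z = (\<chi> i. w (e i) z)" for z
  note LV = lagrangians_sub(2)[OF L] and sub = lagrangians_sub(1)[OF L]
  have "subspace (\<Phi> ` L)"
  proof -
    have "\<Phi> 0 = 0" by (simp add: \<Phi>_def vec_eq_iff)
    moreover have "\<Phi> x + \<Phi> y = \<Phi> (x + y)" if "x \<in> L" "y \<in> L" for x y
      using that LV by (simp add: \<Phi>_def vec_eq_iff w_add_right subsetD)
    moreover have "c *\<^sub>R \<Phi> x = \<Phi> (c *\<^sub>R x)" if "x \<in> L" for x c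
      using that LV by (simp add: \<Phi>_def vec_eq_iff w_scale_right subsetD)
    ultimately show ?thesis
      using sub unfolding subspace_def by (auto simp: image_iff)
  qed
  then have sp: "span (\<Phi> ` L) = \<Phi> ` L" by simp
  have "\<Phi> ` L = UNIV"
  proof (rule ccontr)
    assume "\<Phi> ` L \<noteq> UNIV"
    then obtain a where a: "a \<noteq> 0" "\<And>x. x \<in> \<Phi> ` L \<Longrightarrow> a \<bullet> x = 0"
      using span_not_UNIV_orthogonal[of "\<Phi> ` L"] sp by auto
    define s where "s = (\<Sum>i\<in>UNIV. a $ i *\<^sub>R e i)"
    have sE: "s \<in> annihilator V w e"
      unfolding s_def by (intro subspace_sum[OF annihilator_subspace] subspace_scale[OF annihilator_subspace] e_in_annihilator)
    then have sV: "s \<in> V" by (simp add: annihilator_def)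
    have "w s u = 0" if "u \<in> L" for u
    proof -
      have "w s u = (\<Sum>i\<in>UNIV. a $ i * w (e i) u)"
        unfolding s_def using that LV by (intro w_sum) auto
      also have "\<dots> = a \<bullet> \<Phi> u" by (simp add: inner_vec_def \<Phi>_def)
      finally show ?thesis using a(2) that by auto
    qed
    then have "s \<in> L" using sV by (intro lagrangians_sub(3)[OF L, THEN iffD2] conjI ballI)
    then have "s = 0" using sE tr by (auto simp: transverse_def)
    moreover have "w s (f j) = a $ j" for j
      unfolding s_def by (subst w_sum) (auto simp: ef if_distrib of_bool_def cong: if_cong)
    ultimately have "a = 0" by (simp add: vec_eq_iff)
    then show False using a(1) by simp
  qed
  then obtain z where "z \<in> L" "\<Phi> z = (\<chi> i. y i)" by (metis UNIV_I imageE)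
  then show thesis using that[of z] by (auto simp: \<Phi>_def vec_eq_iff)
qed

text \<open>This gives meaning to the definite description in \<open>lag_chart\<close>: surjectivity
  provides the vector, transversality its uniqueness.\<close>

lemma transverse_chart:
  assumes L: "L \<in> lagrangians V w" and tr: "transverse L (annihilator V w e)" and u: "u \<in> V"
  defines "x \<equiv> THE x. x \<in> annihilator V w e \<and> u + x \<in> L"
  shows "x \<in> annihilator V w e" "u + x \<in> L"
    and "\<And>y. y \<in> annihilator V w e \<Longrightarrow> u + y \<in> L \<Longrightarrow> y = x"
proof -
  note LV = lagrangians_sub(2)[OF L] and sub = lagrangians_sub(1)[OF L]
  obtain z where z: "z \<in> L" "\<And>i. w (e i) z = w (e i) u"
    using transverse_surj[OF L tr, of "\<lambda>i. w (e i) u"] by auto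
  have 1: "z - u \<in> annihilator V w e"
    using z LV u by (auto simp: annihilator_def w_diff_right subspace_diff[OF V] subsetD)
  have unique: "y = y'" if "y \<in> annihilator V w e" "u + y \<in> L" "y' \<in> annihilator V w e" "u + y' \<in> L" for y y'
  proof -
    have "y - y' \<in> annihilator V w e"
      using that subspace_diff[OF annihilator_subspace] by blast
    moreover have "y - y' \<in> L"
      using subspace_diff[OF sub that(2,4)] by simp
    ultimately have "y - y' = 0" using tr unfolding transverse_def by blast
    then show ?thesis by simp
  qed
  have "\<exists>!x. x \<in> annihilator V w e \<and> u + x \<in> L"
  proof (rule ex1I[of _ "z - u"])
    show 2: "z - u \<in> annihilator V w e \<and> u + (z - u) \<in> L" using 1 z(1) by simp
    show "y = z - u" if "y \<in> annihilator V w e \<and> u + y \<in> L" for y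
      using unique[of y "z - u"] that 2 by blast
  qed
  from theI'[OF this] show x: "x \<in> annihilator V w e" "u + x \<in> L" unfolding x_def by blast+
  show "y = x" if "y \<in> annihilator V w e" "u + y \<in> L" for y
    using unique that x by blast
qed

text \<open>The vectors \<open>f i + \<beta> i\<close> lie in \<open>L\<close>. Their combination
  with the \<open>f\<close>-coordinates of \<open>z\<close> differs from \<open>z\<close> by an
  element of both \<open>L\<close> and the annihilator of \<open>e\<close>, hence equals
  \<open>z\<close>; comparing \<open>e\<close>-coordinates gives the equation.\<close>

lemma graph_equation:
  assumes L: "L \<in> lagrangians V w" and tr: "transverse L (annihilator V w e)" and z: "z \<in> L"
  shows "w z (f j) = (\<Sum>i\<in>UNIV. w (e i) z * lag_chart w (annihilator V w f) (annihilator V w e) L (f i) (f j))"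
proof -
  note LV = lagrangians_sub(2)[OF L] and sub = lagrangians_sub(1)[OF L]
  define \<beta> where "\<beta> i = (THE x. x \<in> annihilator V w e \<and> f i + x \<in> L)" for i
  note \<beta> = transverse_chart[OF L tr f_in, folded \<beta>_def]
  have \<beta>V [simp]: "\<beta> i \<in> V" for i using \<beta>(1)[of i] by (simp add: annihilator_def)
  have [simp]: "f i + \<beta> i \<in> V" for i by (simp add: subspace_add[OF V])
  define s where "s = (\<Sum>i\<in>UNIV. w (e i) z *\<^sub>R (f i + \<beta> i))"
  have sL: "s \<in> L" unfolding s_def
    by (intro subspace_sum[OF sub] subspace_scale[OF sub] \<beta>(2))
  have zV: "z \<in> V" and sV: "s \<in> V" using z sL LV by auto
  have "w s (e j) = - w (e j) z" for j
  proof -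
    have *: "w (f i + \<beta> i) (e j) = - of_bool (i = j)" for i
      using \<beta>(1)[of i] w_skew[of "\<beta> i" "e j"] by (simp add: w_add fe annihilator_def)
    have "w s (e j) = (\<Sum>i\<in>UNIV. w (e i) z * w (f i + \<beta> i) (e j))"
      unfolding s_def by (intro w_sum) auto
    then show ?thesis
      by (simp add: * if_distrib of_bool_def sum_negf cong: if_cong)
  qed
  then have "w (e j) s = w (e j) z" for j using w_skew[OF sV, of "e j"] by simp
  then have "z - s \<in> annihilator V w e"
    using zV sV by (simp add: annihilator_def w_diff_right subspace_diff[OF V])
  moreover have "z - s \<in> L" using z sL sub subspace_diff by blast
  ultimately have "z - s = 0" using tr unfolding transverse_def by blast
  then have "w z (f j) = w s (f j)" by (metis eq_iff_diff_eq_0)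
  also have "\<dots> = (\<Sum>i\<in>UNIV. w (e i) z * w (f i + \<beta> i) (f j))"
    unfolding s_def by (intro w_sum) auto
  finally show ?thesis by (simp add: w_add ff lag_chart_def \<beta>_def[symmetric])
qed

text \<open>With \<open>e\<close>-coordinates a and \<open>f\<close>-coordinates b, the graph
  equation writes \<open>L\<close> as a = q b (up to transposing q), and \<open>L1\<close> is b =
  \<epsilon> a. On the intersection a = \<epsilon> q a, which forces a = 0 for small \<epsilon>. On
  the annihilator of \<open>e\<close> the chart form turns out to be \<epsilon> times (|a|^2 -
  \<epsilon> q(a,a)), where a belongs to the component in \<open>L1\<close>. Its value is determined
  by \<open>L1\<close> and \<open>L\<close>, so \<open>L0\<close> may stay arbitrary.\<close>

lemma tilted_chart:
  assumes L: "L \<in> lagrangians V w" and tr: "transverse L (annihilator V w e)"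
    and M: "\<And>i j. \<bar>lag_chart w (annihilator V w f) (annihilator V w e) L (f i) (f j)\<bar> \<le> M"
    and eps: "0 < \<epsilon>" "\<epsilon> * (M * CARD('n)) < 1"
  defines "L1 \<equiv> annihilator V w (\<lambda>i. e i + \<epsilon> *\<^sub>R f i)"
  shows "transverse L L1"
    and "\<And>u. u \<in> annihilator V w e \<Longrightarrow> u \<noteq> 0 \<Longrightarrow> lag_chart w L0 L1 L u u > 0"
proof -
  interpret T: symplectic_basis V w "\<lambda>i. e i + \<epsilon> *\<^sub>R f i" f by (rule tilt)
  note LV = lagrangians_sub(2)[OF L] and sub = lagrangians_sub(1)[OF L]
  define q where "q i j = lag_chart w (annihilator V w f) (annihilator V w e) L (f i) (f j)" for i j
  have L1: "z \<in> L1 \<longleftrightarrow> z \<in> V \<and> (\<forall>i. w (e i) z = \<epsilon> * w z (f i))" for z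
  proof -
    have "w (e i + \<epsilon> *\<^sub>R f i) z = w (e i) z - \<epsilon> * w z (f i)" if "z \<in> V" for i
      using that w_skew[of "f i" z] by (simp add: w_add w_scale subspace_scale[OF V])
    then show ?thesis by (auto simp: L1_def annihilator_def)
  qed
  have pos: "(\<Sum>j\<in>UNIV. (a j)\<^sup>2) - \<epsilon> * (\<Sum>i\<in>UNIV. \<Sum>j\<in>UNIV. a i * a j * q i j) > 0"
    if "a i \<noteq> 0" for a i
  proof -
    let ?s = "\<Sum>j\<in>UNIV. (a j)\<^sup>2"
    have "(a i)\<^sup>2 \<le> ?s" by (rule member_le_sum) auto
    then have s: "?s > 0" using that by (smt (verit) zero_less_power2)
    have "\<epsilon> * (\<Sum>i\<in>UNIV. \<Sum>j\<in>UNIV. a i * a j * q i j) \<le> \<epsilon> * (M * CARD('n) * ?s)"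
      using quadratic_form_bound[of q M a] M eps(1) unfolding q_def[symmetric]
      by (intro mult_left_mono) auto
    also have "\<dots> = (\<epsilon> * (M * CARD('n))) * ?s" by simp
    also have "\<dots> < 1 * ?s" using eps(2) s by (intro mult_strict_right_mono)
    finally show ?thesis by simp
  qed
  have L1_0: "z = 0" if "z \<in> L1" "\<And>i. w z (f i) = 0" for z
    using that L1[of z] by (intro eq_0I) auto
  have 0: "0 \<in> L" "0 \<in> L1" using subspace_0 sub T.annihilator_subspace by (auto simp: L1_def)
  show tr1: "transverse L L1"
  proof -
    have "z = 0" if z: "z \<in> L" "z \<in> L1" for z
    proof (rule L1_0[OF z(2)], rule ccontr)
      fix i assume i: "w z (f i) \<noteq> 0"
      have eq: "w z (f j) = (\<Sum>i\<in>UNIV. \<epsilon> * w z (f i) * q i j)" for j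
        using graph_equation[OF L tr z(1), of j] L1[of z] z(2) by (simp add: q_def)
      have "(\<Sum>j\<in>UNIV. (w z (f j))\<^sup>2) = (\<Sum>j\<in>UNIV. w z (f j) * (\<Sum>i\<in>UNIV. \<epsilon> * w z (f i) * q i j))"
        by (simp add: power2_eq_square eq[symmetric])
      also have "\<dots> = \<epsilon> * (\<Sum>j\<in>UNIV. \<Sum>i\<in>UNIV. w z (f i) * w z (f j) * q i j)"
        by (simp add: sum_distrib_left algebra_simps)
      also have "\<dots> = \<epsilon> * (\<Sum>i\<in>UNIV. \<Sum>j\<in>UNIV. w z (f i) * w z (f j) * q i j)"
        by (subst sum.swap) simp
      finally show False using pos[of "\<lambda>i. w z (f i)" i, OF i] by simp
    qed
    then show ?thesis using 0 by (auto simp: transverse_def)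
  qed
  fix u assume u: "u \<in> annihilator V w e" "u \<noteq> 0"
  then have uV: "u \<in> V" by (simp add: annihilator_def)
  define t where "t = (THE x. x \<in> L1 \<and> u + x \<in> L)"
  have t: "t \<in> L1" "u + t \<in> L"
    using T.transverse_chart(1,2)[OF L tr1[unfolded L1_def] uV] unfolding t_def L1_def by blast+
  then have tV: "t \<in> V" using L1 by blast
  define a where "a i = w t (f i)" for i
  have b: "w (e i) t = \<epsilon> * a i" for i using L1 t(1) by (simp add: a_def)
  \<comment> \<open>As \<open>u\<close> has no \<open>f\<close>-coordinates, the graph equation for
    \<open>u + t\<close> yields the \<open>e\<close>-coordinates of \<open>u\<close>.\<close>
  have au: "w u (f j) = \<epsilon> * (\<Sum>i\<in>UNIV. a i * q i j) - a j" for j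
    using graph_equation[OF L tr t(2), of j] u(1) uV tV
    by (simp add: w_add w_add_right annihilator_def b q_def a_def[symmetric] sum_distrib_left mult.assoc)
  have "w t u = - (\<Sum>j\<in>UNIV. \<epsilon> * a j * (\<epsilon> * (\<Sum>i\<in>UNIV. a i * q i j) - a j))"
    using w_expand[OF tV uV] u(1) by (simp add: annihilator_def b au sum_negf)
  also have "\<dots> = \<epsilon> * ((\<Sum>j\<in>UNIV. (a j)\<^sup>2) - \<epsilon> * (\<Sum>j\<in>UNIV. \<Sum>i\<in>UNIV. a i * a j * q i j))"
    by (simp add: sum_distrib_left right_diff_distrib sum_subtractf power2_eq_square algebra_simps)
  also have "\<dots> = \<epsilon> * ((\<Sum>j\<in>UNIV. (a j)\<^sup>2) - \<epsilon> * (\<Sum>i\<in>UNIV. \<Sum>j\<in>UNIV. a i * a j * q i j))"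
    by (subst sum.swap) simp
  also have "\<dots> > 0"
  proof -
    have "\<exists>i. a i \<noteq> 0"
    proof (rule ccontr)
      assume "\<nexists>i. a i \<noteq> 0"
      then have "t = 0" using L1_0[OF t(1)] by (simp add: a_def)
      then have "u \<in> L" using t(2) by simp
      then show False using u tr by (auto simp: transverse_def)
    qed
    then show ?thesis using pos[of a] eps(1) by auto
  qed
  finally show "lag_chart w L0 L1 L u u > 0" by (simp add: lag_chart_def t_def)
qed

section \<open>Bounds for the number of positive directions\<close>

lemma dim_annihilator_le: "U \<subseteq> annihilator V w e \<Longrightarrow> dim U \<le> CARD('n)"
proof -
  assume U: "U \<subseteq> annihilator V w e"
  have "z \<in> span (range e)" if "z \<in> annihilator V w e" for z
    by (subst annihilator_expand[OF that]) (auto intro!: span_sum span_scale intro: span_base)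
  then have "dim U \<le> card (range e)" using U by (intro dim_le_card) auto
  then show ?thesis using card_image_le[of UNIV e] by simp
qed

lemma dim_span_e: "dim (span (e ` S)) = card S"
proof -
  have inj: "inj e"
  proof (rule injI)
    fix i j assume "e i = e j"
    then have "w (e i) (f i) = w (e j) (f i)" by simp
    then show "i = j" by (auto simp: ef split: if_splits)
  qed
  have "independent (e ` S)"
  proof (rule independent_if_scalars_zero)
    fix c x assume s: "(\<Sum>x\<in>e ` S. c x *\<^sub>R x) = 0" and "x \<in> e ` S"
    then obtain j where j: "j \<in> S" "x = e j" by auto
    have "(\<Sum>x\<in>e ` S. c x *\<^sub>R x) = (\<Sum>i\<in>S. c (e i) *\<^sub>R e i)"
      by (subst sum.reindex) (auto intro: inj_on_subset[OF inj])
    then have "w (\<Sum>i\<in>S. c (e i) *\<^sub>R e i) (f j) = 0" using s by simp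
    then have "(\<Sum>i\<in>S. c (e i) * of_bool (i = j)) = 0" by (subst (asm) w_sum) (auto simp: ef)
    then show "c x = 0" using j by (simp add: of_bool_def if_distrib cong: if_cong)
  qed simp
  then have "dim (span (e ` S)) = card (e ` S)" using dim_eq_card_independent by simp
  then show ?thesis by (simp add: card_image inj_on_subset[OF inj])
qed

text \<open>\<open>n_plus\<close> is a \<open>Max\<close>, which can be used only once its set of
  dimensions is known to be finite and nonempty. The number of basis vectors and the zero subspace
  provide this.\<close>

lemma n_plus_le: "n_plus (annihilator V w e) B \<le> CARD('n)"
  and n_plus_ge: "\<lbrakk>subspace U; U \<subseteq> annihilator V w e; \<And>u. u \<in> U \<Longrightarrow> u \<noteq> 0 \<Longrightarrow> B u u > 0\<rbrakk>
    \<Longrightarrow> dim U \<le> n_plus (annihilator V w e) B"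
proof -
  let ?D = "{dim U |U. subspace U \<and> U \<subseteq> annihilator V w e \<and> (\<forall>u\<in>U. u \<noteq> 0 \<longrightarrow> - B u u < 0)}"
  have sub: "?D \<subseteq> {..CARD('n)}" using dim_annihilator_le by auto
  then have fin: "finite ?D" by (rule finite_subset) simp
  have "dim {0 :: 'v} \<in> ?D" using subspace_0[OF annihilator_subspace]
    by (intro CollectI exI[of _ "{0}"]) auto
  then have "Max ?D \<in> ?D" using fin by (intro Max_in) auto
  then show "n_plus (annihilator V w e) B \<le> CARD('n)" using sub by (auto simp: n_plus_def n_minus_def)
  show "dim U \<le> n_plus (annihilator V w e) B" if "subspace U" "U \<subseteq> annihilator V w e"
    "\<And>u. u \<in> U \<Longrightarrow> u \<noteq> 0 \<Longrightarrow> B u u > 0"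
    unfolding n_plus_def n_minus_def using that by (intro Max_ge[OF fin]) auto
qed

text \<open>The generating sets of the topology are preimages of open sets under chart entries, so a
  continuous path has continuous chart entries; and they consist of Lagrangians, so the path does
  too.\<close>

lemma continuous_on_lag_chart:
  assumes path: "lagrangian_path V w a b l"
    and tr: "\<And>t. t \<in> {a..b} \<Longrightarrow> transverse (l t) (annihilator V w e)"
  shows "continuous_on {a..b} (\<lambda>t. lag_chart w (annihilator V w f) (annihilator V w e) (l t) (f i) (f j))"
    and "\<And>t. t \<in> {a..b} \<Longrightarrow> l t \<in> lagrangians V w"
proof -
  interpret F: symplectic_basis V w f "\<lambda>i. - e i"
    using swap[of UNIV] by simp
  let ?E = "annihilator V w e" and ?F = "annihilator V w f"
  have tEF: "transverse ?F ?E"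
  proof -
    have "z = 0" if "z \<in> ?E" "z \<in> ?F" for z
      using that w_skew[of z] by (intro eq_0I) (auto simp: annihilator_def)
    then show ?thesis
      using subspace_0[OF annihilator_subspace] subspace_0[OF F.annihilator_subspace]
      by (auto simp: transverse_def)
  qed
  let ?G = "\<lambda>S. {L \<in> lagrangians V w. transverse L ?E \<and> lag_chart w ?F ?E L (f i) (f j) \<in> S}"
  have gen: "openin (lagrangian_topology V w) (?G S)" if "open S" for S
    unfolding lagrangian_topology_def
    by (rule topology_generated_by_Basis)
      (use that annihilator_lagrangian F.annihilator_lagrangian tEF F.e_in_annihilator in blast)
  have cm: "continuous_map (top_of_set {a..b}) (lagrangian_topology V w) l"
    using path by (simp add: lagrangian_path_def)
  show lag: "l t \<in> lagrangians V w" if "t \<in> {a..b}" for t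
  proof -
    have "l t \<in> topspace (lagrangian_topology V w)"
      using continuous_map_funspace[OF cm] that by auto
    then show ?thesis
      unfolding lagrangian_topology_def topology_generated_by_topspace by auto
  qed
  have "openin (top_of_set {a..b}) ({a..b} \<inter> (\<lambda>t. lag_chart w ?F ?E (l t) (f i) (f j)) -` S)"
    if "open S" for S
  proof -
    have "openin (top_of_set {a..b}) {t \<in> topspace (top_of_set {a..b}). l t \<in> ?G S}"
      by (rule openin_continuous_map_preimage[OF cm gen[OF that]])
    also have "{t \<in> topspace (top_of_set {a..b}). l t \<in> ?G S} =
        {a..b} \<inter> (\<lambda>t. lag_chart w ?F ?E (l t) (f i) (f j)) -` S"
      using lag tr by auto
    finally show ?thesis .
  qed
  then show "continuous_on {a..b} (\<lambda>t. lag_chart w ?F ?E (l t) (f i) (f j))"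
    by (simp add: continuous_openin_preimage_eq)
qed

theorem maslov_index_bound:
  assumes mu: "is_maslov_index V w \<mu>" and ab: "a \<le> b"
    and path: "lagrangian_path V w a b l"
    and tr: "\<And>t. t \<in> {a..b} \<Longrightarrow> transverse (l t) (annihilator V w e)"
  shows "\<bar>\<mu> (annihilator V w (\<lambda>i. if i \<in> K then f i else e i)) a b l\<bar> \<le> int (card K)"
proof -
  interpret K: symplectic_basis V w "\<lambda>i. if i \<in> K then f i else e i" "\<lambda>i. if i \<in> K then - e i else f i"
    by (rule swap)
  define L0 where "L0 = annihilator V w (\<lambda>i. if i \<in> K then f i else e i)"
  define q where "q t i j = lag_chart w (annihilator V w f) (annihilator V w e) (l t) (f i) (f j)" for t i j
  have lag: "l t \<in> lagrangians V w" if "t \<in> {a..b}" for t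
    using continuous_on_lag_chart(2)[OF path tr that] .
  have "\<exists>M. \<forall>t\<in>{a..b}. \<bar>q t i j\<bar> \<le> M" for i j
  proof -
    have "bounded ((\<lambda>t. q t i j) ` {a..b})"
      unfolding q_def
      by (intro compact_imp_bounded compact_continuous_image continuous_on_lag_chart(1)[OF path tr] compact_Icc)
    then show ?thesis by (simp add: bounded_real)
  qed
  then obtain m where m: "\<And>i j t. t \<in> {a..b} \<Longrightarrow> \<bar>q t i j\<bar> \<le> m i j" by metis
  define M where "M = (\<Sum>i\<in>UNIV. \<Sum>j\<in>UNIV. \<bar>m i j\<bar>)"
  have M: "\<bar>q t i j\<bar> \<le> M" if "t \<in> {a..b}" for t i j
  proof -
    have "\<bar>m i j\<bar> \<le> (\<Sum>j\<in>UNIV. \<bar>m i j\<bar>)" by (rule member_le_sum) auto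
    also have "\<dots> \<le> M" unfolding M_def
      by (rule member_le_sum[where f = "\<lambda>i. \<Sum>j\<in>UNIV. \<bar>m i j\<bar>"]) (auto intro: sum_nonneg)
    finally show ?thesis using m[OF that, of i j] by linarith
  qed
  have M0: "M \<ge> 0" unfolding M_def by (intro sum_nonneg) auto
  \<comment> \<open>The added 1 covers \<open>M = 0\<close>.\<close>
  define \<epsilon> where "\<epsilon> = 1 / (M * CARD('n) + 1)"
  have eps: "0 < \<epsilon>" "\<epsilon> * (M * CARD('n)) < 1"
  proof -
    have "M * CARD('n) \<ge> 0" using M0 by simp
    then show "0 < \<epsilon>" "\<epsilon> * (M * CARD('n)) < 1" by (auto simp: \<epsilon>_def divide_less_eq)
  qed
  interpret T: symplectic_basis V w "\<lambda>i. e i + \<epsilon> *\<^sub>R f i" f by (rule tilt)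
  define L1 where "L1 = annihilator V w (\<lambda>i. e i + \<epsilon> *\<^sub>R f i)"
  have tilted: "transverse (l t) L1"
      "\<And>u. u \<in> annihilator V w e \<Longrightarrow> u \<noteq> 0 \<Longrightarrow> lag_chart w L0 L1 (l t) u u > 0"
    if "t \<in> {a..b}" for t
    using tilted_chart[OF lag[OF that] tr[OF that] M[OF that, unfolded q_def] eps]
    unfolding L1_def by auto
  \<comment> \<open>For each index, membership in \<open>L0\<close> annuls one of the two
    coordinates, and membership in \<open>L1\<close> makes them proportional with the nonzero factor
    \<epsilon>; so both vanish.\<close>
  have "transverse L1 L0"
  proof -
    have "z = 0" if z: "z \<in> L1" "z \<in> L0" for z
    proof -
      have zV: "z \<in> V" using z by (simp add: L0_def annihilator_def)
      have "w (e i + \<epsilon> *\<^sub>R f i) z = 0" for i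
        using z(1) by (simp add: L1_def annihilator_def)
      then have "w (e i) z + \<epsilon> * w (f i) z = 0" for i
        using zV by (simp add: w_add w_scale subspace_scale[OF V])
      then have 1: "w (e i) z = \<epsilon> * w z (f i)" for i
        using w_skew[OF f_in zV, of i] by (smt (verit) mult_minus_right)
      have "w (if i \<in> K then f i else e i) z = 0" for i
        using z(2) unfolding L0_def annihilator_def by blast
      then have 2: "(if i \<in> K then w (f i) z else w (e i) z) = 0" for i
        by (metis (full_types))
      have "w z (f i) = 0" for i
        using 1[of i] 2[of i] eps(1) w_skew[OF zV, of "f i"] by (auto split: if_splits)
      then show ?thesis using 1 zV by (intro eq_0I) auto
    qed
    then show ?thesis
      using subspace_0[OF K.annihilator_subspace] subspace_0[OF T.annihilator_subspace]
      by (auto simp: transverse_def L0_def L1_def)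
  qed
  then have "\<mu> L0 a b l = int (n_plus L0 (lag_chart w L0 L1 (l b))) - int (n_plus L0 (lag_chart w L0 L1 (l a)))"
    using mu ab path tilted(1) K.annihilator_lagrangian T.annihilator_lagrangian
    unfolding is_maslov_index_def L0_def L1_def by blast
  moreover have "CARD('n) - card K \<le> n_plus L0 (lag_chart w L0 L1 (l t))" if "t \<in> {a..b}" for t
  proof -
    \<comment> \<open>The \<open>e i\<close> with index outside \<open>K\<close> span a common
      subspace of \<open>L0\<close> and the annihilator of \<open>e\<close>, on which the chart form
      is positive.\<close>
    have "e ` (- K) \<subseteq> L0"
      unfolding L0_def by (auto simp: annihilator_def ee fe)
    then have 1: "span (e ` (- K)) \<subseteq> L0"
      unfolding L0_def by (intro span_minimal K.annihilator_subspace)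
    have "span (e ` (- K)) \<subseteq> annihilator V w e"
      by (intro span_minimal annihilator_subspace) (auto intro: e_in_annihilator)
    then have "dim (span (e ` (- K))) \<le> n_plus L0 (lag_chart w L0 L1 (l t))"
      using 1 tilted(2)[OF that] unfolding L0_def by (intro K.n_plus_ge) auto
    then show ?thesis by (simp only: dim_span_e) (simp add: Compl_eq_Diff_UNIV card_Diff_subset)
  qed
  moreover have "n_plus L0 (lag_chart w L0 L1 (l t)) \<le> CARD('n)" for t
    unfolding L0_def by (rule K.n_plus_le)
  moreover have "card K \<le> CARD('n)" by (rule card_mono) auto
  ultimately have "\<bar>\<mu> L0 a b l\<bar> \<le> int (card K)"
    using ab by (smt (verit, ccfv_SIG) atLeastAtMost_iff diff_le_mono2 int_ops(6) of_nat_mono)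
  then show ?thesis by (simp add: L0_def)
qed

section \<open>Continuity of paths of Lagrangians given as kernels\<close>

lemma functional_representation:
  assumes add: "\<And>x y. x \<in> V \<Longrightarrow> y \<in> V \<Longrightarrow> \<phi> (x + y) = \<phi> x + \<phi> y"
    and scale: "\<And>r x. x \<in> V \<Longrightarrow> \<phi> (r *\<^sub>R x) = r * \<phi> x"
  obtains s where "s \<in> V" "\<And>z. z \<in> V \<Longrightarrow> \<phi> z = w s z"
proof -
  have zero: "\<phi> 0 = 0" using scale[of 0 0] subspace_0[OF V] by simp
  have sum: "\<phi> (\<Sum>i\<in>I. c i *\<^sub>R h i) = (\<Sum>i\<in>I. c i * \<phi> (h i))" if "\<And>i. i \<in> I \<Longrightarrow> h i \<in> V" for I c and h :: "'n \<Rightarrow> _"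
    using that
  proof (induction I rule: infinite_finite_induct)
    case (insert x F)
    then show ?case by (simp add: add scale subspace_scale[OF V] subspace_sum[OF V])
  qed (simp_all add: zero)
  define s where "s = (\<Sum>i\<in>UNIV. \<phi> (f i) *\<^sub>R e i) + (\<Sum>i\<in>UNIV. (- \<phi> (e i)) *\<^sub>R f i)"
  have in_V: "(\<Sum>i\<in>UNIV. c i *\<^sub>R e i) \<in> V" "(\<Sum>i\<in>UNIV. c i *\<^sub>R f i) \<in> V" for c
    by (intro subspace_sum[OF V] subspace_scale[OF V] e_in f_in)+
  show thesis
  proof (rule that[of s])
    show "s \<in> V" unfolding s_def by (intro subspace_add[OF V] in_V)
    fix z assume z: "z \<in> V"
    have "\<phi> z = \<phi> ((\<Sum>i\<in>UNIV. w z (f i) *\<^sub>R e i) + (\<Sum>i\<in>UNIV. w (e i) z *\<^sub>R f i))"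
      using expand[OF z] by (simp add: sum.distrib)
    also have "\<dots> = (\<Sum>i\<in>UNIV. w z (f i) * \<phi> (e i)) + (\<Sum>i\<in>UNIV. w (e i) z * \<phi> (f i))"
      by (simp only: add in_V sum e_in f_in)
    also have "\<dots> = w s z"
      unfolding s_def using z in_V w_skew[OF f_in z]
      by (simp only: w_add w_sum e_in f_in) (simp add: mult.commute)
    finally show "\<phi> z = w s z" .
  qed
qed

text \<open>If \<open>y\<close> is orthogonal to the image of \<open>L1\<close>, the functional
  \<open>y \<bullet> F z\<close> is \<open>w s z\<close> for some \<open>s\<close>. It vanishes on
  \<open>L1\<close> and on the kernel of \<open>F\<close>; both being their own annihilators,
  \<open>s\<close> lies in both and is 0, contradicting that \<open>F\<close> maps \<open>V\<close>
  onto the whole space.\<close>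

lemma transverse_kernel_surj:
  fixes F :: "'v \<Rightarrow> real ^ 'm"
  assumes add: "\<And>x y. x \<in> V \<Longrightarrow> y \<in> V \<Longrightarrow> F (x + y) = F x + F y"
    and scale: "\<And>r x. x \<in> V \<Longrightarrow> F (r *\<^sub>R x) = r *\<^sub>R F x"
    and surj: "F ` V = UNIV" and L: "{z \<in> V. F z = 0} \<in> lagrangians V w"
    and L1: "L1 \<in> lagrangians V w" and tr: "transverse {z \<in> V. F z = 0} L1"
  shows "F ` L1 = UNIV"
proof (rule ccontr)
  note sub = lagrangians_sub(1)[OF L1] and LV = lagrangians_sub(2)[OF L1]
  assume "F ` L1 \<noteq> UNIV"
  moreover have "subspace (F ` L1)"
    unfolding subspace_def
  proof (intro conjI ballI allI)
    have "F 0 = 0" using scale[of 0 0] subspace_0[OF V] by simp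
    then show "0 \<in> F ` L1" using subspace_0[OF sub] by (metis imageI)
    show "x + y \<in> F ` L1" if "x \<in> F ` L1" "y \<in> F ` L1" for x y
      using that LV by (auto simp: add[symmetric] subsetD intro!: imageI subspace_add[OF sub])
    show "r *\<^sub>R x \<in> F ` L1" if "x \<in> F ` L1" for x r
      using that LV by (auto simp: scale[symmetric] subsetD intro!: imageI subspace_scale[OF sub])
  qed
  ultimately obtain y where y: "y \<noteq> 0" "\<And>x. x \<in> F ` L1 \<Longrightarrow> y \<bullet> x = 0"
    using span_not_UNIV_orthogonal[of "F ` L1"] by (auto simp: span_eq_iff[THEN iffD2])
  obtain s where s: "s \<in> V" "\<And>z. z \<in> V \<Longrightarrow> y \<bullet> F z = w s z"
    using functional_representation[of "\<lambda>z. y \<bullet> F z"] by (auto simp: add scale inner_add_right)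
  have "s \<in> L1"
    using s y(2) LV by (intro lagrangians_sub(3)[OF L1, THEN iffD2] conjI ballI) (metis imageI subsetD)+
  moreover have "s \<in> {z \<in> V. F z = 0}"
    using s by (intro lagrangians_sub(3)[OF L, THEN iffD2] conjI ballI) (metis (mono_tags, lifting) inner_zero_right mem_Collect_eq)+
  ultimately have "s = 0" using tr unfolding transverse_def by blast
  then have "y \<bullet> F z = 0" if "z \<in> V" for z using s(2)[OF that] that by simp
  then have "y \<bullet> y = 0" using surj by (metis UNIV_I imageE)
  then show False using y(1) by simp
qed

text \<open>At \<open>t0\<close> the map is bijective on \<open>L1\<close>; \<open>h\<close> is the
  frame of \<open>L1\<close> that it sends to the standard basis. The matrix \<open>N t\<close> of
  \<open>F t\<close> in this frame is the identity at \<open>t0\<close>, so it is invertible nearby,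
  and invertibility gives both transversality and a formula for the chart.\<close>

lemma lagrangian_kernel_family_chart:
  fixes F :: "real \<Rightarrow> 'v \<Rightarrow> real ^ 'm"
  assumes t0: "t0 \<in> S"
    and add: "\<And>t x y. t \<in> S \<Longrightarrow> x \<in> V \<Longrightarrow> y \<in> V \<Longrightarrow> F t (x + y) = F t x + F t y"
    and scale: "\<And>t r x. t \<in> S \<Longrightarrow> x \<in> V \<Longrightarrow> F t (r *\<^sub>R x) = r *\<^sub>R F t x"
    and surj: "F t0 ` V = UNIV" and L: "{z \<in> V. F t0 z = 0} \<in> lagrangians V w"
    and cont: "\<And>z. z \<in> V \<Longrightarrow> ((\<lambda>t. F t z) \<longlongrightarrow> F t0 z) (at t0 within S)"
    and L1: "L1 \<in> lagrangians V w" and tr: "transverse {z \<in> V. F t0 z = 0} L1"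
    and u: "u \<in> V" and v: "v \<in> V"
  shows "\<forall>\<^sub>F t in at t0 within S. transverse {z \<in> V. F t z = 0} L1" (is ?A)
    and "((\<lambda>t. lag_chart w L0 L1 {z \<in> V. F t z = 0} u v) \<longlongrightarrow> lag_chart w L0 L1 {z \<in> V. F t0 z = 0} u v)
      (at t0 within S)" (is ?B)
proof -
  note sub = lagrangians_sub(1)[OF L1] and LV = lagrangians_sub(2)[OF L1]
  have "\<exists>z\<in>L1. F t0 z = axis i 1" for i
    using transverse_kernel_surj[OF add[OF t0] scale[OF t0] surj L L1 tr] by (metis UNIV_I imageE)
  then obtain h where h: "\<And>i. h i \<in> L1" "\<And>i. F t0 (h i) = axis i 1" by metis
  have hV [simp]: "h i \<in> V" for i using h(1) LV by blast
  define comb where "comb x = (\<Sum>i\<in>UNIV. x $ i *\<^sub>R h i)" for x :: "real ^ 'm"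
  have combL: "comb x \<in> L1" for x
    unfolding comb_def by (intro subspace_sum[OF sub] subspace_scale[OF sub] h)
  then have combV: "comb x \<in> V" for x using LV by blast
  define N where "N t = (\<chi> i j. F t (h j) $ i)" for t
  have F0: "F t 0 = 0" if "t \<in> S" for t
    using scale[OF that, of 0 0] subspace_0[OF V] by simp
  have Fsum: "F t (\<Sum>i\<in>I. c i *\<^sub>R h i) = (\<Sum>i\<in>I. c i *\<^sub>R F t (h i))" if t: "t \<in> S" for t I c
  proof (induction I rule: infinite_finite_induct)
    case (insert x I)
    then show ?case by (simp add: add[OF t] scale[OF t] subspace_scale[OF V] subspace_sum[OF V])
  qed (simp_all add: F0[OF t])
  have Fcomb: "F t (comb x) = N t *v x" if "t \<in> S" for t x
    using Fsum[OF that] by (simp add: comb_def N_def vec_eq_iff matrix_vector_mult_def mult.commute)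
  have N0: "N t0 = mat 1"
    by (simp add: N_def vec_eq_iff mat_def h(2) axis_def)
  have L1_comb: "z = comb (F t0 z)" if "z \<in> L1" for z
  proof -
    have "z - comb (F t0 z) \<in> L1" using that combL subspace_diff[OF sub] by blast
    moreover have "F t0 (z - comb (F t0 z)) = F t0 z - F t0 (comb (F t0 z))"
      using add[OF t0, of z "- comb (F t0 z)"] scale[OF t0, of "comb (F t0 z)" "- 1"] that LV combV
        subspace_neg[OF V] by auto
    then have "F t0 (z - comb (F t0 z)) = 0" by (simp add: Fcomb[OF t0] N0)
    ultimately have "z - comb (F t0 z) = 0" using tr LV unfolding transverse_def by blast
    then show ?thesis by (metis eq_iff_diff_eq_0)
  qed
  have N: "((\<lambda>t. N t $ i $ j) \<longlongrightarrow> N t0 $ i $ j) (at t0 within S)" for i j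
    unfolding N_def by (auto intro!: tendsto_intros cont)
  then have detN: "((\<lambda>t. det (N t)) \<longlongrightarrow> det (N t0)) (at t0 within S)"
    unfolding det_def by (intro tendsto_sum tendsto_mult tendsto_prod tendsto_const N)
  have "det (N t0) \<noteq> 0" by (simp add: N0)
  then have ev: "\<forall>\<^sub>F t in at t0 within S. t \<in> S \<and> det (N t) \<noteq> 0"
    using tendsto_imp_eventually_ne[OF detN] by (simp add: eventually_conj_iff eventually_at_filter)
  \<comment> \<open>The coordinates in the frame \<open>h\<close> of the graph vector over
    \<open>u\<close> solve a linear system with matrix \<open>N t\<close>. Cramer's rule makes the
    chart entry an expression whose continuity is visible.\<close>
  have good: "transverse {z \<in> V. F t z = 0} L1"
      "lag_chart w L0 L1 {z \<in> V. F t z = 0} u v = (\<Sum>i\<in>UNIV.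
        (det (\<chi> k j. if j = i then - F t u $ k else N t $ k $ j) / det (N t)) * w (h i) v)"
    if t: "t \<in> S" and det: "det (N t) \<noteq> 0" for t
  proof -
    have inj: "x = 0" if "N t *v x = 0" for x
      using that det by (metis inj_matrix_vector_mult invertible_det_nz injD matrix_vector_mult_0_right)
    have "z = 0" if "z \<in> V" "F t z = 0" "z \<in> L1" for z
      using that L1_comb[of z] Fcomb[OF t, of "F t0 z"] inj[of "F t0 z"] by (simp add: comb_def)
    then show "transverse {z \<in> V. F t z = 0} L1"
      using subspace_0[OF sub] subspace_0[OF V] F0[OF t] unfolding transverse_def by blast
    define x where "x = (\<chi> i. det (\<chi> k j. if j = i then - F t u $ k else N t $ k $ j) / det (N t))"
    have x: "N t *v x = - F t u"
      using cramer[OF det, of x "- F t u"] by (simp add: x_def cong: if_cong)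
    have "(THE x. x \<in> L1 \<and> u + x \<in> {z \<in> V. F t z = 0}) = comb x"
    proof (rule the_equality)
      have "F t (u + comb x) = 0" using x by (simp add: add[OF t u combV] Fcomb[OF t])
      then show "comb x \<in> L1 \<and> u + comb x \<in> {z \<in> V. F t z = 0}"
        using combL subspace_add[OF V u combV] by simp
      fix y assume y: "y \<in> L1 \<and> u + y \<in> {z \<in> V. F t z = 0}"
      then have "y \<in> V" and yc: "y = comb (F t0 y)" using LV L1_comb by blast+
      then have "F t u + F t y = 0" using y add[OF t u] by simp
      moreover have "F t y = N t *v F t0 y" using Fcomb[OF t, of "F t0 y"] yc by simp
      ultimately have "N t *v (F t0 y - x) = 0" using x by (simp add: matrix_vector_mult_diff_distrib add_eq_0_iff)
      then show "y = comb x" using inj[of "F t0 y - x"] yc by simp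
    qed
    then have "lag_chart w L0 L1 {z \<in> V. F t z = 0} u v = w (comb x) v" by (simp add: lag_chart_def)
    also have "\<dots> = (\<Sum>i\<in>UNIV. x $ i * w (h i) v)"
      using functional_representation[of "\<lambda>z. w z v"] unfolding comb_def
      by (intro w_sum) (auto simp: v)
    finally show "lag_chart w L0 L1 {z \<in> V. F t z = 0} u v = (\<Sum>i\<in>UNIV.
        (det (\<chi> k j. if j = i then - F t u $ k else N t $ k $ j) / det (N t)) * w (h i) v)"
      by (simp add: x_def)
  qed
  show ?A using ev by eventually_elim (use good in blast)
  have "((\<lambda>t. \<Sum>i\<in>UNIV. (det (\<chi> k j. if j = i then - F t u $ k else N t $ k $ j) / det (N t)) * w (h i) v) \<longlongrightarrow>
      (\<Sum>i\<in>UNIV. (det (\<chi> k j. if j = i then - F t0 u $ k else N t0 $ k $ j) / det (N t0)) * w (h i) v))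
      (at t0 within S)"
  proof (intro tendsto_intros detN \<open>det (N t0) \<noteq> 0\<close>)
    fix i
    have *: "((\<lambda>t. (\<chi> k j. if j = i then - F t u $ k else N t $ k $ j) $ k $ j) \<longlongrightarrow>
        (\<chi> k j. if j = i then - F t0 u $ k else N t0 $ k $ j) $ k $ j) (at t0 within S)" for k j
      using cont[OF u] N by (cases "j = i") (auto intro!: tendsto_intros)
    then show "((\<lambda>t. det (\<chi> k j. if j = i then - F t u $ k else N t $ k $ j)) \<longlongrightarrow>
        det (\<chi> k j. if j = i then - F t0 u $ k else N t0 $ k $ j)) (at t0 within S)"
      unfolding det_def by (intro tendsto_sum tendsto_mult tendsto_prod tendsto_const *)
  qed
  then show ?B
    unfolding good(2)[OF t0 \<open>det (N t0) \<noteq> 0\<close>, symmetric]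
    by (rule Lim_transform_eventually) (use ev in eventually_elim, use good(2) in simp)
qed

text \<open>Continuity is tested on generating sets, and openness of their preimages near each
  \<open>t0\<close>, where one family \<open>F t0\<close> describes the path on the neighbourhood
  \<open>S t0\<close>. Transversality to the annihilator of \<open>e\<close> exhibits a generating
  set that contains every \<open>l t\<close>.\<close>

theorem lagrangian_pathI:
  fixes F :: "real \<Rightarrow> real \<Rightarrow> 'v \<Rightarrow> real ^ 'm"
  assumes lag: "\<And>t. t \<in> {a..b} \<Longrightarrow> l t \<in> lagrangians V w"
    and tr: "\<And>t. t \<in> {a..b} \<Longrightarrow> transverse (l t) (annihilator V w e)"
    and S: "\<And>t0. t0 \<in> {a..b} \<Longrightarrow> openin (top_of_set {a..b}) (S t0) \<and> t0 \<in> S t0"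
    and add: "\<And>t0 t x y. t0 \<in> {a..b} \<Longrightarrow> t \<in> S t0 \<Longrightarrow> x \<in> V \<Longrightarrow> y \<in> V \<Longrightarrow> F t0 t (x + y) = F t0 t x + F t0 t y"
    and scale: "\<And>t0 t r x. t0 \<in> {a..b} \<Longrightarrow> t \<in> S t0 \<Longrightarrow> x \<in> V \<Longrightarrow> F t0 t (r *\<^sub>R x) = r *\<^sub>R F t0 t x"
    and surj: "\<And>t0. t0 \<in> {a..b} \<Longrightarrow> F t0 t0 ` V = UNIV"
    and ker: "\<And>t0 t. t0 \<in> {a..b} \<Longrightarrow> t \<in> S t0 \<Longrightarrow> l t = {z \<in> V. F t0 t z = 0}"
    and cont: "\<And>t0 z. t0 \<in> {a..b} \<Longrightarrow> z \<in> V \<Longrightarrow> ((\<lambda>t. F t0 t z) \<longlongrightarrow> F t0 t0 z) (at t0 within S t0)"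
  shows "lagrangian_path V w a b l"
  unfolding lagrangian_path_def lagrangian_topology_def
proof (rule continuous_on_generated_topo)
  interpret F: symplectic_basis V w f "\<lambda>i. - e i"
    using swap[of UNIV] by simp
  have EF: "transverse (annihilator V w f) (annihilator V w e)"
  proof -
    have "z = 0" if "z \<in> annihilator V w e" "z \<in> annihilator V w f" for z
    proof (rule eq_0I)
      show "z \<in> V" using that(1) annihilator_in by blast
      then show "w (e i) z = 0" "w z (f i) = 0" for i
        using that w_skew[of z "f i"] by (simp_all add: annihilator_def)
    qed
    then show ?thesis
      using subspace_0[OF annihilator_subspace] subspace_0[OF F.annihilator_subspace]
      unfolding transverse_def by blast
  qed
  let ?gens = "{{L \<in> lagrangians V w. transverse L L1 \<and> lag_chart w L0 L1 L u v \<in> S} |L0 L1 u v S.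
    L0 \<in> lagrangians V w \<and> L1 \<in> lagrangians V w \<and> transverse L0 L1 \<and> u \<in> L0 \<and> v \<in> L0 \<and> open S}"
  show "l ` topspace (top_of_set {a..b}) \<subseteq> \<Union> ?gens"
  proof (rule image_subsetI)
    fix t assume "t \<in> topspace (top_of_set {a..b})"
    then have t: "t \<in> {a..b}" by simp
    let ?U = "{L \<in> lagrangians V w. transverse L (annihilator V w e) \<and>
      lag_chart w (annihilator V w f) (annihilator V w e) L 0 0 \<in> UNIV}"
    have "l t \<in> ?U" using lag[OF t] tr[OF t] by simp
    moreover have "?U \<in> ?gens"
      using annihilator_lagrangian F.annihilator_lagrangian EF subspace_0[OF F.annihilator_subspace]
        open_UNIV by blast
    ultimately show "l t \<in> \<Union> ?gens" by (rule UnionI[rotated])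
  qed
  fix U assume "U \<in> ?gens"
  then obtain L0 L1 u v W where U: "U = {L \<in> lagrangians V w. transverse L L1 \<and> lag_chart w L0 L1 L u v \<in> W}"
    and L: "L0 \<in> lagrangians V w" "L1 \<in> lagrangians V w" "u \<in> L0" "v \<in> L0" and W: "open W" by blast
  have uv: "u \<in> V" "v \<in> V" using L lagrangians_sub(2) by blast+
  show "openin (top_of_set {a..b}) (l -` U \<inter> topspace (top_of_set {a..b}))"
  proof (subst openin_subopen, intro ballI)
    fix t0 assume "t0 \<in> l -` U \<inter> topspace (top_of_set {a..b})"
    then have t0: "t0 \<in> {a..b}" "l t0 \<in> U" by auto
    have St0: "t0 \<in> S t0" using S[OF t0(1)] by blast
    have lt0: "l t0 = {z \<in> V. F t0 t0 z = 0}" by (rule ker[OF t0(1) St0])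
    have 0: "{z \<in> V. F t0 t0 z = 0} \<in> lagrangians V w" "transverse {z \<in> V. F t0 t0 z = 0} L1"
        "lag_chart w L0 L1 {z \<in> V. F t0 t0 z = 0} u v \<in> W"
      using t0(2) unfolding U lt0 by blast+
    have chart: "\<forall>\<^sub>F t in at t0 within S t0. transverse {z \<in> V. F t0 t z = 0} L1"
      "((\<lambda>t. lag_chart w L0 L1 {z \<in> V. F t0 t z = 0} u v) \<longlongrightarrow>
        lag_chart w L0 L1 {z \<in> V. F t0 t0 z = 0} u v) (at t0 within S t0)"
      by (rule lagrangian_kernel_family_chart[where F = "F t0" and ?t0.0 = t0 and S = "S t0", OF St0 _ _ surj[OF t0(1)] 0(1) _ L(2) 0(2) uv];
          (rule add[OF t0(1)] scale[OF t0(1)] cont[OF t0(1)]; assumption))+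
    have "\<forall>\<^sub>F t in at t0 within S t0. lag_chart w L0 L1 {z \<in> V. F t0 t z = 0} u v \<in> W"
      using topological_tendstoD[OF chart(2) W 0(3)] .
    with chart(1) have "\<forall>\<^sub>F t in at t0 within S t0. t \<in> S t0 \<longrightarrow> l t \<in> U"
    proof eventually_elim
      case (elim t)
      have "l t \<in> U" if t: "t \<in> S t0"
      proof -
        have "t \<in> {a..b}" using S[OF t0(1)] openin_imp_subset t by blast
        then have "l t \<in> lagrangians V w" by (rule lag)
        then show ?thesis using elim unfolding U ker[OF t0(1) t] by blast
      qed
      then show ?case by blast
    qed
    then obtain T where T: "open T" "t0 \<in> T" "\<And>t. t \<in> T \<Longrightarrow> t \<noteq> t0 \<Longrightarrow> t \<in> S t0 \<Longrightarrow> l t \<in> U"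
      unfolding eventually_at_topological by blast
    have "openin (top_of_set {a..b}) (S t0 \<inter> T)"
      using S[OF t0(1)] T(1) by (simp add: openin_Int_open)
    moreover have "S t0 \<inter> T \<subseteq> l -` U \<inter> topspace (top_of_set {a..b})"
    proof
      fix t assume t: "t \<in> S t0 \<inter> T"
      then have "t \<in> {a..b}" using S[OF t0(1)] openin_imp_subset by blast
      moreover have "l t \<in> U" using T(3)[of t] t t0(2) by blast
      ultimately show "t \<in> l -` U \<inter> topspace (top_of_set {a..b})" by simp
    qed
    ultimately show "\<exists>T. openin (top_of_set {a..b}) T \<and> t0 \<in> T \<and> T \<subseteq> l -` U \<inter> topspace (top_of_set {a..b})"
      using T(2) St0 by blast
  qed
qed

end

section \<open>Differentiability classes\<close>

lemma frechet_derivative_works_at: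
  "f differentiable (at x) \<Longrightarrow> (f has_derivative frechet_derivative f (at x)) (at x)"
  using frechet_derivative_works by blast

lemma frechet_derivative_eqI: "(f has_derivative f') (at x) \<Longrightarrow> frechet_derivative f (at x) v = f' v"
  using frechet_derivative_at by metis

lemma Ck_on_cong_imp:
  assumes "Ck_on k S f" "open S" "\<And>x. x \<in> S \<Longrightarrow> f x = g x"
  shows "Ck_on k S g"
  using assms
proof (induction k arbitrary: f g)
  case 0
  then show ?case using continuous_on_cong[of S S f g] by simp
next
  case (Suc k)
  have "(g has_derivative frechet_derivative f (at x)) (at x)" if "x \<in> S" for x
    using has_derivative_transform_within_open[OF frechet_derivative_works_at, of f x S g] Suc.prems that
    by auto
  then have "g differentiable (at x)" "frechet_derivative g (at x) = frechet_derivative f (at x)" if "x \<in> S" for x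
    using that frechet_derivative_at differentiableI by metis+
  then show ?case
    using Suc.IH[of "\<lambda>x. frechet_derivative f (at x) v" "\<lambda>x. frechet_derivative g (at x) v" for v] Suc.prems
    by simp
qed

lemma Ck_on_cong:
  assumes "open S" "\<And>x. x \<in> S \<Longrightarrow> f x = g x"
  shows "Ck_on k S f \<longleftrightarrow> Ck_on k S g"
  using Ck_on_cong_imp[of k S f g] Ck_on_cong_imp[of k S g f] assms by metis

text \<open>On an open set the \<open>frechet_derivative\<close> in \<open>Ck_on\<close> may be
  replaced by any explicit formula for the derivative. The closure properties below are inductions
  on this rule.\<close>

lemma Ck_on_SucI:
  assumes "open S" "\<And>x. x \<in> S \<Longrightarrow> (f has_derivative f' x) (at x)" "\<And>v. Ck_on k S (\<lambda>x. f' x v)"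
  shows "Ck_on (Suc k) S f"
proof -
  have "frechet_derivative f (at x) v = f' x v" if "x \<in> S" for x v
    using frechet_derivative_eqI assms(2) that by metis
  then have "Ck_on k S (\<lambda>x. frechet_derivative f (at x) v)" for v
    using Ck_on_cong[OF assms(1), of "\<lambda>x. frechet_derivative f (at x) v" "\<lambda>x. f' x v" k] assms(3) by metis
  then show ?thesis using assms(2) by (auto simp: differentiable_def)
qed

lemma Ck_on_SucD: "Ck_on (Suc k) S f \<Longrightarrow> Ck_on k S f"
proof (induction k arbitrary: f)
  case 0
  then show ?case
    by (auto simp: differentiable_imp_continuous_within continuous_at_imp_continuous_on)
qed auto

lemma Ck_on_imp_continuous_on: "Ck_on k S f \<Longrightarrow> continuous_on S f"
proof (induction k)
  case (Suc k)
  then show ?case using Ck_on_SucD by blast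
qed auto

lemma Ck_on_const: "Ck_on k S (\<lambda>_. c)"
  by (induction k arbitrary: c) auto

lemma Ck_on_linear:
  assumes "open S" "bounded_linear h" "Ck_on k S f"
  shows "Ck_on k S (\<lambda>x. h (f x))"
  using assms(3)
proof (induction k arbitrary: f)
  case 0
  then show ?case using assms(2) by (auto intro: linear_continuous_on_compose bounded_linear.continuous_on)
next
  case (Suc k)
  then show ?case
    by (intro Ck_on_SucI[OF assms(1), of _ "\<lambda>x v. h (frechet_derivative f (at x) v)"]
        bounded_linear.has_derivative[OF assms(2)] frechet_derivative_works_at) auto
qed

lemma Ck_on_add:
  assumes "open S" "Ck_on k S f" "Ck_on k S g"
  shows "Ck_on k S (\<lambda>x. f x + g x)"
  using assms(2,3)
proof (induction k arbitrary: f g)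
  case 0
  then show ?case by (auto intro: continuous_intros)
next
  case (Suc k)
  then show ?case
    by (intro Ck_on_SucI[OF assms(1), of _ "\<lambda>x v. frechet_derivative f (at x) v + frechet_derivative g (at x) v"]
        has_derivative_add frechet_derivative_works_at) auto
qed

lemma Ck_on_sum:
  assumes "open S" "\<And>i. i \<in> I \<Longrightarrow> Ck_on k S (f i)"
  shows "Ck_on k S (\<lambda>x. \<Sum>i\<in>I. f i x)"
  using assms(2)
  by (induction I rule: infinite_finite_induct) (auto intro: Ck_on_const Ck_on_add[OF assms(1)])

lemma Ck_on_scaleR:
  assumes "open S" "Ck_on k S f" "Ck_on k S g"
  shows "Ck_on k S (\<lambda>x. f x *\<^sub>R g x)"
  using assms(2,3)
proof (induction k arbitrary: f g)
  case 0
  then show ?case by (auto intro: continuous_intros)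
next
  case (Suc k)
  then have "Ck_on k S f" "Ck_on k S g" using Ck_on_SucD by blast+
  with Suc show ?case
    by (intro Ck_on_SucI[OF assms(1), of _ "\<lambda>x v. f x *\<^sub>R frechet_derivative g (at x) v + frechet_derivative f (at x) v *\<^sub>R g x"]
        has_derivative_scaleR frechet_derivative_works_at Ck_on_add[OF assms(1)]) auto
qed

lemma Ck_on_mult:
  fixes f g :: "'a::euclidean_space \<Rightarrow> real"
  assumes "open S" "Ck_on k S f" "Ck_on k S g"
  shows "Ck_on k S (\<lambda>x. f x * g x)"
  using Ck_on_scaleR[OF assms] by simp

lemma Ck_on_prod:
  fixes f :: "'i \<Rightarrow> 'a::euclidean_space \<Rightarrow> real"
  assumes "open S" "\<And>i. i \<in> I \<Longrightarrow> Ck_on k S (f i)"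
  shows "Ck_on k S (\<lambda>x. \<Prod>i\<in>I. f i x)"
  using assms(2)
  by (induction I rule: infinite_finite_induct) (auto intro: Ck_on_const Ck_on_mult[OF assms(1)])

lemma Ck_on_inverse:
  fixes f :: "'a::euclidean_space \<Rightarrow> real"
  assumes "open S" "Ck_on k S f" "\<And>x. x \<in> S \<Longrightarrow> f x \<noteq> 0"
  shows "Ck_on k S (\<lambda>x. inverse (f x))"
  using assms(2)
proof (induction k)
  case 0
  then show ?case using assms(3) by (auto intro: continuous_intros)
next
  case (Suc k)
  then have "Ck_on k S f" using Ck_on_SucD by blast
  then have IH: "Ck_on k S (\<lambda>x. inverse (f x))" by (rule Suc.IH)
  show ?case
  proof (rule Ck_on_SucI[OF assms(1)])
    show "((\<lambda>x. inverse (f x)) has_derivative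
        (\<lambda>v. (- 1) * (inverse (f x) * frechet_derivative f (at x) v * inverse (f x)))) (at x)" if "x \<in> S" for x
      using Deriv.has_derivative_inverse[of f x, OF assms(3)[OF that] frechet_derivative_works_at] Suc.prems that
      by simp
    show "Ck_on k S (\<lambda>x. (- 1) * (inverse (f x) * frechet_derivative f (at x) v * inverse (f x)))" for v
      using IH Suc.prems by (intro Ck_on_mult[OF assms(1)] Ck_on_const) auto
  qed
qed

lemma Ck_on_vec:
  fixes f :: "'a::euclidean_space \<Rightarrow> real ^ 'n"
  assumes "open S"
  shows "Ck_on k S f \<longleftrightarrow> (\<forall>i. Ck_on k S (\<lambda>x. f x $ i))"
proof
  assume "Ck_on k S f"
  then show "\<forall>i. Ck_on k S (\<lambda>x. f x $ i)"
    by (intro allI Ck_on_linear[OF assms bounded_linear_vec_nth])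
next
  assume *: "\<forall>i. Ck_on k S (\<lambda>x. f x $ i)"
  have "Ck_on k S (\<lambda>x. \<Sum>i\<in>UNIV. f x $ i *\<^sub>R axis i 1)"
    using * by (intro Ck_on_sum[OF assms] Ck_on_scaleR[OF assms] Ck_on_const) auto
  moreover have "(\<Sum>i\<in>UNIV. f x $ i *\<^sub>R axis i 1) = f x" for x
    by (simp only: basis_expansion scalar_mult_eq_scaleR[symmetric])
  ultimately show "Ck_on k S f" by (rule Ck_on_cong_imp[OF _ assms])
qed

lemma linear_vec_expand:
  fixes h :: "real ^ 'n \<Rightarrow> 'b::real_vector"
  assumes "linear h"
  shows "h x = (\<Sum>i\<in>UNIV. x $ i *\<^sub>R h (axis i 1))"
proof -
  have "h x = h (\<Sum>i\<in>UNIV. x $ i *\<^sub>R axis i 1)"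
    using basis_expansion[of x] by (simp add: scalar_mult_eq_scaleR)
  then show ?thesis by (simp add: linear_sum[OF assms] linear_cmul[OF assms])
qed

text \<open>The chain rule has the moving vector \<open>frechet_derivative g (at x) v\<close> as an
  argument of the derivative of \<open>f\<close>. Expanding it in the standard basis leaves products
  of scalar functions with composites, to which the induction hypothesis applies.\<close>

lemma Ck_on_compose:
  fixes g :: "'a::euclidean_space \<Rightarrow> real ^ 'n" and f :: "real ^ 'n \<Rightarrow> 'b::real_normed_vector"
  assumes "open S" "open T" "g ` S \<subseteq> T" "Ck_on k T f" "Ck_on k S g"
  shows "Ck_on k S (\<lambda>x. f (g x))"
  using assms(4,5)
proof (induction k arbitrary: f)
  case 0
  then show ?case using continuous_on_compose2[of T f S g] assms(3) by simp
next
  case (Suc k)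
  show ?case
  proof (rule Ck_on_SucI[OF assms(1)])
    show "((\<lambda>x. f (g x)) has_derivative
        (\<lambda>v. frechet_derivative f (at (g x)) (frechet_derivative g (at x) v))) (at x)" if "x \<in> S" for x
      using Suc.prems that assms(3)
      by (intro has_derivative_compose[OF frechet_derivative_works_at frechet_derivative_works_at]) auto
    fix v
    have "linear (frechet_derivative f (at (g x)))" if "x \<in> S" for x
      using Suc.prems that assms(3) by (auto intro!: linear_frechet_derivative)
    note expand = linear_vec_expand[OF this, of _ "frechet_derivative g (at _) v"]
    have "Ck_on k S (\<lambda>x. \<Sum>i\<in>UNIV. frechet_derivative g (at x) v $ i *\<^sub>R frechet_derivative f (at (g x)) (axis i 1))"
    proof (intro Ck_on_sum[OF assms(1)] Ck_on_scaleR[OF assms(1)])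
      fix i
      show "Ck_on k S (\<lambda>x. frechet_derivative g (at x) v $ i)"
        using Suc.prems(2) Ck_on_vec[OF assms(1), of k "\<lambda>x. frechet_derivative g (at x) v"] by auto
      show "Ck_on k S (\<lambda>x. frechet_derivative f (at (g x)) (axis i 1))"
        using Suc.prems Ck_on_SucD[of k S g] by (intro Suc.IH) auto
    qed
    then show "Ck_on k S (\<lambda>x. frechet_derivative f (at (g x)) (frechet_derivative g (at x) v))"
      by (rule Ck_on_cong_imp[OF _ assms(1)]) (simp add: expand[symmetric])
  qed
qed

lemma smooth_onD:
  assumes "smooth_on S f" "x \<in> S"
  shows "f differentiable (at x)" "(f has_derivative frechet_derivative f (at x)) (at x)"
    "linear (frechet_derivative f (at x))"
proof -
  have "Ck_on (Suc 0) S f" using assms(1) unfolding smooth_on_def by blast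
  then show *: "f differentiable (at x)" using assms(2) by simp
  show "(f has_derivative frechet_derivative f (at x)) (at x)" "linear (frechet_derivative f (at x))"
    using frechet_derivative_works_at[OF *] linear_frechet_derivative[OF *] .
qed

lemma smooth_on_derivative: "smooth_on S f \<Longrightarrow> smooth_on S (\<lambda>x. frechet_derivative f (at x) v)"
  unfolding smooth_on_def by (metis Ck_on.simps(2))

lemma smooth_on_cong:
  "open S \<Longrightarrow> (\<And>x. x \<in> S \<Longrightarrow> f x = g x) \<Longrightarrow> smooth_on S f \<longleftrightarrow> smooth_on S g"
  unfolding smooth_on_def using Ck_on_cong by metis

lemma smooth_on_continuous: "smooth_on S f \<Longrightarrow> continuous_on S f"
  unfolding smooth_on_def using Ck_on_imp_continuous_on by blast


lemma linear_frechet_derivative_field: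
  fixes L :: "'a::real_normed_vector \<Rightarrow> 'c::real_vector \<Rightarrow> 'b::real_normed_vector"
  assumes "open S" "x \<in> S" "\<And>y. y \<in> S \<Longrightarrow> linear (L y)" "\<And>u. (\<lambda>y. L y u) differentiable (at x)"
  shows "linear (\<lambda>u. frechet_derivative (\<lambda>y. L y u) (at x) h)"
proof (rule linearI)
  fix u v r
  note d = frechet_derivative_works_at[OF assms(4)]
  have "((\<lambda>y. L y (u + v)) has_derivative
      (\<lambda>h. frechet_derivative (\<lambda>y. L y u) (at x) h + frechet_derivative (\<lambda>y. L y v) (at x) h)) (at x)"
    by (rule has_derivative_transform_within_open[OF has_derivative_add[OF d[of u] d[of v]] assms(1,2)])
      (simp add: linear_add[OF assms(3)])
  then show "frechet_derivative (\<lambda>y. L y (u + v)) (at x) h =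
      frechet_derivative (\<lambda>y. L y u) (at x) h + frechet_derivative (\<lambda>y. L y v) (at x) h"
    by (rule frechet_derivative_eqI)
  have "((\<lambda>y. L y (r *\<^sub>R u)) has_derivative (\<lambda>h. r *\<^sub>R frechet_derivative (\<lambda>y. L y u) (at x) h)) (at x)"
    by (rule has_derivative_transform_within_open[OF has_derivative_scaleR_right[OF d[of u]] assms(1,2)])
      (simp add: linear_cmul[OF assms(3)])
  then show "frechet_derivative (\<lambda>y. L y (r *\<^sub>R u)) (at x) h = r *\<^sub>R frechet_derivative (\<lambda>y. L y u) (at x) h"
    by (rule frechet_derivative_eqI)
qed

text \<open>Product rule for an operator applied to a vector, both moving. Linearity is asked only
  near \<open>t0\<close>, because coordinate expressions along a curve are linear only while the
  curve stays in the chart.\<close>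

lemma has_derivative_linear_field:
  fixes L :: "'s::real_normed_vector \<Rightarrow> real ^ 'n \<Rightarrow> 'b::real_normed_vector"
  assumes lin: "\<forall>\<^sub>F t in at t0 within S. linear (L t)" "linear (L t0)" "t0 \<in> S" "\<And>h. linear (L' h)"
    and L: "\<And>u. ((\<lambda>t. L t u) has_derivative (\<lambda>h. L' h u)) (at t0 within S)"
    and u: "(u has_derivative u') (at t0 within S)"
  shows "((\<lambda>t. L t (u t)) has_derivative (\<lambda>h. L' h (u t0) + L t0 (u' h))) (at t0 within S)"
proof -
  have ui: "((\<lambda>t. u t $ i) has_derivative (\<lambda>h. u' h $ i)) (at t0 within S)" for i
    by (rule bounded_linear.has_derivative[OF bounded_linear_vec_nth u])
  have 1: "((\<lambda>t. \<Sum>i\<in>UNIV. u t $ i *\<^sub>R L t (axis i 1)) has_derivative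
      (\<lambda>h. \<Sum>i\<in>UNIV. u t0 $ i *\<^sub>R L' h (axis i 1) + u' h $ i *\<^sub>R L t0 (axis i 1))) (at t0 within S)"
    by (intro has_derivative_sum has_derivative_scaleR ui L)
  have 2: "\<forall>\<^sub>F t in at t0 within S. (\<Sum>i\<in>UNIV. u t $ i *\<^sub>R L t (axis i 1)) = L t (u t)"
    using lin(1) by eventually_elim (simp add: linear_vec_expand[symmetric])
  have "((\<lambda>t. L t (u t)) has_derivative
      (\<lambda>h. \<Sum>i\<in>UNIV. u t0 $ i *\<^sub>R L' h (axis i 1) + u' h $ i *\<^sub>R L t0 (axis i 1))) (at t0 within S)"
    by (rule has_derivative_transform_eventually[OF 1 2])
      (use lin in \<open>simp_all add: linear_vec_expand[symmetric]\<close>)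
  then show ?thesis
    by (simp add: sum.distrib linear_vec_expand[OF lin(2), symmetric] linear_vec_expand[OF lin(4), symmetric])
qed

text \<open>The mean value theorem twice: first for the increment along \<open>v\<close> as a
  function of the step along \<open>u\<close>, then for the derivative in direction \<open>u\<close>
  as a function of the step along \<open>v\<close>.\<close>

lemma second_difference:
  fixes f :: "'a::real_normed_vector \<Rightarrow> real"
  assumes s: "s > 0" "s * (norm u + norm v) < r"
    and d1: "\<And>y. y \<in> ball x r \<Longrightarrow> f differentiable (at y)"
    and d2: "\<And>y. y \<in> ball x r \<Longrightarrow> (\<lambda>y. frechet_derivative f (at y) u) differentiable (at y)"
  obtains y where "y \<in> ball x r"
    "f (x + s *\<^sub>R u + s *\<^sub>R v) - f (x + s *\<^sub>R u) - f (x + s *\<^sub>R v) + f x =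
      s * s * frechet_derivative (\<lambda>y. frechet_derivative f (at y) u) (at y) v"
proof -
  have in_ball: "x + p *\<^sub>R u + q *\<^sub>R v \<in> ball x r" if "0 \<le> p" "p \<le> s" "0 \<le> q" "q \<le> s" for p q
  proof -
    have "norm (p *\<^sub>R u + q *\<^sub>R v) \<le> p * norm u + q * norm v"
      using norm_triangle_ineq[of "p *\<^sub>R u" "q *\<^sub>R v"] that by simp
    also have "\<dots> \<le> s * norm u + s * norm v"
      using that by (intro add_mono mult_right_mono) auto
    finally have "dist (x + (p *\<^sub>R u + q *\<^sub>R v)) x < r"
      using s(2) by (simp add: dist_norm distrib_left)
    then show ?thesis by (simp add: dist_commute add.assoc)
  qed
  define \<phi> where "\<phi> p = f (x + p *\<^sub>R u + s *\<^sub>R v) - f (x + p *\<^sub>R u + 0 *\<^sub>R v)" for p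
  have "(\<phi> has_real_derivative frechet_derivative f (at (x + p *\<^sub>R u + s *\<^sub>R v)) u
      - frechet_derivative f (at (x + p *\<^sub>R u + 0 *\<^sub>R v)) u) (at p)" if "0 \<le> p" "p \<le> s" for p
  proof -
    have *: "((\<lambda>p. f (x + p *\<^sub>R u + q *\<^sub>R v)) has_derivative
        (\<lambda>h. frechet_derivative f (at (x + p *\<^sub>R u + q *\<^sub>R v)) (h *\<^sub>R u))) (at p)"
      if "0 \<le> q" "q \<le> s" for q
      by (rule has_derivative_compose[OF _ frechet_derivative_works_at])
        (auto intro!: derivative_eq_intros d1 in_ball that \<open>0 \<le> p\<close> \<open>p \<le> s\<close>)
    have lin: "linear (frechet_derivative f (at (x + p *\<^sub>R u + q *\<^sub>R v)))" if "0 \<le> q" "q \<le> s" for q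
      by (intro linear_frechet_derivative d1 in_ball that \<open>0 \<le> p\<close> \<open>p \<le> s\<close>)
    show ?thesis
      using has_derivative_diff[OF *[of s] *[of 0]] s(1) linear_cmul[OF lin[of s]] linear_cmul[OF lin[of 0]]
      by (auto simp: \<phi>_def[abs_def] has_field_derivative_def fun_eq_iff algebra_simps
          intro: has_derivative_eq_rhs)
  qed
  from MVT2[OF s(1) this] obtain p where p: "0 < p" "p < s" and
    \<phi>: "\<phi> s - \<phi> 0 = s * (frechet_derivative f (at (x + p *\<^sub>R u + s *\<^sub>R v)) u
      - frechet_derivative f (at (x + p *\<^sub>R u + 0 *\<^sub>R v)) u)" by auto
  let ?g = "\<lambda>y. frechet_derivative f (at y) u"
  have "((\<lambda>q. ?g (x + p *\<^sub>R u + q *\<^sub>R v)) has_real_derivative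
      frechet_derivative ?g (at (x + p *\<^sub>R u + q *\<^sub>R v)) v) (at q)" if "0 \<le> q" "q \<le> s" for q
  proof -
    have *: "((\<lambda>q. ?g (x + p *\<^sub>R u + q *\<^sub>R v)) has_derivative
        (\<lambda>h. frechet_derivative ?g (at (x + p *\<^sub>R u + q *\<^sub>R v)) (h *\<^sub>R v))) (at q)"
      by (rule has_derivative_compose[OF _ frechet_derivative_works_at])
        (use p in \<open>auto intro!: derivative_eq_intros d2 in_ball that\<close>)
    have lin: "linear (frechet_derivative ?g (at (x + p *\<^sub>R u + q *\<^sub>R v)))"
      using p by (intro linear_frechet_derivative d2 in_ball that) auto
    show ?thesis
      using * linear_cmul[OF lin]
      by (auto simp: has_field_derivative_def fun_eq_iff algebra_simps intro: has_derivative_eq_rhs)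
  qed
  from MVT2[OF s(1) this] obtain q where q: "0 < q" "q < s" and
    "?g (x + p *\<^sub>R u + s *\<^sub>R v) - ?g (x + p *\<^sub>R u + 0 *\<^sub>R v) =
      s * frechet_derivative ?g (at (x + p *\<^sub>R u + q *\<^sub>R v)) v" by auto
  then show thesis
    using \<phi> p q by (intro that[of "x + p *\<^sub>R u + q *\<^sub>R v"] in_ball) (auto simp: \<phi>_def)
qed

text \<open>The second difference is symmetric in \<open>u\<close> and \<open>v\<close>, so the two
  mixed derivatives agree up to moving the point within a small ball; their continuity at
  \<open>x\<close> does the rest.\<close>

lemma symmetric_second_derivative_real:
  fixes f :: "'a::euclidean_space \<Rightarrow> real"
  assumes f: "smooth_on S f" and S: "open S" "x \<in> S"
  shows "frechet_derivative (\<lambda>y. frechet_derivative f (at y) u) (at x) v =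
    frechet_derivative (\<lambda>y. frechet_derivative f (at y) v) (at x) u" (is "?A u v x = ?A v u x")
proof (rule ccontr)
  assume neq: "?A u v x \<noteq> ?A v u x"
  define \<epsilon> where "\<epsilon> = \<bar>?A u v x - ?A v u x\<bar> / 2"
  have "\<epsilon> > 0" using neq by (simp add: \<epsilon>_def)
  have "continuous_on S (?A u v)" for u v
    by (intro smooth_on_continuous smooth_on_derivative f)
  then have "continuous (at x) (?A u v)" for u v
    using S continuous_on_eq_continuous_at by blast
  then have "\<exists>d>0. \<forall>y. dist y x < d \<longrightarrow> dist (?A u v y) (?A u v x) < \<epsilon>" for u v
    using \<open>\<epsilon> > 0\<close> unfolding continuous_at_eps_delta by auto
  then obtain d1 d2 where d: "d1 > 0" "d2 > 0" "\<And>y. dist y x < d1 \<Longrightarrow> dist (?A u v y) (?A u v x) < \<epsilon>"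
    "\<And>y. dist y x < d2 \<Longrightarrow> dist (?A v u y) (?A v u x) < \<epsilon>" by meson
  obtain r0 where r0: "r0 > 0" "ball x r0 \<subseteq> S" using S open_contains_ball by blast
  define r where "r = min r0 (min d1 d2)"
  have r: "r > 0" "ball x r \<subseteq> S" using d r0 by (auto simp: r_def)
  \<comment> \<open>Small enough for the two displacements together to stay in the ball; the added 1
    covers \<open>u = v = 0\<close>.\<close>
  define s where "s = r / (2 * (norm u + norm v + 1))"
  have n: "norm u + norm v + 1 > 0" by (smt (verit) norm_ge_zero)
  have s: "s > 0" "s * (norm u + norm v) < r"
  proof -
    show "s > 0" using r n by (simp add: s_def)
    have "s * (norm u + norm v) < s * (2 * (norm u + norm v + 1))"
      using \<open>s > 0\<close> n by (intro mult_strict_left_mono) (simp_all add: field_simps)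
    also have "\<dots> = r" using n by (simp add: s_def)
    finally show "s * (norm u + norm v) < r" .
  qed
  have dd: "f differentiable (at y)" "(\<lambda>y. frechet_derivative f (at y) u) differentiable (at y)"
    if "y \<in> ball x r" for y u
    using smooth_onD(1)[OF f] smooth_onD(1)[OF smooth_on_derivative[OF f]] that r by blast+
  obtain y where y: "y \<in> ball x r"
    "f (x + s *\<^sub>R u + s *\<^sub>R v) - f (x + s *\<^sub>R u) - f (x + s *\<^sub>R v) + f x = s * s * ?A u v y"
    using second_difference[OF s, of x f] dd by metis
  have s': "s * (norm v + norm u) < r" using s(2) by (simp add: add.commute)
  obtain z where z: "z \<in> ball x r"
    "f (x + s *\<^sub>R v + s *\<^sub>R u) - f (x + s *\<^sub>R v) - f (x + s *\<^sub>R u) + f x = s * s * ?A v u z"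
    using second_difference[OF s(1) s', of x f] dd by metis
  have "s * s * ?A u v y = s * s * ?A v u z"
    using y(2) z(2) by (simp add: algebra_simps)
  then have "?A u v y = ?A v u z" using s(1) by simp
  moreover have "\<bar>?A u v y - ?A u v x\<bar> < \<epsilon>" "\<bar>?A v u z - ?A v u x\<bar> < \<epsilon>"
    using d(3)[of y] d(4)[of z] y(1) z(1) by (auto simp: r_def dist_real_def dist_commute)
  ultimately show False unfolding \<epsilon>_def by (simp add: abs_if field_simps split: if_splits)
qed

lemma smooth_on_vec:
  fixes f :: "'a::euclidean_space \<Rightarrow> real ^ 'n"
  shows "open S \<Longrightarrow> smooth_on S f \<longleftrightarrow> (\<forall>i. smooth_on S (\<lambda>x. f x $ i))"
  unfolding smooth_on_def using Ck_on_vec by blast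

lemma frechet_derivative_nth:
  fixes f :: "'a::real_normed_vector \<Rightarrow> 'b::real_normed_vector ^ 'n"
  assumes "f differentiable (at x)"
  shows "frechet_derivative (\<lambda>y. f y $ i) (at x) v = frechet_derivative f (at x) v $ i"
  by (rule frechet_derivative_eqI)
    (rule bounded_linear.has_derivative[OF bounded_linear_vec_nth frechet_derivative_works_at[OF assms]])

lemma symmetric_second_derivative:
  fixes f :: "'a::euclidean_space \<Rightarrow> real ^ 'n"
  assumes f: "smooth_on S f" and S: "open S" "x \<in> S"
  shows "frechet_derivative (\<lambda>y. frechet_derivative f (at y) u) (at x) v =
    frechet_derivative (\<lambda>y. frechet_derivative f (at y) v) (at x) u"
proof -
  have *: "frechet_derivative (\<lambda>y. frechet_derivative f (at y) u) (at x) v $ i =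
      frechet_derivative (\<lambda>y. frechet_derivative (\<lambda>y. f y $ i) (at y) u) (at x) v" for i u v
  proof -
    have d: "(\<lambda>y. frechet_derivative f (at y) u) differentiable (at x)"
      using smooth_onD(1)[OF smooth_on_derivative[OF f] S(2)] .
    have d2: "(\<lambda>y. frechet_derivative f (at y) u $ i) differentiable (at x)"
      using bounded_linear.has_derivative[OF bounded_linear_vec_nth frechet_derivative_works_at[OF d]]
      by (auto simp: differentiable_def)
    have "frechet_derivative (\<lambda>y. frechet_derivative f (at y) u $ i) (at x) =
        frechet_derivative (\<lambda>y. frechet_derivative (\<lambda>y. f y $ i) (at y) u) (at x)"
      by (rule frechet_derivative_transform_within_open[OF d2 S])
        (simp add: frechet_derivative_nth[OF smooth_onD(1)[OF f]])
    then show ?thesis using frechet_derivative_nth[OF d, of i v] by simp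
  qed
  have "smooth_on S (\<lambda>y. f y $ i)" for i using f smooth_on_vec[OF S(1)] by blast
  then show ?thesis
    unfolding vec_eq_iff * using symmetric_second_derivative_real[OF _ S] by blast
qed

section \<open>Tensors in coordinates\<close>

lemma smooth_on_const: "smooth_on S (\<lambda>_. c)"
  and smooth_on_add: "open S \<Longrightarrow> smooth_on S f \<Longrightarrow> smooth_on S g \<Longrightarrow> smooth_on S (\<lambda>x. f x + g x)"
  and smooth_on_sum: "open S \<Longrightarrow> (\<And>i. i \<in> I \<Longrightarrow> smooth_on S (h i)) \<Longrightarrow> smooth_on S (\<lambda>x. \<Sum>i\<in>I. h i x)"
  and smooth_on_linear: "open S \<Longrightarrow> bounded_linear l \<Longrightarrow> smooth_on S f \<Longrightarrow> smooth_on S (\<lambda>x. l (f x))"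
  unfolding smooth_on_def
  by (auto intro: Ck_on_const Ck_on_add Ck_on_sum Ck_on_linear)

lemma
  fixes f g :: "'a::euclidean_space \<Rightarrow> real" and h :: "'i \<Rightarrow> 'a \<Rightarrow> real"
  shows smooth_on_mult: "open S \<Longrightarrow> smooth_on S f \<Longrightarrow> smooth_on S g \<Longrightarrow> smooth_on S (\<lambda>x. f x * g x)"
    and smooth_on_prod: "open S \<Longrightarrow> (\<And>i. i \<in> I \<Longrightarrow> smooth_on S (h i)) \<Longrightarrow> smooth_on S (\<lambda>x. \<Prod>i\<in>I. h i x)"
    and smooth_on_inverse: "open S \<Longrightarrow> smooth_on S f \<Longrightarrow> (\<And>x. x \<in> S \<Longrightarrow> f x \<noteq> 0) \<Longrightarrow> smooth_on S (\<lambda>x. inverse (f x))"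
  unfolding smooth_on_def by (auto intro: Ck_on_mult Ck_on_prod Ck_on_inverse)

lemma smooth_on_compose:
  fixes g :: "'a::euclidean_space \<Rightarrow> real ^ 'n" and f :: "real ^ 'n \<Rightarrow> 'b::real_normed_vector"
  shows "open S \<Longrightarrow> open T \<Longrightarrow> g ` S \<subseteq> T \<Longrightarrow> smooth_on T f \<Longrightarrow> smooth_on S g \<Longrightarrow> smooth_on S (\<lambda>x. f (g x))"
  unfolding smooth_on_def by (auto intro: Ck_on_compose)

lemma smooth_on_minus:
  fixes f g :: "'a::euclidean_space \<Rightarrow> real"
  shows "open S \<Longrightarrow> smooth_on S f \<Longrightarrow> smooth_on S g \<Longrightarrow> smooth_on S (\<lambda>x. f x - g x)"
  using smooth_on_add[of S f "\<lambda>x. (- 1) * g x"] smooth_on_mult[of S "\<lambda>_. - 1" g] smooth_on_const[of S]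
  by (simp add: smooth_on_const)

lemma smooth_on_det:
  fixes M :: "'a::euclidean_space \<Rightarrow> real ^ 'n ^ 'n"
  assumes "open S" "\<And>i j. smooth_on S (\<lambda>x. M x $ i $ j)"
  shows "smooth_on S (\<lambda>x. det (M x))"
  unfolding det_def
  by (intro smooth_on_sum smooth_on_mult smooth_on_prod smooth_on_const assms)

lemma matrix_inv_right:
  fixes M :: "'a::semiring_1 ^ 'n ^ 'm"
  assumes "invertible M"
  shows "M ** matrix_inv M = mat 1"
  using someI_ex[OF assms[unfolded invertible_def]] unfolding matrix_inv_def by blast

text \<open>By Cramer's rule the entries of the inverse are quotients of determinants, hence of
  polynomials in the entries of \<open>M\<close>.\<close>

lemma smooth_on_matrix_inv:
  fixes M :: "'a::euclidean_space \<Rightarrow> real ^ 'n ^ 'n"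
  assumes S: "open S" and M: "\<And>i j. smooth_on S (\<lambda>x. M x $ i $ j)"
    and inv: "\<And>x. x \<in> S \<Longrightarrow> invertible (M x)"
  shows "smooth_on S (\<lambda>x. matrix_inv (M x) $ k $ l)"
proof -
  define N where "N x = (\<chi> i j. if j = k then axis l 1 $ i else M x $ i $ j)" for x
  have "matrix_inv (M x) $ k $ l = det (N x) * inverse (det (M x))" if "x \<in> S" for x
  proof -
    have "det (M x) \<noteq> 0" using inv[OF that] by (simp add: invertible_det_nz)
    moreover have "M x *v (matrix_inv (M x) *v axis l 1) = axis l 1"
      using matrix_inv_right[OF inv[OF that]] by (simp add: matrix_vector_mul_assoc)
    ultimately have "matrix_inv (M x) *v axis l 1 = (\<chi> k. det (\<chi> i j. if j = k then axis l 1 $ i else M x $ i $ j) / det (M x))"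
      using cramer by blast
    then have "(matrix_inv (M x) *v axis l 1) $ k = det (N x) / det (M x)" by (simp add: N_def)
    then show ?thesis by (simp add: matrix_vector_mul_component inner_axis' divide_inverse matrix_vector_mult_basis column_def)
  qed
  moreover have "smooth_on S (\<lambda>x. det (N x) * inverse (det (M x)))"
  proof (intro smooth_on_mult smooth_on_inverse smooth_on_det S M)
    show "smooth_on S (\<lambda>x. N x $ i $ j)" for i j
      by (cases "j = k") (auto simp: N_def intro: smooth_on_const M)
    show "det (M x) \<noteq> 0" if "x \<in> S" for x using inv[OF that] by (simp add: invertible_det_nz)
  qed
  ultimately show ?thesis using smooth_on_cong[OF S] by (metis (no_types, lifting))
qed

lemma has_derivative_bilinear_field:
  fixes B :: "'s::real_normed_vector \<Rightarrow> real ^ 'n \<Rightarrow> real ^ 'm \<Rightarrow> 'b::real_normed_vector"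
  assumes lin: "\<forall>\<^sub>F t in at t0 within S. (\<forall>v. linear (\<lambda>u. B t u v)) \<and> (\<forall>u. linear (B t u))"
      "\<And>v. linear (\<lambda>u. B t0 u v)" "\<And>u. linear (B t0 u)" "t0 \<in> S"
      "\<And>h v. linear (\<lambda>u. B' h u v)" "\<And>h u. linear (B' h u)"
    and B: "\<And>u v. ((\<lambda>t. B t u v) has_derivative (\<lambda>h. B' h u v)) (at t0 within S)"
    and u: "(u has_derivative u') (at t0 within S)" and v: "(v has_derivative v') (at t0 within S)"
  shows "((\<lambda>t. B t (u t) (v t)) has_derivative
    (\<lambda>h. B' h (u t0) (v t0) + B t0 (u' h) (v t0) + B t0 (u t0) (v' h))) (at t0 within S)"
proof -
  have "((\<lambda>t. B t u (v t)) has_derivative (\<lambda>h. B' h u (v t0) + B t0 u (v' h))) (at t0 within S)" for u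
  proof (rule has_derivative_linear_field[where L = "\<lambda>t. B t u" and L' = "\<lambda>h. B' h u"])
    show "\<forall>\<^sub>F t in at t0 within S. linear (B t u)"
      using lin(1) by eventually_elim blast
  qed (use lin B v in auto)
  note D = this
  have "((\<lambda>t. (\<lambda>u. B t u (v t)) (u t)) has_derivative
      (\<lambda>h. (\<lambda>u. B' h u (v t0) + B t0 u (v' h)) (u t0) + (\<lambda>u. B t0 u (v t0)) (u' h))) (at t0 within S)"
  proof (rule has_derivative_linear_field[where L = "\<lambda>t u. B t u (v t)" and L' = "\<lambda>h u. B' h u (v t0) + B t0 u (v' h)"])
    show "\<forall>\<^sub>F t in at t0 within S. linear (\<lambda>u. B t u (v t))"
      using lin(1) by eventually_elim blast
    show "linear (\<lambda>u. B' h u (v t0) + B t0 u (v' h))" for h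
      by (intro linear_compose_add lin)
  qed (use lin D u in auto)
  then show ?thesis by (rule has_derivative_eq_rhs) (simp add: fun_eq_iff)
qed

lemma sum_swap3:
  "(\<Sum>l\<in>L. \<Sum>i\<in>I. \<Sum>j\<in>J. F i j l) = (\<Sum>i\<in>I. \<Sum>j\<in>J. \<Sum>l\<in>L. F i j l)"
  by (subst sum.swap) (intro sum.cong refl sum.swap)

section \<open>Charts, transition maps and tangent vectors\<close>

locale manifold =
  fixes A :: "('m::topological_space, 'n::finite) chart set"
  assumes A: "smooth_structure A"
begin

abbreviation range_of :: "('m, 'n) chart \<Rightarrow> (real ^ 'n) set" where
  "range_of c \<equiv> coord c ` dom_of c"

abbreviation overlap :: "('m, 'n) chart \<Rightarrow> ('m, 'n) chart \<Rightarrow> (real ^ 'n) set" where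
  "overlap c d \<equiv> coord c ` (dom_of c \<inter> dom_of d)"

abbreviation dtrans :: "('m, 'n) chart \<Rightarrow> ('m, 'n) chart \<Rightarrow> real ^ 'n \<Rightarrow> real ^ 'n \<Rightarrow> real ^ 'n" where
  "dtrans c d y \<equiv> frechet_derivative (transition c d) (at y)"

lemma chart:
  assumes "c \<in> A"
  shows "open (dom_of c)" "open (range_of c)" "continuous_on (dom_of c) (coord c)"
    "continuous_on (range_of c) (coord_inv c)" "\<And>p. p \<in> dom_of c \<Longrightarrow> coord_inv c (coord c p) = p"
  using A assms unfolding smooth_structure_def is_chart_def homeomorphism_def by auto

lemma coord_inv_in: "y \<in> range_of c \<Longrightarrow> coord_inv c y \<in> dom_of c" "y \<in> range_of c \<Longrightarrow> coord c (coord_inv c y) = y"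
  by (auto simp: inv_into_into f_inv_into_f)

lemma charts_at_D: "c \<in> charts_at A p \<Longrightarrow> c \<in> A" "c \<in> charts_at A p \<Longrightarrow> p \<in> dom_of c"
  by (auto simp: charts_at_def)

lemma charts_at_I: "c \<in> A \<Longrightarrow> p \<in> dom_of c \<Longrightarrow> c \<in> charts_at A p"
  by (auto simp: charts_at_def)

lemma chart_exists: obtains c where "c \<in> charts_at A p"
proof -
  have "p \<in> (\<Union>c\<in>A. dom_of c)" using A by (simp add: smooth_structure_def)
  then show thesis using that by (auto simp: charts_at_def)
qed

lemma overlap_open: 
  assumes "c \<in> A" "d \<in> A"
  shows "open (overlap c d)"
proof -
  have "overlap c d = range_of c \<inter> coord_inv c -` dom_of d"
    using chart(5)[OF assms(1)] by auto
  then show ?thesis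
    using continuous_open_preimage[OF chart(4)[OF assms(1)] chart(2)[OF assms(1)] chart(1)[OF assms(2)]] by simp
qed

lemma transition_coord: "c \<in> A \<Longrightarrow> p \<in> dom_of c \<Longrightarrow> transition c d (coord c p) = coord d p"
  by (simp add: transition_def chart(5))

lemma transition_in: "c \<in> A \<Longrightarrow> y \<in> overlap c d \<Longrightarrow> transition c d y \<in> overlap d c"
  by (elim imageE) (simp add: transition_coord)

lemma coord_inv_transition: "c \<in> A \<Longrightarrow> d \<in> A \<Longrightarrow> y \<in> overlap c d \<Longrightarrow> coord_inv d (transition c d y) = coord_inv c y"
  by (elim imageE) (simp add: transition_coord chart(5))

lemma transition_smooth: "c \<in> A \<Longrightarrow> d \<in> A \<Longrightarrow> smooth_on (overlap c d) (transition c d)"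
  using A unfolding smooth_structure_def compatible_def by blast

lemma transition_deriv:
  assumes "c \<in> A" "d \<in> A" "y \<in> overlap c d"
  shows "(transition c d has_derivative dtrans c d y) (at y)" "linear (dtrans c d y)"
  using smooth_onD(2,3)[OF transition_smooth assms(3)] assms by auto

text \<open>The chain rule as a cocycle condition; it is what makes the components in
  \<open>tangent_of\<close> compatible with each other.\<close>

lemma dtrans_chain:
  assumes "c \<in> A" "d \<in> A" "e \<in> A" "p \<in> dom_of c" "p \<in> dom_of d" "p \<in> dom_of e"
  shows "dtrans d e (coord d p) (dtrans c d (coord c p) u) = dtrans c e (coord c p) u"
proof -
  let ?S = "overlap c d \<inter> overlap c e"
  have S: "open ?S" by (intro open_Int overlap_open assms)
  have "(transition c d has_derivative dtrans c d (coord c p)) (at (coord c p))"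
    using assms by (intro transition_deriv) auto
  moreover have "(transition d e has_derivative dtrans d e (coord d p)) (at (transition c d (coord c p)))"
    using transition_deriv(1)[of d e "coord d p"] assms by (simp add: transition_coord)
  ultimately have "((\<lambda>y. transition d e (transition c d y)) has_derivative
      (\<lambda>u. dtrans d e (coord d p) (dtrans c d (coord c p) u))) (at (coord c p))"
    by (rule has_derivative_compose)
  then have "(transition c e has_derivative
      (\<lambda>u. dtrans d e (coord d p) (dtrans c d (coord c p) u))) (at (coord c p))"
  proof (rule has_derivative_transform_within_open[OF _ S])
    show "coord c p \<in> ?S" using assms by blast
    fix y assume "y \<in> ?S"
    then obtain q where q: "q \<in> dom_of c" "q \<in> dom_of d" "y = coord c q" by blast
    then have "q = coord_inv c y" using chart(5)[OF assms(1)] by metis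
    then show "transition d e (transition c d y) = transition c e y"
      using q assms by (simp add: transition_coord)
  qed
  then show ?thesis by (rule frechet_derivative_eqI[symmetric])
qed

lemma dtrans_id:
  assumes "c \<in> A" "y \<in> range_of c"
  shows "dtrans c c y u = u"
proof -
  have "(transition c c has_derivative (\<lambda>u. u)) (at y)"
    by (rule has_derivative_transform_within_open[OF has_derivative_ident chart(2)[OF assms(1)] assms(2)])
      (use assms in \<open>auto simp: transition_coord\<close>)
  then show ?thesis by (rule frechet_derivative_eqI)
qed

lemma dtrans_inverse:
  assumes "c \<in> A" "d \<in> A" "p \<in> dom_of c" "p \<in> dom_of d"
  shows "dtrans d c (coord d p) (dtrans c d (coord c p) u) = u"
  using assms by (simp add: dtrans_chain dtrans_id)

lemma tangent_of_in [simp]: "c \<in> charts_at A p \<Longrightarrow> tangent_of A p c u \<in> tangent_space A p"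
  unfolding tangent_space_def mem_Collect_eq
proof (intro conjI ballI allI impI)
  fix d e assume c: "c \<in> charts_at A p" and d: "d \<in> charts_at A p" and e: "e \<in> charts_at A p"
  then show "tangent_of A p c u e = dtrans d e (coord d p) (tangent_of A p c u d)"
    by (simp add: tangent_of_def dtrans_chain charts_at_D)
qed (simp add: tangent_of_def)

lemma tangent_of_at [simp]: "c \<in> charts_at A p \<Longrightarrow> tangent_of A p c u c = u"
  using dtrans_id[of c "coord c p"] charts_at_D[of c p] unfolding tangent_of_def by (metis imageI)

lemma tangent_of_eq: "v \<in> tangent_space A p \<Longrightarrow> c \<in> charts_at A p \<Longrightarrow> tangent_of A p c (v c) = v"
  unfolding tangent_space_def tangent_of_def mem_Collect_eq by (intro ext) (metis (full_types))

lemma tangent_change: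
  "v \<in> tangent_space A p \<Longrightarrow> c \<in> charts_at A p \<Longrightarrow> d \<in> charts_at A p \<Longrightarrow> v d = dtrans c d (coord c p) (v c)"
  unfolding tangent_space_def by blast

lemma tangent_eqI:
  "v \<in> tangent_space A p \<Longrightarrow> w \<in> tangent_space A p \<Longrightarrow> c \<in> charts_at A p \<Longrightarrow> v c = w c \<Longrightarrow> v = w"
  using tangent_of_eq by metis

lemma tangentI:
  assumes "\<And>c d. c \<in> charts_at A p \<Longrightarrow> d \<in> charts_at A p \<Longrightarrow> v d = dtrans c d (coord c p) (v c)"
    "\<And>c. c \<notin> charts_at A p \<Longrightarrow> v c = 0"
  shows "v \<in> tangent_space A p"
  using assms unfolding tangent_space_def by blast

lemma dtrans_linear: "c \<in> charts_at A p \<Longrightarrow> d \<in> charts_at A p \<Longrightarrow> linear (dtrans c d (coord c p))"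
  by (rule transition_deriv(2)) (simp_all add: charts_at_def)

lemma tangent_of_linear:
  assumes "c \<in> charts_at A p"
  shows "linear (tangent_of A p c)"
  using linear_add[OF dtrans_linear[OF assms]] linear_cmul[OF dtrans_linear[OF assms]]
  by (intro linearI ext) (simp_all add: tangent_of_def scaleR_fun_def)

lemma tangent_subspace: "subspace (tangent_space A p)"
  unfolding subspace_def
proof (intro conjI ballI allI)
  show "0 \<in> tangent_space A p" by (rule tangentI) (simp_all add: linear_0[OF dtrans_linear])
  fix x y r assume x: "x \<in> tangent_space A p"
  have 0: "z c = 0" if "z \<in> tangent_space A p" "c \<notin> charts_at A p" for z c
    using that unfolding tangent_space_def by blast
  show "r *\<^sub>R x \<in> tangent_space A p"
    by (rule tangentI)
      (simp_all add: scaleR_fun_def linear_cmul[OF dtrans_linear] tangent_change[OF x, symmetric] 0[OF x])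
  assume y: "y \<in> tangent_space A p"
  show "x + y \<in> tangent_space A p"
    by (rule tangentI) (simp_all add: linear_add[OF dtrans_linear] tangent_change[OF x, symmetric]
        tangent_change[OF y, symmetric] 0[OF x] 0[OF y])
qed

end

section \<open>The metric and the Levi-Civita connection in coordinates\<close>

locale semi_riemannian = manifold A for A :: "('m::topological_space, 'n::finite) chart set" +
  fixes g :: "('m, 'n) metric"
  assumes g: "semi_riemannian_metric A g"
begin

text \<open>The metric on coordinate vectors: with the arguments fixed it can be differentiated in
  the base point, which tangent vectors at varying points do not allow.\<close>

definition G :: "('m, 'n) chart \<Rightarrow> real ^ 'n \<Rightarrow> real ^ 'n \<Rightarrow> real ^ 'n \<Rightarrow> real" where
  "G c y u v = g (coord_inv c y) (tangent_of A (coord_inv c y) c u) (tangent_of A (coord_inv c y) c v)"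

abbreviation dG :: "('m, 'n) chart \<Rightarrow> real ^ 'n \<Rightarrow> real ^ 'n \<Rightarrow> real ^ 'n \<Rightarrow> real ^ 'n \<Rightarrow> real" where
  "dG c y u v \<equiv> frechet_derivative (\<lambda>y. G c y u v) (at y)"

abbreviation \<Gamma> :: "('m, 'n) chart \<Rightarrow> real ^ 'n \<Rightarrow> real ^ 'n \<Rightarrow> real ^ 'n \<Rightarrow> real ^ 'n" where
  "\<Gamma> \<equiv> gamma_form A g"

abbreviation d\<Gamma> :: "('m, 'n) chart \<Rightarrow> real ^ 'n \<Rightarrow> real ^ 'n \<Rightarrow> real ^ 'n \<Rightarrow> real ^ 'n \<Rightarrow> real ^ 'n" where
  "d\<Gamma> c y u v \<equiv> frechet_derivative (\<lambda>y. \<Gamma> c y u v) (at y)"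

lemma g_props:
  assumes "u \<in> tangent_space A p" "v \<in> tangent_space A p"
  shows "g p u v = g p v u" "w \<in> tangent_space A p \<Longrightarrow> g p (u + v) w = g p u w + g p v w"
    "g p (r *\<^sub>R u) v = r * g p u v"
  using g assms unfolding semi_riemannian_metric_def by blast+

lemma g_nondegenerate:
  "u \<in> tangent_space A p \<Longrightarrow> (\<And>v. v \<in> tangent_space A p \<Longrightarrow> g p u v = 0) \<Longrightarrow> u = 0"
  using g unfolding semi_riemannian_metric_def nondegenerate_on_def by blast

lemma g_coord:
  assumes "c \<in> charts_at A p" "u \<in> tangent_space A p" "v \<in> tangent_space A p"
  shows "g p u v = G c (coord c p) (u c) (v c)"
  using assms chart(5)[OF charts_at_D(1)] by (auto simp: G_def tangent_of_eq charts_at_D)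

lemma coord_inv_chart: "c \<in> A \<Longrightarrow> y \<in> range_of c \<Longrightarrow> c \<in> charts_at A (coord_inv c y)"
  by (intro charts_at_I coord_inv_in)

lemma G_sym: "c \<in> A \<Longrightarrow> y \<in> range_of c \<Longrightarrow> G c y u v = G c y v u"
  unfolding G_def by (intro g_props tangent_of_in coord_inv_chart)

lemma G_linear1: "c \<in> A \<Longrightarrow> y \<in> range_of c \<Longrightarrow> linear (\<lambda>u. G c y u v)"
  using coord_inv_chart
  by (intro linearI) (simp_all add: G_def linear_add[OF tangent_of_linear] linear_cmul[OF tangent_of_linear] g_props)

lemma G_linear2: "c \<in> A \<Longrightarrow> y \<in> range_of c \<Longrightarrow> linear (G c y u)"
proof -
  assume c: "c \<in> A" "y \<in> range_of c"
  have "G c y u = (\<lambda>v. G c y v u)" using G_sym[OF c] by (intro ext)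
  then show ?thesis using G_linear1[OF c] by simp
qed

lemma G_nondegenerate:
  assumes "c \<in> A" "y \<in> range_of c" "\<And>v. G c y u v = 0"
  shows "u = 0"
proof -
  let ?p = "coord_inv c y"
  have c: "c \<in> charts_at A ?p" by (rule coord_inv_chart[OF assms(1,2)])
  have "tangent_of A ?p c u = 0"
  proof (rule g_nondegenerate)
    show "g ?p (tangent_of A ?p c u) v = 0" if "v \<in> tangent_space A ?p" for v
      using assms(3)[of "v c"] by (simp add: G_def tangent_of_eq[OF that c])
  qed (simp add: c)
  then show ?thesis using tangent_of_at[OF c, of u] by simp
qed

lemma metric_matrix_nth: "metric_matrix A g c y $ i $ j = G c y (axis i 1) (axis j 1)"
  by (simp add: metric_matrix_def G_def)

lemma G_matrix:
  assumes "c \<in> A" "y \<in> range_of c"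
  shows "G c y u v = u \<bullet> (metric_matrix A g c y *v v)"
proof -
  have "G c y u v = (\<Sum>i\<in>UNIV. u $ i * G c y (axis i 1) v)"
    by (subst linear_vec_expand[OF G_linear1[OF assms]]) simp
  also have "\<dots> = (\<Sum>i\<in>UNIV. u $ i * (\<Sum>j\<in>UNIV. v $ j * G c y (axis i 1) (axis j 1)))"
    by (subst linear_vec_expand[OF G_linear2[OF assms]]) simp
  finally show ?thesis
    by (simp add: inner_vec_def matrix_vector_mult_def metric_matrix_nth mult.commute)
qed

lemma metric_matrix_invertible:
  assumes "c \<in> A" "y \<in> range_of c"
  shows "invertible (metric_matrix A g c y)"
proof -
  have "x = 0" if "metric_matrix A g c y *v x = 0" for x
    using that G_matrix[OF assms, of _ x] G_sym[OF assms, of x] by (intro G_nondegenerate[OF assms]) simp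
  then show ?thesis
    by (meson invertible_left_inverse matrix_left_invertible_ker)
qed

lemma metric_matrix_smooth: "c \<in> A \<Longrightarrow> smooth_on (range_of c) (\<lambda>y. metric_matrix A g c y $ i $ j)"
proof -
  assume c: "c \<in> A"
  have "smooth_on (range_of c) (metric_matrix A g c)"
    using g c unfolding semi_riemannian_metric_def by blast
  then show ?thesis
    using smooth_on_linear[OF chart(2)[OF c] bounded_linear_compose[OF bounded_linear_vec_nth[of j] bounded_linear_vec_nth[of i]]]
    by blast
qed

lemma G_smooth: "c \<in> A \<Longrightarrow> smooth_on (range_of c) (\<lambda>y. G c y u v)"
proof -
  assume c: "c \<in> A"
  have "smooth_on (range_of c) (\<lambda>y. \<Sum>i\<in>UNIV. u $ i * (\<Sum>j\<in>UNIV. metric_matrix A g c y $ i $ j * v $ j))"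
    by (intro smooth_on_sum smooth_on_mult smooth_on_const metric_matrix_smooth chart(2) c)
  then show ?thesis
    by (subst smooth_on_cong[OF chart(2)[OF c]])
      (auto simp: G_matrix[OF c] inner_vec_def matrix_vector_mult_def)
qed

lemma \<Gamma>_smooth: 
  assumes c: "c \<in> A"
  shows "smooth_on (range_of c) (\<lambda>y. \<Gamma> c y u v)"
proof -
  have *: "smooth_on (range_of c) (\<lambda>y. partial_deriv i (\<lambda>z. metric_matrix A g c z $ j $ l) y)" for i j l
    unfolding partial_deriv_def by (intro smooth_on_derivative metric_matrix_smooth c)
  show ?thesis
    unfolding smooth_on_vec[OF chart(2)[OF c]] gamma_form_def christoffel_def vec_lambda_beta
    by (intro allI smooth_on_sum smooth_on_mult smooth_on_minus smooth_on_add smooth_on_const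
        smooth_on_matrix_inv metric_matrix_smooth metric_matrix_invertible chart(2) c *)
qed

lemma \<Gamma>_linear1: "linear (\<lambda>u. \<Gamma> c y u v)" and \<Gamma>_linear2: "linear (\<Gamma> c y u)"
  by (rule linearI; simp add: gamma_form_def vec_eq_iff sum.distrib[symmetric] sum_distrib_left algebra_simps)+

lemma dG_linear1: "c \<in> A \<Longrightarrow> y \<in> range_of c \<Longrightarrow> linear (\<lambda>u. dG c y u v h)"
  by (rule linear_frechet_derivative_field[OF chart(2)])
    (auto intro: G_linear1 smooth_onD(1)[OF G_smooth])

lemma dG_linear2: "c \<in> A \<Longrightarrow> y \<in> range_of c \<Longrightarrow> linear (\<lambda>v. dG c y u v h)"
  by (rule linear_frechet_derivative_field[OF chart(2)])
    (auto intro: G_linear2 smooth_onD(1)[OF G_smooth])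

lemma dG_linear3: "c \<in> A \<Longrightarrow> y \<in> range_of c \<Longrightarrow> linear (dG c y u v)"
  by (intro smooth_onD(3)[OF G_smooth])

lemma dG_sym: "c \<in> A \<Longrightarrow> y \<in> range_of c \<Longrightarrow> dG c y u v = dG c y v u"
  by (rule frechet_derivative_transform_within_open[OF smooth_onD(1)[OF G_smooth] chart(2)])
    (auto intro: G_sym)

text \<open>The Christoffel symbols are the Koszul expression on basis vectors with an index raised
  by the inverse metric matrix. Pairing with \<open>G\<close> lowers it again, and linearity passes
  to all vectors. Symmetry, metric compatibility and the transformation law of \<Gamma> are all
  drawn from this identity.\<close>

lemma koszul:
  assumes c: "c \<in> A" "y \<in> range_of c"
  shows "2 * G c y (\<Gamma> c y u v) w = dG c y v w u + dG c y u w v - dG c y u v w"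
proof -
  define K where "K u v w = dG c y v w u + dG c y u w v - dG c y u v w" for u v w
  have K1: "linear (\<lambda>u. K u v w)" and K2: "linear (\<lambda>v. K u v w)" and K3: "linear (K u v)" for u v w
    unfolding K_def by (intro linear_compose_add linear_compose_sub dG_linear1 dG_linear2 dG_linear3 c)+
  let ?M = "metric_matrix A g c y"
  have K_expand: "K u v w = (\<Sum>i\<in>UNIV. \<Sum>j\<in>UNIV. u $ i * (v $ j * K (axis i 1) (axis j 1) w))" for w
    by (subst linear_vec_expand[OF K1], subst linear_vec_expand[OF K2]) (simp add: sum_distrib_left)
  have chr: "christoffel A g c y k i j = (1 / 2) * (\<Sum>l\<in>UNIV. matrix_inv ?M $ k $ l * K (axis i 1) (axis j 1) (axis l 1))"
    for k i j
    unfolding christoffel_def partial_deriv_def metric_matrix_nth K_def ..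
  have "\<Gamma> c y u v $ k = (\<Sum>l\<in>UNIV. matrix_inv ?M $ k $ l * ((1 / 2) * K u v (axis l 1)))" for k
  proof -
    have "(\<Sum>l\<in>UNIV. matrix_inv ?M $ k $ l * ((1 / 2) * K u v (axis l 1))) = (\<Sum>i\<in>UNIV. \<Sum>j\<in>UNIV. \<Sum>l\<in>UNIV.
        matrix_inv ?M $ k $ l * ((1 / 2) * (u $ i * (v $ j * K (axis i 1) (axis j 1) (axis l 1)))))"
      unfolding K_expand sum_distrib_left by (rule sum_swap3)
    also have "\<dots> = \<Gamma> c y u v $ k"
      unfolding gamma_form_def vec_lambda_beta chr sum_distrib_left sum_distrib_right
      by (intro sum.cong refl) simp
    finally show ?thesis by (rule sym)
  qed
  then have "\<Gamma> c y u v = matrix_inv ?M *v (\<chi> l. (1 / 2) * K u v (axis l 1))"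
    by (simp add: vec_eq_iff matrix_vector_mult_def)
  then have "?M *v \<Gamma> c y u v = (\<chi> l. (1 / 2) * K u v (axis l 1))"
    using matrix_inv_right[OF metric_matrix_invertible[OF c]] by (simp add: matrix_vector_mul_assoc)
  then have "2 * G c y (\<Gamma> c y u v) w = (\<Sum>l\<in>UNIV. w $ l * K u v (axis l 1))"
    unfolding G_sym[OF c, of "\<Gamma> c y u v" w] unfolding G_matrix[OF c]
    by (simp add: inner_vec_def sum_distrib_left)
  also have "\<dots> = K u v w" by (subst (2) linear_vec_expand[OF K3]) simp
  finally show ?thesis by (simp add: K_def)
qed

end

context semi_riemannian
begin

text \<open>In the sum of the Koszul identities for \<open>(h, u, v)\<close> and
  \<open>(h, v, u)\<close> only the derivative in direction \<open>h\<close> survives,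
  twice.\<close>

lemma metric_compatible:
  assumes c: "c \<in> A" "y \<in> range_of c"
  shows "dG c y u v h = G c y (\<Gamma> c y h u) v + G c y u (\<Gamma> c y h v)"
proof -
  have "dG c y h v = dG c y v h" "dG c y u h = dG c y h u" "dG c y v u = dG c y u v"
    using dG_sym[OF c] by auto
  then show ?thesis
    using koszul[OF c, of h u v] koszul[OF c, of h v u] G_sym[OF c, of u "\<Gamma> c y h v"] by simp
qed

lemma \<Gamma>_sym: "c \<in> A \<Longrightarrow> y \<in> range_of c \<Longrightarrow> \<Gamma> c y u v = \<Gamma> c y v u"
proof -
  assume c: "c \<in> A" "y \<in> range_of c"
  have "G c y (\<Gamma> c y u v - \<Gamma> c y v u) w = 0" for w
    using koszul[OF c, of u v w] koszul[OF c, of v u w] dG_sym[OF c, of u v]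
    by (simp add: linear_diff[OF G_linear1[OF c]])
  then show ?thesis using G_nondegenerate[OF c] by fastforce
qed

lemma G_bilinear_derivative:
  fixes y :: "'s::real_normed_vector \<Rightarrow> real ^ 'n"
  assumes c: "c \<in> A" "y t0 \<in> range_of c" "t0 \<in> S"
    and y: "(y has_derivative y') (at t0 within S)"
    and u: "(u has_derivative u') (at t0 within S)" and v: "(v has_derivative v') (at t0 within S)"
  shows "((\<lambda>t. G c (y t) (u t) (v t)) has_derivative
    (\<lambda>h. dG c (y t0) (u t0) (v t0) (y' h) + G c (y t0) (u' h) (v t0) + G c (y t0) (u t0) (v' h))) (at t0 within S)"
proof (rule has_derivative_bilinear_field[where B = "\<lambda>t. G c (y t)" and B' = "\<lambda>h u v. dG c (y t0) u v (y' h)"])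
  have "continuous (at t0 within S) y" using y has_derivative_continuous by blast
  then have "\<forall>\<^sub>F t in at t0 within S. y t \<in> range_of c"
    using c(2) chart(2)[OF c(1)] by (metis continuous_within topological_tendstoD)
  then show "\<forall>\<^sub>F t in at t0 within S. (\<forall>v. linear (\<lambda>u. G c (y t) u v)) \<and> (\<forall>u. linear (G c (y t) u))"
    by eventually_elim (use G_linear1 G_linear2 c in blast)
  show "((\<lambda>t. G c (y t) u v) has_derivative (\<lambda>h. dG c (y t0) u v (y' h))) (at t0 within S)" for u v
    using has_derivative_compose[OF y smooth_onD(2)[OF G_smooth c(2)]] c(1) by blast
qed (use c u v G_linear1 G_linear2 dG_linear1 dG_linear2 in auto)

lemma \<Gamma>_derivative_linear:
  assumes "c \<in> A" "y \<in> range_of c"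
  shows "linear (\<lambda>u. d\<Gamma> c y u v h)" "linear (\<lambda>v. d\<Gamma> c y u v h)"
  by (rule linear_frechet_derivative_field[OF chart(2)[OF assms(1)] assms(2)];
      intro \<Gamma>_linear1 \<Gamma>_linear2 smooth_onD(1)[OF \<Gamma>_smooth] assms)+

lemma \<Gamma>_bilinear_derivative:
  fixes y :: "'s::real_normed_vector \<Rightarrow> real ^ 'n"
  assumes c: "c \<in> A" "y t0 \<in> range_of c" "t0 \<in> S"
    and y: "(y has_derivative y') (at t0 within S)"
    and u: "(u has_derivative u') (at t0 within S)" and v: "(v has_derivative v') (at t0 within S)"
  shows "((\<lambda>t. \<Gamma> c (y t) (u t) (v t)) has_derivative
    (\<lambda>h. d\<Gamma> c (y t0) (u t0) (v t0) (y' h) + \<Gamma> c (y t0) (u' h) (v t0) + \<Gamma> c (y t0) (u t0) (v' h))) (at t0 within S)"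
proof (rule has_derivative_bilinear_field[where B = "\<lambda>t. \<Gamma> c (y t)" and B' = "\<lambda>h u v. d\<Gamma> c (y t0) u v (y' h)"])
  show "((\<lambda>t. \<Gamma> c (y t) u v) has_derivative (\<lambda>h. d\<Gamma> c (y t0) u v (y' h))) (at t0 within S)" for u v
    using has_derivative_compose[OF y smooth_onD(2)[OF \<Gamma>_smooth c(2)]] c(1) by blast
qed (use c u v \<Gamma>_linear1 \<Gamma>_linear2 \<Gamma>_derivative_linear in auto)

abbreviation d2trans where
  "d2trans c d y u v \<equiv> frechet_derivative (\<lambda>y. dtrans c d y u) (at y) v"

lemma dtrans_smooth: "c \<in> A \<Longrightarrow> d \<in> A \<Longrightarrow> smooth_on (overlap c d) (\<lambda>y. dtrans c d y u)"
  by (intro smooth_on_derivative transition_smooth)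

lemma dtrans_linear_derivative:
  fixes y :: "'s::real_normed_vector \<Rightarrow> real ^ 'n"
  assumes c: "c \<in> A" "d \<in> A" "y t0 \<in> overlap c d" "t0 \<in> S"
    and y: "(y has_derivative y') (at t0 within S)" and u: "(u has_derivative u') (at t0 within S)"
  shows "((\<lambda>t. dtrans c d (y t) (u t)) has_derivative
    (\<lambda>h. d2trans c d (y t0) (u t0) (y' h) + dtrans c d (y t0) (u' h))) (at t0 within S)"
proof (rule has_derivative_linear_field[where L = "\<lambda>t. dtrans c d (y t)" and L' = "\<lambda>h u. d2trans c d (y t0) u (y' h)"])
  have "continuous (at t0 within S) y" using y has_derivative_continuous by blast
  then have "\<forall>\<^sub>F t in at t0 within S. y t \<in> overlap c d"
    using c(3) overlap_open[OF c(1,2)] by (metis continuous_within topological_tendstoD)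
  then show "\<forall>\<^sub>F t in at t0 within S. linear (dtrans c d (y t))"
    by eventually_elim (use transition_deriv c in blast)
  show "((\<lambda>t. dtrans c d (y t) u) has_derivative (\<lambda>h. d2trans c d (y t0) u (y' h))) (at t0 within S)" for u
    using has_derivative_compose[OF y smooth_onD(2)[OF dtrans_smooth c(3)]] c(1,2) by blast
  show "linear (\<lambda>u. d2trans c d (y t0) u (y' h))" for h
    by (rule linear_frechet_derivative_field[OF overlap_open[OF c(1,2)] c(3)])
      (use transition_deriv(2) smooth_onD(1)[OF dtrans_smooth c(3)] c in auto)
qed (use c u transition_deriv in auto)

lemma d2trans_sym: "c \<in> A \<Longrightarrow> d \<in> A \<Longrightarrow> y \<in> overlap c d \<Longrightarrow> d2trans c d y u v = d2trans c d y v u"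
  by (rule symmetric_second_derivative[OF transition_smooth overlap_open])

lemma G_transform:
  assumes c: "c \<in> A" "d \<in> A" "y \<in> overlap c d"
  shows "G d (transition c d y) (dtrans c d y u) (dtrans c d y v) = G c y u v"
proof -
  obtain p where p: "p \<in> dom_of c" "p \<in> dom_of d" "y = coord c p" using c(3) by blast
  have ch: "c \<in> charts_at A p" "d \<in> charts_at A p" using c p by (auto intro: charts_at_I)
  have "tangent_of A p c w d = dtrans c d y w" for w
    using ch p by (simp add: tangent_of_def)
  then show ?thesis
    using g_coord[OF ch(1), of "tangent_of A p c u" "tangent_of A p c v"]
      g_coord[OF ch(2), of "tangent_of A p c u" "tangent_of A p c v"] ch p c
    by (simp add: transition_coord)
qed

lemma dtrans_surj:
  assumes "c \<in> A" "d \<in> A" "y \<in> overlap c d"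
  obtains u where "v = dtrans c d y u"
proof -
  obtain p where p: "p \<in> dom_of c" "p \<in> dom_of d" "y = coord c p" using assms(3) by blast
  then show thesis using dtrans_inverse[of d c p v] assms that by metis
qed

text \<open>Differentiating the invariance of the metric expresses \<open>dG d\<close> by
  \<open>dG c\<close> and second derivatives of the transition map. In the Koszul combination the
  symmetry of the latter cancels all of them but \<open>d2trans c d y u v\<close>, and nondegeneracy
  removes the test vector.\<close>

lemma \<Gamma>_transform:
  assumes c: "c \<in> A" "d \<in> A" "y \<in> overlap c d"
  shows "\<Gamma> d (transition c d y) (dtrans c d y u) (dtrans c d y v) + d2trans c d y u v = dtrans c d y (\<Gamma> c y u v)"
proof -
  let ?z = "transition c d y" and ?D = "dtrans c d y" and ?H = "d2trans c d y"
  have y: "y \<in> range_of c" using c(3) by auto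
  have z: "?z \<in> range_of d" using transition_in[OF c(1,3)] by auto
  have H: "?H u v = ?H v u" for u v using d2trans_sym[OF c] .
  note lin = linear_add[OF G_linear1[OF c(2) z]] linear_diff[OF G_linear1[OF c(2) z]]
  have dG: "dG d ?z (?D u) (?D v) (?D h) + G d ?z (?H u h) (?D v) + G d ?z (?D u) (?H v h) = dG c y u v h" for u v h
  proof -
    have D: "((\<lambda>y. dtrans c d y u) has_derivative ?H u) (at y)" for u
      using smooth_onD(2)[OF dtrans_smooth c(3)] c by blast
    have "((\<lambda>y. G d (transition c d y) (dtrans c d y u) (dtrans c d y v)) has_derivative
        (\<lambda>h. dG d ?z (?D u) (?D v) (?D h) + G d ?z (?H u h) (?D v) + G d ?z (?D u) (?H v h))) (at y)"
      by (rule G_bilinear_derivative[OF c(2) z _ transition_deriv(1)[OF c] D D]) simp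
    then have "((\<lambda>y. G c y u v) has_derivative
        (\<lambda>h. dG d ?z (?D u) (?D v) (?D h) + G d ?z (?H u h) (?D v) + G d ?z (?D u) (?H v h))) (at y)"
      by (rule has_derivative_transform_within_open[OF _ overlap_open[OF c(1,2)] c(3)])
        (rule G_transform[OF c(1,2)])
    then show ?thesis by (rule frechet_derivative_eqI[symmetric])
  qed
  have "G d ?z (\<Gamma> d ?z (?D u) (?D v) + ?H u v - ?D (\<Gamma> c y u v)) w' = 0" for w'
  proof -
    obtain w where w: "w' = ?D w" using dtrans_surj[OF c] by metis
    have "2 * G d ?z (\<Gamma> d ?z (?D u) (?D v)) (?D w) + 2 * G d ?z (?H u v) (?D w) = 2 * G c y (\<Gamma> c y u v) w"
      unfolding koszul[OF c(2) z] koszul[OF c(1) y] dG[symmetric]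
      using G_sym[OF c(2) z, of "?D v" "?H w u"] G_sym[OF c(2) z, of "?D u" "?H w v"]
        H[of v u] H[of u w] H[of v w] by simp
    also have "G c y (\<Gamma> c y u v) w = G d ?z (?D (\<Gamma> c y u v)) (?D w)" using G_transform[OF c] by simp
    finally show ?thesis by (simp add: lin w)
  qed
  then have "\<Gamma> d ?z (?D u) (?D v) + ?H u v - ?D (\<Gamma> c y u v) = 0" using G_nondegenerate[OF c(2) z] by blast
  then show ?thesis by simp
qed

section \<open>The curvature tensor and its symmetries\<close>

definition R :: "('m, 'n) chart \<Rightarrow> real ^ 'n \<Rightarrow> real ^ 'n \<Rightarrow> real ^ 'n \<Rightarrow> real ^ 'n \<Rightarrow> real ^ 'n" where
  "R c y u v w = d\<Gamma> c y v w u + \<Gamma> c y u (\<Gamma> c y v w) - d\<Gamma> c y u w v - \<Gamma> c y v (\<Gamma> c y u w)"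

lemma curvature_coord_R: "curvature_coord A g c (\<lambda>_. u) (\<lambda>_. v) (\<lambda>_. w) y = R c y u v w"
  by (simp add: curvature_coord_def nabla_coord_def lie_bracket_def R_def linear_0[OF \<Gamma>_linear1])

text \<open>Differentiating the law of \<Gamma> brings in the third derivative \<open>T\<close> of
  the transition map. It is symmetric in its arguments, so it drops out on antisymmetrizing in
  \<open>u\<close> and \<open>v\<close>, and so do the terms with the second derivative
  \<open>?H\<close>.\<close>

lemma R_transform:
  assumes c: "c \<in> A" "d \<in> A" "y \<in> overlap c d"
  shows "R d (transition c d y) (dtrans c d y u) (dtrans c d y v) (dtrans c d y w) = dtrans c d y (R c y u v w)"
proof -
  let ?z = "transition c d y" and ?D = "dtrans c d y" and ?H = "d2trans c d y"
  define T where "T u v w = frechet_derivative (\<lambda>y. d2trans c d y u v) (at y) w" for u v w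
  have y: "y \<in> range_of c" using c(3) by auto
  have z: "?z \<in> range_of d" using transition_in[OF c(1,3)] by auto
  have H: "?H u v = ?H v u" for u v using d2trans_sym[OF c] .
  have Hs: "smooth_on (overlap c d) (\<lambda>y. d2trans c d y u v)" for u v
    by (intro smooth_on_derivative transition_smooth c)
  have T: "T u v w = T w v u" for u v w
  proof -
    have 1: "T u v w = T v u w" for u v w
      unfolding T_def
      by (rule fun_cong[OF frechet_derivative_transform_within_open[OF smooth_onD(1)[OF Hs c(3)] overlap_open[OF c(1,2)] c(3)]])
        (rule d2trans_sym[OF c(1,2)])
    have 2: "T u v w = T u w v" for u v w
      unfolding T_def by (rule symmetric_second_derivative[OF dtrans_smooth overlap_open]) (use c in auto)
    show ?thesis using 1 2 by metis
  qed
  have d\<Gamma>: "d\<Gamma> d ?z (?D v) (?D w) (?D u) + \<Gamma> d ?z (?H v u) (?D w) + \<Gamma> d ?z (?D v) (?H w u) + T v w u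
      = ?H (\<Gamma> c y v w) u + ?D (d\<Gamma> c y v w u)" for u v w
  proof -
    have D: "((\<lambda>y. dtrans c d y u) has_derivative ?H u) (at y)" for u
      using smooth_onD(2)[OF dtrans_smooth c(3)] c by blast
    have "((\<lambda>y. \<Gamma> d (transition c d y) (dtrans c d y v) (dtrans c d y w)) has_derivative
        (\<lambda>u. d\<Gamma> d ?z (?D v) (?D w) (?D u) + \<Gamma> d ?z (?H v u) (?D w) + \<Gamma> d ?z (?D v) (?H w u))) (at y)"
      by (rule \<Gamma>_bilinear_derivative[OF c(2) z _ transition_deriv(1)[OF c] D D]) simp
    then have 1: "((\<lambda>y. \<Gamma> d (transition c d y) (dtrans c d y v) (dtrans c d y w) + d2trans c d y v w) has_derivative
        (\<lambda>u. d\<Gamma> d ?z (?D v) (?D w) (?D u) + \<Gamma> d ?z (?H v u) (?D w) + \<Gamma> d ?z (?D v) (?H w u) + T v w u)) (at y)"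
      unfolding T_def by (rule has_derivative_add) (rule smooth_onD(2)[OF Hs c(3)])
    have "((\<lambda>y. dtrans c d y (\<Gamma> c y v w)) has_derivative
        (\<lambda>u. ?H (\<Gamma> c y v w) u + ?D (d\<Gamma> c y v w u))) (at y)"
      by (rule dtrans_linear_derivative[OF c _ has_derivative_ident smooth_onD(2)[OF \<Gamma>_smooth y]]) (use c in auto)
    then have "((\<lambda>y. \<Gamma> d (transition c d y) (dtrans c d y v) (dtrans c d y w) + d2trans c d y v w) has_derivative
        (\<lambda>u. ?H (\<Gamma> c y v w) u + ?D (d\<Gamma> c y v w u))) (at y)"
      by (rule has_derivative_transform_within_open[OF _ overlap_open[OF c(1,2)] c(3)])
        (rule \<Gamma>_transform[OF c(1,2), symmetric])
    from fun_cong[OF has_derivative_unique[OF 1 this]] show ?thesis .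
  qed
  have \<Gamma>\<Gamma>: "\<Gamma> d ?z (?D u) (\<Gamma> d ?z (?D v) (?D w)) =
      ?D (\<Gamma> c y u (\<Gamma> c y v w)) - ?H u (\<Gamma> c y v w) - \<Gamma> d ?z (?D u) (?H v w)" for u v w
  proof -
    have "\<Gamma> d ?z (?D v) (?D w) = ?D (\<Gamma> c y v w) - ?H v w"
      using \<Gamma>_transform[OF c, of v w] by (simp add: algebra_simps)
    then have "\<Gamma> d ?z (?D u) (\<Gamma> d ?z (?D v) (?D w)) = \<Gamma> d ?z (?D u) (?D (\<Gamma> c y v w)) - \<Gamma> d ?z (?D u) (?H v w)"
      by (simp add: linear_diff[OF \<Gamma>_linear2])
    then show ?thesis using \<Gamma>_transform[OF c, of u "\<Gamma> c y v w"] by (simp add: algebra_simps)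
  qed
  have d\<Gamma>': "d\<Gamma> d ?z (?D v) (?D w) (?D u) = ?H (\<Gamma> c y v w) u + ?D (d\<Gamma> c y v w u) - T v w u
      - \<Gamma> d ?z (?H v u) (?D w) - \<Gamma> d ?z (?D v) (?H w u)" for u v w
    using d\<Gamma>[of v w u] by (simp add: algebra_simps)
  show ?thesis
    unfolding R_def d\<Gamma>' \<Gamma>\<Gamma> linear_add[OF transition_deriv(2)[OF c]] linear_diff[OF transition_deriv(2)[OF c]]
    using T[of v w u] H[of v u] H[of w u] H[of w v] H[of u "\<Gamma> c y v w"] H[of v "\<Gamma> c y u w"]
    by (simp add: algebra_simps)
qed

lemma R_skew: "R c y u v w = - R c y v u w"
  by (simp add: R_def)

text \<open>With \<Gamma>, and hence its derivative, symmetric, the cyclic sum cancels in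
  pairs.\<close>

lemma bianchi:
  assumes c: "c \<in> A" "y \<in> range_of c"
  shows "R c y u v w + R c y v w u + R c y w u v = 0"
proof -
  have "d\<Gamma> c y u v = d\<Gamma> c y v u" for u v
    by (rule frechet_derivative_transform_within_open[OF smooth_onD(1)[OF \<Gamma>_smooth c(2)] chart(2)[OF c(1)] c(2)])
      (use c \<Gamma>_sym in auto)
  from this[of v w] this[of u w] this[of u v] show ?thesis
    unfolding R_def using \<Gamma>_sym[OF c, of v w] \<Gamma>_sym[OF c, of u w] \<Gamma>_sym[OF c, of u v]
    by (simp add: algebra_simps)
qed

text \<open>The second derivatives of the function \<open>G c y w z\<close> in directions
  \<open>u\<close> and \<open>v\<close> commute. Expanding both orders by metric compatibility,
  applied twice, leaves exactly the curvature terms.\<close>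

lemma R_metric_skew:
  assumes c: "c \<in> A" "y \<in> range_of c"
  shows "G c y (R c y u v w) z + G c y w (R c y u v z) = 0"
proof -
  note d = smooth_onD(2)[OF \<Gamma>_smooth c(2)]
  have 2: "frechet_derivative (\<lambda>y. dG c y w z v) (at y) u =
      G c y (\<Gamma> c y u (\<Gamma> c y v w)) z + G c y (\<Gamma> c y v w) (\<Gamma> c y u z) + G c y (d\<Gamma> c y v w u) z
    + (G c y (\<Gamma> c y u w) (\<Gamma> c y v z) + G c y w (\<Gamma> c y u (\<Gamma> c y v z)) + G c y w (d\<Gamma> c y v z u))" for u v
  proof -
    have 0: "((\<lambda>y. w) has_derivative (\<lambda>h. 0)) (at y)" for w :: "real ^ 'n" by simp
    have "((\<lambda>y. G c y (\<Gamma> c y v w) z + G c y w (\<Gamma> c y v z)) has_derivative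
      (\<lambda>u. (dG c y (\<Gamma> c y v w) z u + G c y (d\<Gamma> c y v w u) z + G c y (\<Gamma> c y v w) 0)
         + (dG c y w (\<Gamma> c y v z) u + G c y 0 (\<Gamma> c y v z) + G c y w (d\<Gamma> c y v z u)))) (at y)"
      by (rule has_derivative_add; rule G_bilinear_derivative[OF c UNIV_I has_derivative_ident];
          rule 0 d[OF c(1)])
    then have "((\<lambda>y. dG c y w z v) has_derivative
      (\<lambda>u. (dG c y (\<Gamma> c y v w) z u + G c y (d\<Gamma> c y v w u) z + G c y (\<Gamma> c y v w) 0)
         + (dG c y w (\<Gamma> c y v z) u + G c y 0 (\<Gamma> c y v z) + G c y w (d\<Gamma> c y v z u)))) (at y)"
      by (rule has_derivative_transform_within_open[OF _ chart(2)[OF c(1)] c(2)])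
        (rule metric_compatible[OF c(1), symmetric])
    from frechet_derivative_eqI[OF this, of u] show ?thesis
      using linear_0[OF G_linear1[OF c]] linear_0[OF G_linear2[OF c]]
      by (simp add: metric_compatible[OF c])
  qed
  have "frechet_derivative (\<lambda>y. dG c y w z v) (at y) u = frechet_derivative (\<lambda>y. dG c y w z u) (at y) v"
    using symmetric_second_derivative_real[OF G_smooth[OF c(1)] chart(2)[OF c(1)] c(2)] .
  then show ?thesis
    unfolding 2 R_def linear_add[OF G_linear1[OF c]] linear_diff[OF G_linear1[OF c]]
      linear_add[OF G_linear2[OF c]] linear_diff[OF G_linear2[OF c]]
    by (simp add: algebra_simps)
qed

text \<open>The octahedron argument: four Bianchi sums, combined by means of the skew-symmetry in
  the first and in the second pair. This symmetry is what keeps the symplectic form constant along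
  Jacobi fields.\<close>

lemma R_pair_sym:
  assumes c: "c \<in> A" "y \<in> range_of c"
  shows "G c y (R c y u v w) z = G c y (R c y w z u) v"
proof -
  define r where "r u v w z = G c y (R c y u v w) z" for u v w z
  have s1: "r u v w z = - r v u w z" for u v w z
    unfolding r_def by (subst R_skew) (simp add: linear_neg[OF G_linear1[OF c]])
  have s2: "r u v w z = - r u v z w" for u v w z
    unfolding r_def using R_metric_skew[OF c, of u v w z] G_sym[OF c, of w "R c y u v z"] by simp
  have b: "r u v w z + r v w u z + r w u v z = 0" for u v w z
    using bianchi[OF c, of u v w] linear_0[OF G_linear1[OF c], of z]
    unfolding r_def by (metis linear_add[OF G_linear1[OF c]])
  show ?thesis
    unfolding r_def[symmetric]
    using b[of u v w z] b[of v w z u] b[of w z u v] b[of z u v w]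
      s1[of v z w u] s1[of u z w v] s1[of w u z v] s1[of u z v w]
      s2[of v w u z] s2[of w z u v] s2[of u z v w] s2[of w u v z] s2[of u v w z] s2[of v z w u]
    by linarith
qed

end

section \<open>Jacobi fields\<close>

lemma linear_Basis_expand:
  fixes h :: "'a::euclidean_space \<Rightarrow> 'b::real_vector"
  assumes "linear h"
  shows "h x = (\<Sum>b\<in>Basis. (x \<bullet> b) *\<^sub>R h b)"
proof -
  have "h x = h (\<Sum>b\<in>Basis. (x \<bullet> b) *\<^sub>R b)" by (simp add: euclidean_representation)
  then show ?thesis by (simp add: linear_sum[OF assms] linear_cmul[OF assms])
qed

lemma continuous_on_linear_field:
  fixes L :: "'s::topological_space \<Rightarrow> 'a::euclidean_space \<Rightarrow> 'b::real_normed_vector"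
  assumes lin: "\<And>t. t \<in> S \<Longrightarrow> linear (L t)" and L: "\<And>x. continuous_on S (\<lambda>t. L t x)"
    and u: "continuous_on S u"
  shows "continuous_on S (\<lambda>t. L t (u t))"
proof -
  have "continuous_on S (\<lambda>t. \<Sum>b\<in>Basis. (u t \<bullet> b) *\<^sub>R L t b)"
    by (intro continuous_intros L u)
  then show ?thesis
    by (rule continuous_on_eq) (rule linear_Basis_expand[OF lin, symmetric])
qed

lemma linear_field_bounded:
  fixes L :: "'s::topological_space \<Rightarrow> 'a::euclidean_space \<Rightarrow> 'b::real_normed_vector"
  assumes lin: "\<And>t. t \<in> S \<Longrightarrow> linear (L t)" and L: "\<And>x. continuous_on S (\<lambda>t. L t x)"
    and S: "compact S"
  obtains K where "K \<ge> 0" "\<And>t x. t \<in> S \<Longrightarrow> norm (L t x) \<le> K * norm x"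
proof -
  have "\<exists>k. \<forall>t\<in>S. norm (L t b) \<le> k" for b
    using compact_imp_bounded[OF compact_continuous_image[OF L S]] by (auto simp: bounded_iff)
  then obtain k where k: "\<And>t b. t \<in> S \<Longrightarrow> norm (L t b) \<le> k b" by metis
  define K where "K = (\<Sum>b\<in>Basis. \<bar>k b\<bar>)"
  show thesis
  proof (rule that[of K])
    show "K \<ge> 0" unfolding K_def by (intro sum_nonneg) auto
    fix t x assume t: "t \<in> S"
    have "norm (L t x) \<le> (\<Sum>b\<in>Basis. norm ((x \<bullet> b) *\<^sub>R L t b))"
      by (subst linear_Basis_expand[OF lin[OF t]]) (rule norm_sum)
    also have "\<dots> \<le> (\<Sum>b\<in>Basis. \<bar>k b\<bar> * norm x)"
    proof (rule sum_mono)
      fix b :: 'a assume "b \<in> Basis"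
      then have "\<bar>x \<bullet> b\<bar> \<le> norm x" by (rule Basis_le_norm)
      moreover have "norm (L t b) \<le> \<bar>k b\<bar>" using k[OF t, of b] by linarith
      ultimately show "norm ((x \<bullet> b) *\<^sub>R L t b) \<le> \<bar>k b\<bar> * norm x"
        by (simp add: mult.commute mult_mono)
    qed
    finally show "norm (L t x) \<le> K * norm x" by (simp add: K_def sum_distrib_right)
  qed
qed

text \<open>Short intervals make the Picard operator of a linear equation a contraction with factor 1/2.\<close>

lemma linear_ode_short_interval:
  fixes M :: "real \<Rightarrow> 'a::euclidean_space \<Rightarrow> 'a"
  assumes lin: "\<And>t. t \<in> {s..e} \<Longrightarrow> linear (M t)" and M: "\<And>x. continuous_on {s..e} (\<lambda>t. M t x)"
    and K: "K \<ge> 0" "\<And>t x. t \<in> {s..e} \<Longrightarrow> norm (M t x) \<le> K * norm x" "4 * K * (e - s) \<le> 1"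
    and x0: "x0 \<in> {s..e}"
  obtains \<phi> where "\<phi> x0 = z0" "\<And>t. t \<in> {s..e} \<Longrightarrow> (\<phi> has_vector_derivative M t (\<phi> t)) (at t within {s..e})"
proof -
  have se: "s \<le> e" using x0 by auto
  \<comment> \<open>The fixed point is sought among bounded continuous functions on the whole line;
    clamping the time extends a solution on \<open>{s..e}\<close> by constants.\<close>
  define cl where "cl \<tau> = max s (min e \<tau>)" for \<tau> :: real
  have cl: "cl \<tau> \<in> {s..e}" for \<tau> using se by (auto simp: cl_def)
  have cl_id: "\<tau> \<in> {s..e} \<Longrightarrow> cl \<tau> = \<tau>" for \<tau> by (auto simp: cl_def)
  define h where "h \<psi> r = M r (apply_bcontfun \<psi> r)" for \<psi> :: "real \<Rightarrow>\<^sub>C 'a" and r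
  have h: "continuous_on {s..e} (h \<psi>)" for \<psi>
    unfolding h_def by (rule continuous_on_linear_field[OF lin M continuous_on_apply_bcontfun])
  define I where "I \<psi> r = integral {s..r} (h \<psi>)" for \<psi> r
  have I: "continuous_on {s..e} (I \<psi>)" for \<psi>
    unfolding I_def by (intro indefinite_integral_continuous_1 integrable_continuous_interval h)
  \<comment> \<open>The integral from \<open>x0\<close> is a difference of integrals from
    \<open>s\<close>, since \<open>x0\<close> may lie on either side of the current instant. Each of
    the two contributes \<open>K * (e - s)\<close> to the Lipschitz constant, whence the factor 4 in
    the hypothesis.\<close>
  define F where "F \<psi> \<tau> = z0 + (I \<psi> (cl \<tau>) - I \<psi> x0)" for \<psi> \<tau>
  have F: "F \<psi> \<in> bcontfun" for \<psi>
  proof -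
    have "continuous_on UNIV cl" unfolding cl_def[abs_def] by (intro continuous_intros)
    then have "continuous_on UNIV (\<lambda>\<tau>. I \<psi> (cl \<tau>))"
      by (rule continuous_on_compose2[OF I]) (use cl in blast)
    then have "continuous_on UNIV (F \<psi>)"
      unfolding F_def[abs_def] by (intro continuous_on_add continuous_on_diff continuous_on_const)
    moreover have "bounded (range (F \<psi>))"
    proof (rule bounded_subset)
      show "bounded ((\<lambda>\<tau>. z0 + (I \<psi> \<tau> - I \<psi> x0)) ` {s..e})"
        by (intro compact_imp_bounded compact_continuous_image continuous_intros I compact_Icc)
      show "range (F \<psi>) \<subseteq> (\<lambda>\<tau>. z0 + (I \<psi> \<tau> - I \<psi> x0)) ` {s..e}"
        using cl by (auto simp: F_def)
    qed
    ultimately show ?thesis by (simp add: bcontfun_def)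
  qed
  define T where "T \<psi> = Bcontfun (F \<psi>)" for \<psi>
  have T: "apply_bcontfun (T \<psi>) = F \<psi>" for \<psi> using F by (simp add: T_def Bcontfun_inverse)
  have "dist (T \<psi>) (T \<xi>) \<le> (1/2) * dist \<psi> \<xi>" for \<psi> \<xi>
  proof (rule dist_bound)
    fix \<tau>
    have i: "norm (I \<psi> r - I \<xi> r) \<le> K * dist \<psi> \<xi> * (e - s)" if r: "r \<in> {s..e}" for r
    proof -
      have cont: "continuous_on {s..r} (h \<psi>)" for \<psi> using r by (intro continuous_on_subset[OF h]) auto
      have "I \<psi> r - I \<xi> r = integral {s..r} (\<lambda>x. h \<psi> x - h \<xi> x)"
        unfolding I_def by (intro integral_diff[symmetric] integrable_continuous_interval cont)
      also have "norm \<dots> \<le> (K * dist \<psi> \<xi>) * (r - s)"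
      proof (rule integral_bound)
        fix x assume "x \<in> {s..r}"
        then have x: "x \<in> {s..e}" using r by auto
        have "h \<psi> x - h \<xi> x = M x (apply_bcontfun \<psi> x - apply_bcontfun \<xi> x)"
          by (simp add: h_def linear_diff[OF lin[OF x]])
        also have "norm \<dots> \<le> K * norm (apply_bcontfun \<psi> x - apply_bcontfun \<xi> x)" by (rule K(2)[OF x])
        also have "\<dots> \<le> K * dist \<psi> \<xi>"
          using dist_bounded[of \<psi> x \<xi>] K(1) by (intro mult_left_mono) (simp_all add: dist_norm)
        finally show "norm (h \<psi> x - h \<xi> x) \<le> K * dist \<psi> \<xi>" .
      next
        show "continuous_on {s..r} (\<lambda>x. h \<psi> x - h \<xi> x)" by (intro continuous_on_diff cont)
        show "s \<le> r" using r by simp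
      qed
      also have "\<dots> \<le> (K * dist \<psi> \<xi>) * (e - s)"
        using r K(1) by (intro mult_left_mono) auto
      finally show ?thesis .
    qed
    have "norm (F \<psi> \<tau> - F \<xi> \<tau>) = norm ((I \<psi> (cl \<tau>) - I \<xi> (cl \<tau>)) - (I \<psi> x0 - I \<xi> x0))"
      by (simp add: F_def algebra_simps)
    also have "\<dots> \<le> K * dist \<psi> \<xi> * (e - s) + K * dist \<psi> \<xi> * (e - s)"
      by (rule norm_triangle_le_diff) (intro add_mono i cl x0)
    also have "\<dots> = (4 * K * (e - s)) * (1/2 * dist \<psi> \<xi>)" by simp
    also have "\<dots> \<le> 1 * (1/2 * dist \<psi> \<xi>)" using K(3) by (rule mult_right_mono) simp
    finally show "dist (apply_bcontfun (T \<psi>) \<tau>) (apply_bcontfun (T \<xi>) \<tau>) \<le> (1/2) * dist \<psi> \<xi>"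
      by (simp add: T dist_norm)
  qed
  then have "\<forall>\<psi> \<xi>. dist (T \<psi>) (T \<xi>) \<le> (1/2) * dist \<psi> \<xi>" by blast
  from banach_fix_type[OF _ _ this] have "\<exists>!\<psi>. T \<psi> = \<psi>" by simp
  then obtain \<psi> where \<psi>: "T \<psi> = \<psi>" by (rule ex1E)
  then have fp: "apply_bcontfun \<psi> = F \<psi>" using T[of \<psi>] by simp
  show thesis
  proof (rule that[of "F \<psi>"])
    show "F \<psi> x0 = z0" by (simp add: F_def cl_id[OF x0])
    fix t assume t: "t \<in> {s..e}"
    have "((\<lambda>r. z0 + (I \<psi> r - I \<psi> x0)) has_vector_derivative h \<psi> t) (at t within {s..e})"
      using has_vector_derivative_add[OF has_vector_derivative_const[of z0]
          has_vector_derivative_diff[OF integral_has_vector_derivative[OF h[of \<psi>] t]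
            has_vector_derivative_const[of "I \<psi> x0"]]]
      unfolding I_def by simp
    then have "(F \<psi> has_vector_derivative h \<psi> t) (at t within {s..e})"
      by (rule has_vector_derivative_transform[OF t, rotated]) (simp add: F_def cl_id)
    then show "(F \<psi> has_vector_derivative M t (F \<psi> t)) (at t within {s..e})"
      by (simp add: h_def fp)
  qed
qed

lemma has_vector_derivative_glue:
  assumes m: "s \<le> m" "m \<le> e" and t: "t \<in> {s..e}"
    and f: "t \<in> {s..m} \<Longrightarrow> (f has_vector_derivative f' t) (at t within {s..m})"
    and g: "t \<in> {m..e} \<Longrightarrow> (g has_vector_derivative g' t) (at t within {m..e})"
    and eq: "f m = g m" "f' m = g' m"
  shows "((\<lambda>x. if x \<in> {s..m} then f x else g x) has_vector_derivative
    (if t \<in> {s..m} then f' t else g' t)) (at t within {s..e})"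
proof (rule has_vector_derivative_If_within_closures[where T = "{m..e}"])
  have cl: "closure {s..m} \<inter> closure {m..e} = {m}" using m by auto
  have un: "{s..m} \<union> {m} = {s..m}" "{m..e} \<union> {m} = {m..e}" using m by auto
  show "(f has_vector_derivative f' t) (at t within {s..m} \<union> closure {s..m} \<inter> closure {m..e})"
    if "t \<in> {s..m} \<union> closure {s..m} \<inter> closure {m..e}"
    using f that unfolding cl un by blast
  show "(g has_vector_derivative g' t) (at t within {m..e} \<union> closure {s..m} \<inter> closure {m..e})"
    if "t \<in> {m..e} \<union> closure {s..m} \<inter> closure {m..e}"
    using g that unfolding cl un by blast
  show "t \<in> {s..m} \<union> {m..e}" "{s..e} = {s..m} \<union> {m..e}" using t m by auto
  show "f t = g t" "f' t = g' t" if "t \<in> closure {s..m}" "t \<in> closure {m..e}"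
    using that cl eq by auto
qed

section \<open>The Jacobi equation along a geodesic, chart by chart\<close>

locale semi_riemannian_geodesic = semi_riemannian A g
  for A :: "('m::topological_space, 'n::finite) chart set" and g +
  fixes a b :: real and \<gamma> :: "real \<Rightarrow> 'm"
  assumes ab: "a < b" and geo: "geodesic A g a b \<gamma>"
begin

abbreviation vel :: "real \<Rightarrow> ('m, 'n) tangent" where "vel \<equiv> velocity A a b \<gamma>"
abbreviation pos :: "('m, 'n) chart \<Rightarrow> real \<Rightarrow> real ^ 'n" where "pos c t \<equiv> coord c (\<gamma> t)"

lemma vel_in: "t \<in> {a..b} \<Longrightarrow> vel t \<in> tangent_space A (\<gamma> t)"
  using geo unfolding geodesic_def has_cov_deriv_def by blast

lemma pos_in: "c \<in> charts_at A (\<gamma> t) \<Longrightarrow> pos c t \<in> range_of c"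
  using charts_at_D(2) by blast

lemma pos_in_overlap: "c \<in> charts_at A (\<gamma> t) \<Longrightarrow> d \<in> charts_at A (\<gamma> t) \<Longrightarrow> pos c t \<in> overlap c d"
  using charts_at_D(2) by blast

lemma pos_deriv:
  assumes "t \<in> S" "S \<subseteq> {a..b}" "c \<in> charts_at A (\<gamma> t)"
  shows "(pos c has_vector_derivative vel t c) (at t within S)"
proof -
  have "pos c differentiable (at t within {a..b})"
    using geo assms unfolding geodesic_def by blast
  then have "(pos c has_vector_derivative vel t c) (at t within {a..b})"
    using assms(3) by (simp add: velocity_def vector_derivative_works)
  then show ?thesis using assms(2) by (rule has_vector_derivative_within_subset)
qed

lemma vel_continuous:
  assumes "t \<in> {a..b}" "c \<in> charts_at A (\<gamma> t)"
  shows "continuous (at t within {a..b}) (\<lambda>t. vel t c)"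
proof -
  have "\<exists>D. ((\<lambda>t. vel t c) has_vector_derivative D) (at t within {a..b})"
    using geo assms unfolding geodesic_def has_cov_deriv_def by blast
  then show ?thesis using has_vector_derivative_continuous by blast
qed

lemma eventually_chart:
  assumes "t \<in> S" "S \<subseteq> {a..b}" "c \<in> charts_at A (\<gamma> t)"
  shows "\<forall>\<^sub>F s in at t within S. c \<in> charts_at A (\<gamma> s)"
proof -
  have "continuous_on S \<gamma>" using geo continuous_on_subset[OF _ assms(2)] unfolding geodesic_def by blast
  then have "(\<gamma> \<longlongrightarrow> \<gamma> t) (at t within S)" using assms(1) by (simp add: continuous_on_def)
  then have "\<forall>\<^sub>F s in at t within S. \<gamma> s \<in> dom_of c"
    using topological_tendstoD chart(1)[OF charts_at_D(1)[OF assms(3)]] charts_at_D(2)[OF assms(3)] by blast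
  then show ?thesis by eventually_elim (rule charts_at_I[OF charts_at_D(1)[OF assms(3)]])
qed

text \<open>The transition map, differentiated along the geodesic, contributes a second derivative
  that cancels the inhomogeneous term of \<open>\<Gamma>_transform\<close>. Hence a covariant
  derivative may be verified in one chart per instant.\<close>

lemma cov_deriv_change:
  assumes t: "t \<in> S" "S \<subseteq> {a..b}" and c: "c \<in> charts_at A (\<gamma> t)" and d: "d \<in> charts_at A (\<gamma> t)"
    and X: "\<And>s. s \<in> S \<Longrightarrow> X s \<in> tangent_space A (\<gamma> s)"
    and D: "((\<lambda>s. X s c) has_vector_derivative (Y - \<Gamma> c (pos c t) (vel t c) (X t c))) (at t within S)"
  shows "((\<lambda>s. X s d) has_vector_derivative
    (dtrans c d (pos c t) Y - \<Gamma> d (pos d t) (vel t d) (X t d))) (at t within S)"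
proof -
  note cA = charts_at_D(1)[OF c] and dA = charts_at_D(1)[OF d]
  let ?y = "pos c t" let ?D = "dtrans c d ?y" let ?V = "vel t c"
  have y: "?y \<in> overlap c d" using pos_in_overlap c d .
  have "((\<lambda>s. dtrans c d (pos c s) (X s c)) has_derivative (\<lambda>h. d2trans c d ?y (X t c) (h *\<^sub>R ?V)
      + ?D (h *\<^sub>R (Y - \<Gamma> c ?y ?V (X t c))))) (at t within S)"
    using dtrans_linear_derivative[of c d "pos c" t S "\<lambda>h. h *\<^sub>R ?V" "\<lambda>s. X s c"
        "\<lambda>h. h *\<^sub>R (Y - \<Gamma> c ?y ?V (X t c))", OF cA dA y t(1)] pos_deriv[OF t c] D
    unfolding has_vector_derivative_def by blast
  moreover have "\<forall>\<^sub>F s in at t within S. dtrans c d (pos c s) (X s c) = X s d"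
  proof -
    have "\<forall>\<^sub>F s in at t within S. s \<in> S" by (simp add: eventually_at_filter)
    then show ?thesis
      using eventually_chart[OF t c] eventually_chart[OF t d]
      by eventually_elim (use X tangent_change in metis)
  qed
  ultimately have "((\<lambda>s. X s d) has_derivative (\<lambda>h. d2trans c d ?y (X t c) (h *\<^sub>R ?V)
      + ?D (h *\<^sub>R (Y - \<Gamma> c ?y ?V (X t c))))) (at t within S)"
    by (rule has_derivative_transform_eventually) (use X[OF t(1)] tangent_change c d t(1) in metis)+
  moreover have "d2trans c d ?y (X t c) (h *\<^sub>R ?V) + ?D (h *\<^sub>R (Y - \<Gamma> c ?y ?V (X t c))) =
      h *\<^sub>R (?D Y - \<Gamma> d (pos d t) (vel t d) (X t d))" for h
  proof -
    have "transition c d ?y = pos d t" using transition_coord cA charts_at_D(2)[OF c] .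
    moreover have "?D ?V = vel t d" using tangent_change[OF vel_in c d] t by auto
    moreover have "?D (X t c) = X t d" using tangent_change[OF X[OF t(1)] c d] by simp
    ultimately have "?D (\<Gamma> c ?y ?V (X t c)) = \<Gamma> d (pos d t) (vel t d) (X t d) + d2trans c d ?y ?V (X t c)"
      using \<Gamma>_transform[OF cA dA y, of ?V "X t c"] by simp
    moreover have "d2trans c d ?y (X t c) (h *\<^sub>R ?V) = h *\<^sub>R d2trans c d ?y ?V (X t c)"
      using linear_cmul[OF smooth_onD(3)[OF dtrans_smooth[OF cA dA] y]] d2trans_sym[OF cA dA y] by simp
    moreover have "?D (h *\<^sub>R (Y - \<Gamma> c ?y ?V (X t c))) = h *\<^sub>R (?D Y - ?D (\<Gamma> c ?y ?V (X t c)))"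
      by (simp only: linear_diff[OF transition_deriv(2)[OF cA dA y]] linear_cmul[OF transition_deriv(2)[OF cA dA y]])
    ultimately show ?thesis by (simp add: scaleR_diff_right scaleR_add_right)
  qed
  ultimately show ?thesis unfolding has_vector_derivative_def by simp
qed

text \<open>The Jacobi equation as a first-order linear system for the components of the field and
  of its covariant derivative; the terms with \<Gamma> turn covariant into ordinary
  derivatives.\<close>

definition jacobi_in_chart where
  "jacobi_in_chart S J J' t c \<longleftrightarrow>
    ((\<lambda>s. J s c) has_vector_derivative (J' t c - \<Gamma> c (pos c t) (vel t c) (J t c))) (at t within S) \<and>
    ((\<lambda>s. J' s c) has_vector_derivative
       (R c (pos c t) (vel t c) (J t c) (vel t c) - \<Gamma> c (pos c t) (vel t c) (J' t c))) (at t within S)"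

text \<open>Derivatives are taken within \<open>S\<close>, so that solutions on subintervals can be
  built separately and glued.\<close>

definition jacobi_on where
  "jacobi_on S J J' \<longleftrightarrow> (\<forall>t\<in>S. J t \<in> tangent_space A (\<gamma> t) \<and> J' t \<in> tangent_space A (\<gamma> t) \<and>
    (\<forall>c\<in>charts_at A (\<gamma> t). jacobi_in_chart S J J' t c))"

lemma jacobi_onI:
  assumes S: "S \<subseteq> {a..b}"
    and J: "\<And>t. t \<in> S \<Longrightarrow> J t \<in> tangent_space A (\<gamma> t)" "\<And>t. t \<in> S \<Longrightarrow> J' t \<in> tangent_space A (\<gamma> t)"
    and c: "\<And>t. t \<in> S \<Longrightarrow> c t \<in> charts_at A (\<gamma> t)" "\<And>t. t \<in> S \<Longrightarrow> jacobi_in_chart S J J' t (c t)"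
  shows "jacobi_on S J J'"
  unfolding jacobi_on_def
proof (intro ballI conjI J)
  fix t d assume t: "t \<in> S" and d: "d \<in> charts_at A (\<gamma> t)"
  note ct = c(1)[OF t]
  let ?y = "pos (c t) t" let ?D = "dtrans (c t) d ?y"
  have tab: "t \<in> {a..b}" using t S by auto
  have y: "?y \<in> overlap (c t) d" using pos_in_overlap[OF ct d] .
  have "?D (J' t (c t)) = J' t d" "?D (J t (c t)) = J t d" "?D (vel t (c t)) = vel t d"
    using tangent_change[OF _ ct d] J[OF t] vel_in[OF tab] by simp_all
  moreover have "transition (c t) d ?y = pos d t"
    using transition_coord charts_at_D[OF ct] by metis
  ultimately have "?D (R (c t) ?y (vel t (c t)) (J t (c t)) (vel t (c t))) = R d (pos d t) (vel t d) (J t d) (vel t d)"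
    using R_transform[OF charts_at_D(1)[OF ct] charts_at_D(1)[OF d] y, of "vel t (c t)" "J t (c t)" "vel t (c t)"] by simp
  moreover note \<open>?D (J' t (c t)) = J' t d\<close>
  ultimately show "jacobi_in_chart S J J' t d"
    using cov_deriv_change[OF t S ct d J(1)] cov_deriv_change[OF t S ct d J(2)] c(2)[OF t]
    unfolding jacobi_in_chart_def by metis
qed

lemma curvature_in:
  assumes "t \<in> {a..b}" "J \<in> tangent_space A (\<gamma> t)"
  shows "curvature A g (\<gamma> t) (vel t) J (vel t) \<in> tangent_space A (\<gamma> t)"
proof (rule tangentI)
  fix c d assume c: "c \<in> charts_at A (\<gamma> t)" and d: "d \<in> charts_at A (\<gamma> t)"
  have "transition c d (pos c t) = pos d t" using transition_coord charts_at_D[OF c] by metis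
  then show "curvature A g (\<gamma> t) (vel t) J (vel t) d =
      dtrans c d (pos c t) (curvature A g (\<gamma> t) (vel t) J (vel t) c)"
    using R_transform[OF charts_at_D(1)[OF c] charts_at_D(1)[OF d] pos_in_overlap[OF c d], of "vel t c" "J c" "vel t c"]
      tangent_change[OF vel_in[OF assms(1)] c d] tangent_change[OF assms(2) c d] c d
    by (simp add: curvature_def curvature_coord_R)
qed (simp add: curvature_def)

lemma jacobi_field_iff: "jacobi_field A g a b \<gamma> J J' \<longleftrightarrow> jacobi_on {a..b} J J'"
proof -
  have R: "curvature A g (\<gamma> t) (vel t) (J t) (vel t) c = R c (pos c t) (vel t c) (J t c) (vel t c)"
    if "c \<in> charts_at A (\<gamma> t)" for t c
    using that by (simp add: curvature_def curvature_coord_R)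
  have "curvature A g (\<gamma> t) (vel t) (J t) (vel t) \<in> tangent_space A (\<gamma> t)"
    if "jacobi_on {a..b} J J'" "t \<in> {a..b}" for t
    using that curvature_in unfolding jacobi_on_def by blast
  then show ?thesis
    unfolding jacobi_field_def has_cov_deriv_def
    by (auto simp: jacobi_on_def jacobi_in_chart_def R simp del: split_paired_All)
qed

text \<open>The equations express the derivatives by the values, so agreement of the values at
  \<open>m\<close> makes the one-sided derivatives agree there as well.\<close>

lemma jacobi_on_glue:
  assumes m: "s \<le> m" "m \<le> e" and J: "jacobi_on {s..m} J J'" and K: "jacobi_on {m..e} K K'"
    and eq: "J m = K m" "J' m = K' m"
  shows "jacobi_on {s..e} (\<lambda>t. if t \<in> {s..m} then J t else K t) (\<lambda>t. if t \<in> {s..m} then J' t else K' t)"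
  unfolding jacobi_on_def
proof (intro ballI conjI)
  fix t assume t: "t \<in> {s..e}"
  then have or: "t \<in> {s..m} \<or> t \<notin> {s..m} \<and> t \<in> {m..e}" by auto
  then show "(if t \<in> {s..m} then J t else K t) \<in> tangent_space A (\<gamma> t)"
    "(if t \<in> {s..m} then J' t else K' t) \<in> tangent_space A (\<gamma> t)"
    using J K unfolding jacobi_on_def by auto
  fix c assume c: "c \<in> charts_at A (\<gamma> t)"
  have Jc: "jacobi_in_chart {s..m} J J' t c" if "t \<in> {s..m}" using J that c unfolding jacobi_on_def by blast
  have Kc: "jacobi_in_chart {m..e} K K' t c" if "t \<in> {m..e}" using K that c unfolding jacobi_on_def by blast
  have 1: "((\<lambda>t. if t \<in> {s..m} then J t c else K t c) has_vector_derivative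
      (if t \<in> {s..m} then J' t c - \<Gamma> c (pos c t) (vel t c) (J t c) else K' t c - \<Gamma> c (pos c t) (vel t c) (K t c)))
      (at t within {s..e})"
    by (rule has_vector_derivative_glue[OF m t]) (use Jc Kc eq in \<open>simp_all add: jacobi_in_chart_def\<close>)
  have 2: "((\<lambda>t. if t \<in> {s..m} then J' t c else K' t c) has_vector_derivative
      (if t \<in> {s..m} then R c (pos c t) (vel t c) (J t c) (vel t c) - \<Gamma> c (pos c t) (vel t c) (J' t c)
       else R c (pos c t) (vel t c) (K t c) (vel t c) - \<Gamma> c (pos c t) (vel t c) (K' t c)))
      (at t within {s..e})"
    by (rule has_vector_derivative_glue[OF m t]) (use Jc Kc eq in \<open>simp_all add: jacobi_in_chart_def\<close>)
  show "jacobi_in_chart {s..e} (\<lambda>t. if t \<in> {s..m} then J t else K t)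
      (\<lambda>t. if t \<in> {s..m} then J' t else K' t) t c"
    using 1 2 unfolding jacobi_in_chart_def if_distrib[of "\<lambda>J. J c"]
    by (cases "t \<in> {s..m}") (simp_all only: if_True if_False)
qed

end

context semi_riemannian_geodesic
begin

section \<open>Existence of Jacobi fields with prescribed data\<close>

lemma \<Gamma>_continuous:
  assumes c: "c \<in> A" and p: "continuous_on S p" "\<And>t. t \<in> S \<Longrightarrow> p t \<in> range_of c"
    and u: "continuous_on S u" and v: "continuous_on S v"
  shows "continuous_on S (\<lambda>t. \<Gamma> c (p t) (u t) (v t))"
proof -
  have "continuous_on S (\<lambda>t. \<Gamma> c (p t) u v)" for u v
    using continuous_on_compose2[OF smooth_on_continuous[OF \<Gamma>_smooth[OF c]] p(1)] p(2) by blast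
  then have "continuous_on S (\<lambda>t. \<Gamma> c (p t) u (v t))" for u
    by (rule continuous_on_linear_field[OF \<Gamma>_linear2 _ v])
  then show ?thesis
    by (rule continuous_on_linear_field[where L = "\<lambda>t u. \<Gamma> c (p t) u (v t)", OF \<Gamma>_linear1 _ u])
qed

lemma d\<Gamma>_continuous:
  assumes c: "c \<in> A" and p: "continuous_on S p" "\<And>t. t \<in> S \<Longrightarrow> p t \<in> range_of c"
    and u: "continuous_on S u" and v: "continuous_on S v" and h: "continuous_on S h"
  shows "continuous_on S (\<lambda>t. d\<Gamma> c (p t) (u t) (v t) (h t))"
proof -
  have "continuous_on S (\<lambda>t. d\<Gamma> c (p t) u v h)" for u v h
    using continuous_on_compose2[OF smooth_on_continuous[OF smooth_on_derivative[OF \<Gamma>_smooth[OF c]]] p(1)] p(2)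
    by blast
  note 1 = this
  have 2: "continuous_on S (\<lambda>t. d\<Gamma> c (p t) u v (h t))" for u v
    by (rule continuous_on_linear_field[where L = "\<lambda>t. d\<Gamma> c (p t) u v", OF _ 1 h])
      (rule smooth_onD(3)[OF \<Gamma>_smooth[OF c] p(2)])
  have 3: "continuous_on S (\<lambda>t. d\<Gamma> c (p t) u (v t) (h t))" for u
    by (rule continuous_on_linear_field[where L = "\<lambda>t v. d\<Gamma> c (p t) u v (h t)", OF _ 2 v])
      (rule \<Gamma>_derivative_linear(2)[OF c p(2)])
  show ?thesis
    by (rule continuous_on_linear_field[where L = "\<lambda>t u. d\<Gamma> c (p t) u (v t) (h t)", OF _ 3 u])
      (rule \<Gamma>_derivative_linear(1)[OF c p(2)])
qed

lemma R_linear2: "c \<in> A \<Longrightarrow> y \<in> range_of c \<Longrightarrow> linear (\<lambda>v. R c y u v w)"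
  unfolding R_def
  by (intro linear_compose_add linear_compose_sub \<Gamma>_derivative_linear \<Gamma>_linear1
      linear_compose[OF \<Gamma>_linear1 \<Gamma>_linear2, unfolded o_def] smooth_onD(3)[OF \<Gamma>_smooth])

text \<open>Shaped for the \<open>Bolzano\<close> induction: all short intervals around
  \<open>x\<close> are covered, and the data may be given at any instant of the interval, because
  gluing continues solutions in both directions.\<close>

lemma jacobi_local:
  assumes x: "x \<in> {a..b}"
  shows "\<exists>d>0. \<forall>s e. s \<le> x \<and> x \<le> e \<and> e - s < d \<longrightarrow> {s..e} \<subseteq> {a..b} \<longrightarrow>
    (\<forall>x0\<in>{s..e}. \<forall>v\<in>tangent_space A (\<gamma> x0). \<forall>w\<in>tangent_space A (\<gamma> x0).
      \<exists>J J'. jacobi_on {s..e} J J' \<and> J x0 = v \<and> J' x0 = w)"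
proof -
  obtain c where c: "c \<in> charts_at A (\<gamma> x)" by (rule chart_exists)
  note cA = charts_at_D(1)[OF c]
  obtain \<delta> where \<delta>: "\<delta> > 0" "\<And>t. t \<in> {a..b} \<Longrightarrow> \<bar>t - x\<bar> < \<delta> \<Longrightarrow> c \<in> charts_at A (\<gamma> t)"
    using eventually_chart[OF x order_refl c] c unfolding eventually_at dist_real_def by metis
  \<comment> \<open>Halving \<delta> gives a compact interval inside the stretch covered by the
    chart, on which the coefficients are bounded.\<close>
  define S where "S = {max a (x - \<delta> / 2)..min b (x + \<delta> / 2)}"
  have Sab: "S \<subseteq> {a..b}" by (auto simp: S_def)
  have cS: "c \<in> charts_at A (\<gamma> t)" if "t \<in> S" for t
  proof (rule \<delta>(2))
    show "t \<in> {a..b}" using that Sab by blast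
    show "\<bar>t - x\<bar> < \<delta>" using that \<delta>(1) unfolding S_def by (simp add: abs_less_iff)
  qed
  have range: "pos c t \<in> range_of c" if "t \<in> S" for t by (rule pos_in[OF cS[OF that]])
  have p: "continuous_on S (pos c)"
    using has_vector_derivative_continuous[OF pos_deriv[OF _ Sab cS]] by (simp add: continuous_on_eq_continuous_within)
  have v: "continuous_on S (\<lambda>t. vel t c)"
  proof -
    have "continuous (at t within S) (\<lambda>t. vel t c)" if "t \<in> S" for t
      using vel_continuous[OF _ cS[OF that]] that Sab continuous_within_subset by blast
    then show ?thesis by (simp add: continuous_on_eq_continuous_within)
  qed
  define M where "M t z = (snd z - \<Gamma> c (pos c t) (vel t c) (fst z),
      R c (pos c t) (vel t c) (fst z) (vel t c) - \<Gamma> c (pos c t) (vel t c) (snd z))" for t and z :: "(real ^ 'n) \<times> (real ^ 'n)"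
  have M_lin: "linear (M t)" if "t \<in> S" for t
  proof -
    note l = \<Gamma>_linear2[of c "pos c t" "vel t c"] R_linear2[OF cA range[OF that], of "vel t c" "vel t c"]
    show ?thesis
      by (rule linearI)
        (simp_all add: M_def linear_add[OF l(1)] linear_add[OF l(2)] linear_cmul[OF l(1)] linear_cmul[OF l(2)]
          scaleR_diff_right)
  qed
  have M_cont: "continuous_on S (\<lambda>t. M t z)" for z
    unfolding M_def R_def
    by (intro continuous_on_Pair continuous_on_add continuous_on_diff continuous_on_const
        \<Gamma>_continuous d\<Gamma>_continuous cA p v range)
  have "compact S" by (simp add: S_def)
  then obtain K where K: "K \<ge> 0" "\<And>t z. t \<in> S \<Longrightarrow> norm (M t z) \<le> K * norm z"
    using linear_field_bounded[OF M_lin M_cont] by blast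
  \<comment> \<open>The first bound keeps the interval inside \<open>S\<close>; the second is the
    smallness that the Picard argument asks for, with 1 added to cover \<open>K = 0\<close>.\<close>
  define d where "d = min (\<delta> / 2) (1 / (4 * (K + 1)))"
  have d0: "d > 0" using \<delta>(1) K(1) by (simp add: d_def)
  show ?thesis
  proof (intro exI[of _ d] conjI d0 allI impI ballI)
    fix s e x0 v w
    assume se: "s \<le> x \<and> x \<le> e \<and> e - s < d" and sab: "{s..e} \<subseteq> {a..b}" and x0: "x0 \<in> {s..e}"
      and vw: "v \<in> tangent_space A (\<gamma> x0)" "w \<in> tangent_space A (\<gamma> x0)"
    have "d \<le> \<delta> / 2" by (simp add: d_def)
    then have sS: "{s..e} \<subseteq> S"
      using se sab unfolding S_def by auto
    have "4 * K * (e - s) \<le> 4 * K * (1 / (4 * (K + 1)))"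
      using se K(1) by (intro mult_left_mono) (auto simp: d_def)
    also have "\<dots> \<le> 1" using K(1) by (simp add: field_simps)
    finally have Kse: "4 * K * (e - s) \<le> 1" .
    have lin': "linear (M t)" and bd': "norm (M t z) \<le> K * norm z" if "t \<in> {s..e}" for t z
      using that sS M_lin K(2) by blast+
    obtain \<phi> where \<phi>: "\<phi> x0 = (v c, w c)"
      "\<And>t. t \<in> {s..e} \<Longrightarrow> (\<phi> has_vector_derivative M t (\<phi> t)) (at t within {s..e})"
      using linear_ode_short_interval[OF lin' continuous_on_subset[OF M_cont sS] K(1) bd' Kse x0, of "(v c, w c)"] by metis
    define J where "J t = tangent_of A (\<gamma> t) c (fst (\<phi> t))" for t
    define J' where "J' t = tangent_of A (\<gamma> t) c (snd (\<phi> t))" for t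
    have ct: "c \<in> charts_at A (\<gamma> t)" if "t \<in> {s..e}" for t using cS sS that by blast
    have Jc: "J t c = fst (\<phi> t)" "J' t c = snd (\<phi> t)" if "t \<in> {s..e}" for t
      using ct[OF that] by (simp_all add: J_def J'_def)
    have "jacobi_on {s..e} J J'"
    proof (rule jacobi_onI[OF sab, where c = "\<lambda>_. c"])
      fix t assume t: "t \<in> {s..e}"
      show "J t \<in> tangent_space A (\<gamma> t)" "J' t \<in> tangent_space A (\<gamma> t)" "c \<in> charts_at A (\<gamma> t)"
        using ct[OF t] by (simp_all add: J_def J'_def)
      have 1: "((\<lambda>t. fst (\<phi> t)) has_vector_derivative fst (M t (\<phi> t))) (at t within {s..e})"
        "((\<lambda>t. snd (\<phi> t)) has_vector_derivative snd (M t (\<phi> t))) (at t within {s..e})"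
        using \<phi>(2)[OF t] bounded_linear.has_vector_derivative[OF bounded_linear_fst]
          bounded_linear.has_vector_derivative[OF bounded_linear_snd] by blast+
      have "((\<lambda>t. J t c) has_vector_derivative fst (M t (\<phi> t))) (at t within {s..e})"
        by (rule has_vector_derivative_transform[OF t Jc(1) 1(1)])
      moreover have "((\<lambda>t. J' t c) has_vector_derivative snd (M t (\<phi> t))) (at t within {s..e})"
        by (rule has_vector_derivative_transform[OF t Jc(2) 1(2)])
      ultimately show "jacobi_in_chart {s..e} J J' t c"
        unfolding jacobi_in_chart_def by (simp add: Jc[OF t] M_def)
    qed
    moreover have "J x0 = v" "J' x0 = w"
      using \<phi>(1) vw ct[OF x0] by (simp_all add: J_def J'_def tangent_of_eq)
    ultimately show "\<exists>J J'. jacobi_on {s..e} J J' \<and> J x0 = v \<and> J' x0 = w" by blast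
  qed
qed

text \<open>Solve on the part that contains the prescribed instant, then continue into the other
  part with the values reached at the common endpoint.\<close>

theorem jacobi_exists:
  assumes "s \<in> {a..b}" "v \<in> tangent_space A (\<gamma> s)" "w \<in> tangent_space A (\<gamma> s)"
  obtains J J' where "jacobi_on {a..b} J J'" "J s = v" "J' s = w"
proof -
  define P where "P s e \<longleftrightarrow> (\<forall>x0\<in>{s..e}. \<forall>v\<in>tangent_space A (\<gamma> x0). \<forall>w\<in>tangent_space A (\<gamma> x0).
      \<exists>J J'. jacobi_on {s..e} J J' \<and> J x0 = v \<and> J' x0 = w)" for s e
  \<comment> \<open>The local case of the induction also meets intervals reaching beyond
    \<open>{a..b}\<close>; the premise exempts them.\<close>
  define Q where "Q s e \<longleftrightarrow> {s..e} \<subseteq> {a..b} \<longrightarrow> P s e" for s e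
  have "a \<le> b" using ab by simp
  then have "Q a b"
  proof (induction rule: Bolzano)
    case (trans s m e)
    show ?case
      unfolding Q_def
    proof
      assume sub: "{s..e} \<subseteq> {a..b}"
      have P: "P s m" "P m e" using trans sub unfolding Q_def by auto
      show "P s e"
        unfolding P_def
      proof (intro ballI)
        fix x0 v w assume x0: "x0 \<in> {s..e}" and vw: "v \<in> tangent_space A (\<gamma> x0)" "w \<in> tangent_space A (\<gamma> x0)"
        show "\<exists>J J'. jacobi_on {s..e} J J' \<and> J x0 = v \<and> J' x0 = w"
        proof (cases "x0 \<le> m")
          case True
          then obtain J J' where J: "jacobi_on {s..m} J J'" "J x0 = v" "J' x0 = w"
            using P(1) x0 vw unfolding P_def by (metis atLeastAtMost_iff)
          have "J m \<in> tangent_space A (\<gamma> m)" "J' m \<in> tangent_space A (\<gamma> m)"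
            using J(1) trans(3) unfolding jacobi_on_def by auto
          then obtain K K' where K: "jacobi_on {m..e} K K'" "K m = J m" "K' m = J' m"
            using P(2) trans(4) unfolding P_def by (metis atLeastAtMost_iff order_refl)
          show ?thesis
            using jacobi_on_glue[OF trans(3,4) J(1) K(1)] J(2,3) K(2,3) True x0
            by (intro exI conjI) (assumption | simp)+
        next
          case False
          then obtain K K' where K: "jacobi_on {m..e} K K'" "K x0 = v" "K' x0 = w"
            using P(2) x0 vw unfolding P_def by (metis atLeastAtMost_iff linear)
          have "K m \<in> tangent_space A (\<gamma> m)" "K' m \<in> tangent_space A (\<gamma> m)"
            using K(1) trans(4) unfolding jacobi_on_def by auto
          then obtain J J' where J: "jacobi_on {s..m} J J'" "J m = K m" "J' m = K' m"
            using P(1) trans(3) unfolding P_def by (metis atLeastAtMost_iff order_refl)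
          show ?thesis
            using jacobi_on_glue[OF trans(3,4) J(1) K(1)] J(2,3) K(2,3) False
            by (intro exI conjI) (assumption | simp)+
        qed
      qed
    qed
  next
    case (local x)
    then show ?case using jacobi_local[of x] unfolding P_def Q_def by simp
  qed
  then have "P a b" by (simp add: Q_def)
  then show thesis using assms that unfolding P_def by blast
qed

section \<open>Conservation of the symplectic form\<close>

lemma metric_derivative:
  assumes t: "t \<in> {a..b}" and c: "c \<in> charts_at A (\<gamma> t)"
    and X: "\<And>s. s \<in> {a..b} \<Longrightarrow> X s \<in> tangent_space A (\<gamma> s)" and Y: "\<And>s. s \<in> {a..b} \<Longrightarrow> Y s \<in> tangent_space A (\<gamma> s)"
    and dX: "((\<lambda>s. X s c) has_vector_derivative X' - \<Gamma> c (pos c t) (vel t c) (X t c)) (at t within {a..b})"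
    and dY: "((\<lambda>s. Y s c) has_vector_derivative Y' - \<Gamma> c (pos c t) (vel t c) (Y t c)) (at t within {a..b})"
  shows "((\<lambda>s. g (\<gamma> s) (X s) (Y s)) has_vector_derivative
    G c (pos c t) X' (Y t c) + G c (pos c t) (X t c) Y') (at t within {a..b})"
proof -
  let ?y = "pos c t" and ?V = "vel t c" and ?X = "X t c" and ?Y = "Y t c"
  note cA = charts_at_D(1)[OF c] and y = pos_in[OF c]
  have "((\<lambda>s. G c (pos c s) (X s c) (Y s c)) has_derivative (\<lambda>h. dG c ?y ?X ?Y (h *\<^sub>R ?V)
      + G c ?y (h *\<^sub>R (X' - \<Gamma> c ?y ?V ?X)) ?Y + G c ?y ?X (h *\<^sub>R (Y' - \<Gamma> c ?y ?V ?Y)))) (at t within {a..b})"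
    using G_bilinear_derivative[of c "pos c" t "{a..b}" "\<lambda>h. h *\<^sub>R ?V" "\<lambda>s. X s c" "\<lambda>h. h *\<^sub>R (X' - \<Gamma> c ?y ?V ?X)"
        "\<lambda>s. Y s c" "\<lambda>h. h *\<^sub>R (Y' - \<Gamma> c ?y ?V ?Y)", OF cA y t]
      pos_deriv[OF t order_refl c] dX dY unfolding has_vector_derivative_def by blast
  moreover have "dG c ?y ?X ?Y (h *\<^sub>R ?V) + G c ?y (h *\<^sub>R (X' - \<Gamma> c ?y ?V ?X)) ?Y + G c ?y ?X (h *\<^sub>R (Y' - \<Gamma> c ?y ?V ?Y))
      = h *\<^sub>R (G c ?y X' ?Y + G c ?y ?X Y')" for h
    unfolding linear_cmul[OF dG_linear3[OF cA y]] linear_cmul[OF G_linear1[OF cA y]] linear_cmul[OF G_linear2[OF cA y]]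
      linear_diff[OF G_linear1[OF cA y]] linear_diff[OF G_linear2[OF cA y]]
    unfolding metric_compatible[OF cA y] by (simp add: algebra_simps)
  ultimately have 1: "((\<lambda>s. G c (pos c s) (X s c) (Y s c)) has_vector_derivative
      G c ?y X' ?Y + G c ?y ?X Y') (at t within {a..b})"
    unfolding has_vector_derivative_def by simp
  have "\<forall>\<^sub>F s in at t within {a..b}. s \<in> {a..b}" by (simp add: eventually_at_filter)
  then have 2: "\<forall>\<^sub>F s in at t within {a..b}. G c (pos c s) (X s c) (Y s c) = g (\<gamma> s) (X s) (Y s)"
    using eventually_chart[OF t order_refl c]
    by eventually_elim (rule g_coord[OF _ X Y, symmetric])
  show ?thesis
    using has_derivative_transform_eventually[OF 1[unfolded has_vector_derivative_def] 2 g_coord[OF c X[OF t] Y[OF t], symmetric] t]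
    unfolding has_vector_derivative_def .
qed

text \<open>In the derivative the two products of \<open>J'\<close> with \<open>K'\<close> cancel by
  symmetry of the metric, and the two curvature terms cancel by the pair symmetry of the
  curvature.\<close>

lemma jacobi_symplectic_constant:
  assumes J: "jacobi_on {a..b} J J'" and K: "jacobi_on {a..b} K K'" and t: "t \<in> {a..b}"
  shows "g (\<gamma> t) (K t) (J' t) - g (\<gamma> t) (J t) (K' t) = g (\<gamma> a) (K a) (J' a) - g (\<gamma> a) (J a) (K' a)"
proof -
  have "((\<lambda>s. g (\<gamma> s) (K s) (J' s) - g (\<gamma> s) (J s) (K' s)) has_derivative (\<lambda>h. 0)) (at t within {a..b})"
    if t: "t \<in> {a..b}" for t
  proof -
    obtain c where c: "c \<in> charts_at A (\<gamma> t)" by (rule chart_exists)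
    note cA = charts_at_D(1)[OF c] and y = pos_in[OF c]
    have in_T: "\<And>s. s \<in> {a..b} \<Longrightarrow> J s \<in> tangent_space A (\<gamma> s)" "\<And>s. s \<in> {a..b} \<Longrightarrow> J' s \<in> tangent_space A (\<gamma> s)"
      "\<And>s. s \<in> {a..b} \<Longrightarrow> K s \<in> tangent_space A (\<gamma> s)" "\<And>s. s \<in> {a..b} \<Longrightarrow> K' s \<in> tangent_space A (\<gamma> s)"
      using J K unfolding jacobi_on_def by blast+
    have Jc: "jacobi_in_chart {a..b} J J' t c" and Kc: "jacobi_in_chart {a..b} K K' t c"
      using J K t c unfolding jacobi_on_def by blast+
    note Jd = Jc[unfolded jacobi_in_chart_def] and Kd = Kc[unfolded jacobi_in_chart_def]
    let ?y = "pos c t" and ?V = "vel t c"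
    have "G c ?y (J t c) (R c ?y ?V (K t c) ?V) = G c ?y (K t c) (R c ?y ?V (J t c) ?V)"
      using R_pair_sym[OF cA y, of ?V "J t c" ?V "K t c"] G_sym[OF cA y] by metis
    moreover have "G c ?y (K' t c) (J' t c) = G c ?y (J' t c) (K' t c)" by (rule G_sym[OF cA y])
    ultimately show ?thesis
      using has_vector_derivative_diff[OF
          metric_derivative[OF t c in_T(3,2) conjunct1[OF Kd] conjunct2[OF Jd]]
          metric_derivative[OF t c in_T(1,4) conjunct1[OF Jd] conjunct2[OF Kd]]]
      unfolding has_vector_derivative_def by simp
  qed
  from has_derivative_zero_constant[OF convex_real_interval(5) this]
  obtain k where "\<And>s. s \<in> {a..b} \<Longrightarrow> g (\<gamma> s) (K s) (J' s) - g (\<gamma> s) (J s) (K' s) = k" by blast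
  from this[OF t] this[of a] show ?thesis using ab by simp
qed

end

section \<open>The curve of Lagrangians of a geodesic\<close>

context semi_riemannian
begin

lemma g_linear1: "v \<in> tangent_space A p \<Longrightarrow> u \<in> tangent_space A p \<Longrightarrow> u' \<in> tangent_space A p \<Longrightarrow>
    g p (u + r *\<^sub>R u') v = g p u v + r * g p u' v"
  by (simp add: g_props(2,3) subspace_scale[OF tangent_subspace])

lemma g_linear2: "v \<in> tangent_space A p \<Longrightarrow> u \<in> tangent_space A p \<Longrightarrow> u' \<in> tangent_space A p \<Longrightarrow>
    g p v (u + r *\<^sub>R u') = g p v u + r * g p v u'"
proof -
  assume *: "v \<in> tangent_space A p" "u \<in> tangent_space A p" "u' \<in> tangent_space A p"
  then have "u + r *\<^sub>R u' \<in> tangent_space A p"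
    by (intro subspace_add[OF tangent_subspace] subspace_scale[OF tangent_subspace])
  from g_props(1)[OF *(1) this] show ?thesis
    using g_linear1[OF *] g_props(1)[OF *(1,2)] g_props(1)[OF *(1,3)] by simp
qed

lemma g_zero: "v \<in> tangent_space A p \<Longrightarrow> g p 0 v = 0" "v \<in> tangent_space A p \<Longrightarrow> g p v 0 = 0"
  using g_props(3)[of v p v 0] g_props(1)[of v p 0] subspace_0[OF tangent_subspace, of p] by simp_all

lemma g_eqI:
  assumes "u \<in> tangent_space A p" "u' \<in> tangent_space A p"
    "\<And>v. v \<in> tangent_space A p \<Longrightarrow> g p u v = g p u' v"
  shows "u = u'"
proof -
  have "u + (- 1) *\<^sub>R u' = 0"
  proof (rule g_nondegenerate)
    show "u + (- 1) *\<^sub>R u' \<in> tangent_space A p"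
      by (intro subspace_add[OF tangent_subspace] subspace_scale[OF tangent_subspace] assms)
    show "g p (u + (- 1) *\<^sub>R u') v = 0" if "v \<in> tangent_space A p" for v
      unfolding g_linear1[OF that assms(1,2)] using assms(3)[OF that] by simp
  qed
  then show ?thesis by simp
qed

lemma symp_space_subspace: "subspace (symp_space A p)"
  unfolding symp_space_def by (rule subspace_Times[OF tangent_subspace tangent_subspace])

lemma symp_form_linear:
  assumes "x \<in> symp_space A p" "y \<in> symp_space A p" "z \<in> symp_space A p"
  shows "symp_form g p (x + y) z = symp_form g p x z + symp_form g p y z"
    "symp_form g p (r *\<^sub>R x) z = r * symp_form g p x z" "symp_form g p x y = - symp_form g p y x"
proof -
  obtain x1 x2 y1 y2 z1 z2 where [simp]: "x = (x1, x2)" "y = (y1, y2)" "z = (z1, z2)" by (cases x, cases y, cases z)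
  have T: "x1 \<in> tangent_space A p" "x2 \<in> tangent_space A p" "y1 \<in> tangent_space A p"
      "y2 \<in> tangent_space A p" "z1 \<in> tangent_space A p" "z2 \<in> tangent_space A p"
    using assms by (simp_all add: symp_space_def)
  note T0 = subspace_0[OF tangent_subspace, of p]
  show "symp_form g p (x + y) z = symp_form g p x z + symp_form g p y z"
    using g_linear1[OF T(6,1,3), of 1] g_linear2[OF T(5,2,4), of 1] by (simp add: symp_form_def)
  show "symp_form g p (r *\<^sub>R x) z = r * symp_form g p x z"
    using g_linear1[OF T(6) T0 T(1), of r] g_linear2[OF T(5) T0 T(2), of r] T
    by (simp add: symp_form_def g_zero right_diff_distrib)
  show "symp_form g p x y = - symp_form g p y x"
    using g_props(1)[OF T(1,4)] g_props(1)[OF T(3,2)] by (simp add: symp_form_def)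
qed

end

context semi_riemannian_geodesic
begin

lemma jacobi_in:
  "jacobi_on S J J' \<Longrightarrow> t \<in> S \<Longrightarrow> J t \<in> tangent_space A (\<gamma> t)"
  "jacobi_on S J J' \<Longrightarrow> t \<in> S \<Longrightarrow> J' t \<in> tangent_space A (\<gamma> t)"
  unfolding jacobi_on_def by blast+

lemma a_in: "a \<in> {a..b}" using ab by simp

text \<open>Pairing with a Jacobi field that vanishes at \<open>t\<close> and has derivative
  \<open>w\<close> there, the conserved form expresses \<open>g (\<gamma> t) (J t) w\<close> by the
  initial data of \<open>J\<close>. Existence thus implies uniqueness, in place of a Gronwall
  estimate.\<close>

lemma jacobi_determined:
  assumes J: "jacobi_on {a..b} J J'" and K: "jacobi_on {a..b} K K'" and t: "t \<in> {a..b}"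
    and eq: "J a = K a" "J' a = K' a"
  shows "J t = K t"
proof (rule g_eqI[OF jacobi_in(1)[OF J t] jacobi_in(1)[OF K t]])
  fix w assume w: "w \<in> tangent_space A (\<gamma> t)"
  obtain N N' where N: "jacobi_on {a..b} N N'" "N t = 0" "N' t = w"
    using jacobi_exists[OF t subspace_0[OF tangent_subspace] w] .
  show "g (\<gamma> t) (J t) w = g (\<gamma> t) (K t) w"
    using jacobi_symplectic_constant[OF J N(1) t] jacobi_symplectic_constant[OF K N(1) t]
      g_zero(1)[OF jacobi_in(2)[OF J t]] g_zero(1)[OF jacobi_in(2)[OF K t]] eq N(2,3) by simp
qed

lemma jacobi_combine:
  assumes J: "jacobi_on {a..b} J J'" and K: "jacobi_on {a..b} K K'"
  shows "jacobi_on {a..b} (\<lambda>t. J t + r *\<^sub>R K t) (\<lambda>t. J' t + r *\<^sub>R K' t)"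
  unfolding jacobi_on_def
proof (intro ballI conjI)
  fix t assume t: "t \<in> {a..b}"
  show "J t + r *\<^sub>R K t \<in> tangent_space A (\<gamma> t)" "J' t + r *\<^sub>R K' t \<in> tangent_space A (\<gamma> t)"
    by (intro subspace_add[OF tangent_subspace] subspace_scale[OF tangent_subspace] jacobi_in[OF J t] jacobi_in[OF K t])+
  fix c assume c: "c \<in> charts_at A (\<gamma> t)"
  note cA = charts_at_D(1)[OF c] and y = pos_in[OF c]
  have Jc: "jacobi_in_chart {a..b} J J' t c" and Kc: "jacobi_in_chart {a..b} K K' t c"
    using J K t c unfolding jacobi_on_def by blast+
  let ?\<Gamma> = "\<Gamma> c (pos c t) (vel t c)" and ?R = "\<lambda>x. R c (pos c t) (vel t c) x (vel t c)"
  have \<Gamma>: "?\<Gamma> (u + r *\<^sub>R v) = ?\<Gamma> u + r *\<^sub>R ?\<Gamma> v" for u v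
    by (simp add: linear_add[OF \<Gamma>_linear2] linear_cmul[OF \<Gamma>_linear2])
  have R: "?R (u + r *\<^sub>R v) = ?R u + r *\<^sub>R ?R v" for u v
    by (simp add: linear_add[OF R_linear2[OF cA y]] linear_cmul[OF R_linear2[OF cA y]])
  have "((\<lambda>s. J s c + r *\<^sub>R K s c) has_vector_derivative
      (J' t c - ?\<Gamma> (J t c)) + r *\<^sub>R (K' t c - ?\<Gamma> (K t c))) (at t within {a..b})"
    using Jc Kc unfolding jacobi_in_chart_def
    by (intro has_vector_derivative_add bounded_linear.has_vector_derivative[OF bounded_linear_scaleR_right]) blast+
  moreover have "((\<lambda>s. J' s c + r *\<^sub>R K' s c) has_vector_derivative
      (?R (J t c) - ?\<Gamma> (J' t c)) + r *\<^sub>R (?R (K t c) - ?\<Gamma> (K' t c))) (at t within {a..b})"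
    using Jc Kc unfolding jacobi_in_chart_def
    by (intro has_vector_derivative_add bounded_linear.has_vector_derivative[OF bounded_linear_scaleR_right]) blast+
  ultimately show "jacobi_in_chart {a..b} (\<lambda>t. J t + r *\<^sub>R K t) (\<lambda>t. J' t + r *\<^sub>R K' t) t c"
    unfolding jacobi_in_chart_def by (simp add: scaleR_fun_def \<Gamma> R algebra_simps)
qed

text \<open>Jacobi fields as a function of their initial data. By \<open>jacobi_determined\<close>
  the choice does not affect the values on \<open>{a..b}\<close>, which are therefore linear in
  \<open>z\<close>.\<close>

definition flow :: "('m, 'n) tangent \<times> ('m, 'n) tangent \<Rightarrow> real \<Rightarrow> ('m, 'n) tangent" where
  "flow z = (SOME J. \<exists>J'. jacobi_on {a..b} J J' \<and> J a = fst z \<and> J' a = snd z)"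

abbreviation data :: "(('m, 'n) tangent \<times> ('m, 'n) tangent) set" where
  "data \<equiv> symp_space A (\<gamma> a)"

lemma data_iff: "z \<in> data \<longleftrightarrow> fst z \<in> tangent_space A (\<gamma> a) \<and> snd z \<in> tangent_space A (\<gamma> a)"
  by (simp add: symp_space_def mem_Times_iff)

lemma flow_jacobi:
  assumes "z \<in> data"
  obtains J' where "jacobi_on {a..b} (flow z) J'" "flow z a = fst z" "J' a = snd z"
proof -
  obtain J J' where "jacobi_on {a..b} J J'" "J a = fst z" "J' a = snd z"
    using jacobi_exists[OF a_in] assms unfolding data_iff by blast
  then have "\<exists>J J'. jacobi_on {a..b} J J' \<and> J a = fst z \<and> J' a = snd z" by blast
  from someI_ex[OF this] show thesis using that unfolding flow_def by blast
qed

lemma flow_unique: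
  assumes "jacobi_on {a..b} J J'" "t \<in> {a..b}"
  shows "flow (J a, J' a) t = J t"
proof -
  have "(J a, J' a) \<in> data" using jacobi_in[OF assms(1) a_in] by (simp add: data_iff)
  then obtain K' where "jacobi_on {a..b} (flow (J a, J' a)) K'" "flow (J a, J' a) a = J a" "K' a = J' a"
    using flow_jacobi by (metis fst_conv snd_conv)
  then show ?thesis using jacobi_determined assms by blast
qed

lemma flow_combine:
  assumes "x \<in> data" "z \<in> data" "t \<in> {a..b}"
  shows "flow (x + r *\<^sub>R z) t = flow x t + r *\<^sub>R flow z t"
proof -
  obtain J' where J: "jacobi_on {a..b} (flow x) J'" "flow x a = fst x" "J' a = snd x" using flow_jacobi[OF assms(1)] .
  obtain K' where K: "jacobi_on {a..b} (flow z) K'" "flow z a = fst z" "K' a = snd z" using flow_jacobi[OF assms(2)] .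
  have "(flow x a + r *\<^sub>R flow z a, J' a + r *\<^sub>R K' a) = x + r *\<^sub>R z"
    by (simp add: J K prod_eq_iff)
  then show ?thesis using flow_unique[OF jacobi_combine[OF J(1) K(1), of r] assms(3)] by (simp only:)
qed

lemma flow_in: "z \<in> data \<Longrightarrow> t \<in> {a..b} \<Longrightarrow> flow z t \<in> tangent_space A (\<gamma> t)"
  using flow_jacobi jacobi_in by metis

lemma flow_0: "t \<in> {a..b} \<Longrightarrow> flow 0 t = 0"
proof -
  assume t: "t \<in> {a..b}"
  note z = subspace_0[OF symp_space_subspace, of "\<gamma> a"]
  have "flow (0 + (- 1) *\<^sub>R 0) t = flow 0 t + (- 1) *\<^sub>R flow 0 t" by (rule flow_combine[OF z z t])
  then show ?thesis by simp
qed

lemma lag_curve_eq: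
  assumes "t \<in> {a..b}"
  shows "lag_curve A g a b \<gamma> t = {z \<in> data. flow z t = 0}"
proof -
  have "(v, w) \<in> lag_curve A g a b \<gamma> t \<longleftrightarrow> (v, w) \<in> {z \<in> data. flow z t = 0}" for v w
  proof
    assume "(v, w) \<in> lag_curve A g a b \<gamma> t"
    then obtain J J' where "(v, w) \<in> data" "jacobi_on {a..b} J J'" "J a = v" "J' a = w" "J t = 0"
      unfolding lag_curve_def jacobi_field_iff by blast
    then show "(v, w) \<in> {z \<in> data. flow z t = 0}" using flow_unique[of J J' t] assms by simp
  next
    assume *: "(v, w) \<in> {z \<in> data. flow z t = 0}"
    then have vw: "(v, w) \<in> data" and 0: "flow (v, w) t = 0" by simp_all
    obtain J' where "jacobi_on {a..b} (flow (v, w)) J'" "flow (v, w) a = v" "J' a = w"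
      using flow_jacobi[OF vw] by (metis fst_conv snd_conv)
    then show "(v, w) \<in> lag_curve A g a b \<gamma> t"
      using vw 0 unfolding lag_curve_def jacobi_field_iff by blast
  qed
  note iff = this
  show ?thesis
  proof (rule set_eqI)
    fix z
    show "z \<in> lag_curve A g a b \<gamma> t \<longleftrightarrow> z \<in> {z \<in> data. flow z t = 0}"
      using iff[of "fst z" "snd z"] by (simp only: prod.collapse)
  qed
qed

lemma flow_symp_form:
  assumes J: "jacobi_on {a..b} J J'" and K: "jacobi_on {a..b} K K'" and t: "t \<in> {a..b}"
  shows "symp_form g (\<gamma> a) (J a, J' a) (K a, K' a) = g (\<gamma> t) (K t) (J' t) - g (\<gamma> t) (J t) (K' t)"
  using jacobi_symplectic_constant[OF J K t] by (simp add: symp_form_def)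

text \<open>The form may be evaluated at \<open>t\<close> instead of \<open>a\<close>. There it
  vanishes on two fields that are both zero at \<open>t\<close>, and the fields that are zero at
  \<open>t\<close> with arbitrary derivative detect every nonzero value
  \<open>flow z t\<close>.\<close>

lemma lag_curve_lagrangian:
  assumes t: "t \<in> {a..b}"
  shows "lag_curve A g a b \<gamma> t \<in> lagrangians data (symp_form g (\<gamma> a))"
proof -
  let ?L = "{z \<in> data. flow z t = 0}" and ?w = "symp_form g (\<gamma> a)"
  note sub = symp_space_subspace[of "\<gamma> a"]
  have L: "subspace ?L"
    unfolding subspace_def
  proof (intro conjI ballI allI)
    show "0 \<in> ?L" using subspace_0[OF sub] flow_0[OF t] by simp
    fix x r assume "x \<in> ?L"
    then have x: "x \<in> data" "flow x t = 0" by simp_all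
    show "r *\<^sub>R x \<in> ?L"
      using flow_combine[OF subspace_0[OF sub] x(1) t, of r] flow_0[OF t] x subspace_scale[OF sub x(1)] by simp
    fix y assume "y \<in> ?L"
    then have y: "y \<in> data" "flow y t = 0" by simp_all
    show "x + y \<in> ?L"
      using flow_combine[OF x(1) y(1) t, of 1] x y subspace_add[OF sub x(1) y(1)] by simp
  qed
  have iso: "?w z u = 0" if z: "z \<in> ?L" and u: "u \<in> ?L" for z u
  proof -
    have "z \<in> data" "u \<in> data" using z u by simp_all
    obtain J' where J: "jacobi_on {a..b} (flow z) J'" "flow z a = fst z" "J' a = snd z"
      using flow_jacobi[OF \<open>z \<in> data\<close>] .
    obtain K' where K: "jacobi_on {a..b} (flow u) K'" "flow u a = fst u" "K' a = snd u"
      using flow_jacobi[OF \<open>u \<in> data\<close>] .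
    have "flow z t = 0" "flow u t = 0" using z u by simp_all
    then show ?thesis
      using flow_symp_form[OF J(1) K(1) t] J K g_zero(1)[OF jacobi_in(2)[OF J(1) t]] g_zero(1)[OF jacobi_in(2)[OF K(1) t]]
      by simp
  qed
  have max: "flow z t = 0" if z: "z \<in> data" and orth: "\<And>u. u \<in> ?L \<Longrightarrow> ?w z u = 0" for z
  proof (rule g_nondegenerate[OF flow_in[OF z t]])
    fix x assume x: "x \<in> tangent_space A (\<gamma> t)"
    obtain J' where J: "jacobi_on {a..b} (flow z) J'" "flow z a = fst z" "J' a = snd z" using flow_jacobi[OF z] .
    obtain K K' where K: "jacobi_on {a..b} K K'" "K t = 0" "K' t = x"
      using jacobi_exists[OF t subspace_0[OF tangent_subspace] x] .
    have "(K a, K' a) \<in> ?L"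
      using flow_unique[OF K(1) t] K(2) jacobi_in[OF K(1) a_in] by (simp add: data_iff)
    from orth[OF this] show "g (\<gamma> t) (flow z t) x = 0"
      using flow_symp_form[OF J(1) K(1) t] J K(2,3) g_zero(1)[OF jacobi_in(2)[OF J(1) t]] by simp
  qed
  have "?L = {z \<in> data. \<forall>u\<in>?L. ?w z u = 0}"
  proof (intro equalityI subsetI)
    show "z \<in> {z \<in> data. \<forall>u\<in>?L. ?w z u = 0}" if "z \<in> ?L" for z
      using that iso[OF that] by blast
    show "z \<in> ?L" if "z \<in> {z \<in> data. \<forall>u\<in>?L. ?w z u = 0}" for z
      using that max[of z] by blast
  qed
  moreover have "?L \<subseteq> data" by blast
  ultimately show ?thesis
    unfolding lag_curve_eq[OF t] lagrangians_def mem_Collect_eq by (intro conjI L)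
qed

text \<open>The Lagrangian at \<open>t\<close> is the kernel of the component of
  \<open>flow z t\<close> in a chart fixed near \<open>t0\<close>, so that the values lie in one
  vector space and vary continuously. The map is onto at \<open>t0\<close>, since some Jacobi field
  takes any given value there.\<close>

theorem lag_curve_path:
  assumes sub: "{\<alpha>..\<beta>} \<subseteq> {a..b}"
    and basis: "symplectic_basis data (symp_form g (\<gamma> a)) e (f :: 'k::finite \<Rightarrow> _)"
    and tr: "\<And>t. t \<in> {\<alpha>..\<beta>} \<Longrightarrow> transverse (lag_curve A g a b \<gamma> t) (annihilator data (symp_form g (\<gamma> a)) e)"
  shows "lagrangian_path data (symp_form g (\<gamma> a)) \<alpha> \<beta> (lag_curve A g a b \<gamma>)"
proof -
  interpret B: symplectic_basis data "symp_form g (\<gamma> a)" e f by (rule basis)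
  have "\<exists>c. c \<in> charts_at A (\<gamma> t)" for t by (rule chart_exists) blast
  then obtain c where c: "\<And>t. c t \<in> charts_at A (\<gamma> t)" using choice[of "\<lambda>t c. c \<in> charts_at A (\<gamma> t)"] by blast
  define S where "S t0 = {t \<in> {\<alpha>..\<beta>}. c t0 \<in> charts_at A (\<gamma> t)}" for t0
  have S_ab: "t \<in> {a..b}" if "t \<in> S t0" for t t0 using that sub unfolding S_def by blast
  have cS: "c t0 \<in> charts_at A (\<gamma> t)" if "t \<in> S t0" for t t0 using that unfolding S_def by blast
  show ?thesis
  proof (rule B.lagrangian_pathI[where F = "\<lambda>t0 t z. flow z t (c t0)" and S = S])
    show "lag_curve A g a b \<gamma> t \<in> lagrangians data (symp_form g (\<gamma> a))" if "t \<in> {\<alpha>..\<beta>}" for t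
      using that sub by (intro lag_curve_lagrangian) blast
    show "transverse (lag_curve A g a b \<gamma> t) (annihilator data (symp_form g (\<gamma> a)) e)" if "t \<in> {\<alpha>..\<beta>}" for t
      by (rule tr[OF that])
    fix t0 assume t0: "t0 \<in> {\<alpha>..\<beta>}"
    have "continuous_on {\<alpha>..\<beta>} \<gamma>"
      using geo continuous_on_subset[OF _ sub] unfolding geodesic_def by blast
    then have "openin (top_of_set {\<alpha>..\<beta>}) ({\<alpha>..\<beta>} \<inter> \<gamma> -` dom_of (c t0))"
      by (intro continuous_openin_preimage_gen chart(1) charts_at_D(1)[OF c])
    also have "{\<alpha>..\<beta>} \<inter> \<gamma> -` dom_of (c t0) = S t0"
      using charts_at_D(1)[OF c[of t0]] by (simp add: S_def charts_at_def set_eq_iff)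
    finally show "openin (top_of_set {\<alpha>..\<beta>}) (S t0) \<and> t0 \<in> S t0"
      using t0 c by (simp add: S_def)
    then have t0S: "t0 \<in> S t0" ..
    show "flow (x + y) t (c t0) = flow x t (c t0) + flow y t (c t0)" if "t \<in> S t0" "x \<in> data" "y \<in> data" for t x y
      using flow_combine[OF that(2,3) S_ab[OF that(1)], of 1] by simp
    show "flow (r *\<^sub>R x) t (c t0) = r *\<^sub>R flow x t (c t0)" if "t \<in> S t0" "x \<in> data" for t r x
      using flow_combine[OF subspace_0[OF symp_space_subspace] that(2) S_ab[OF that(1)], of r] flow_0[OF S_ab[OF that(1)]]
      by (simp add: scaleR_fun_def)
    show "lag_curve A g a b \<gamma> t = {z \<in> data. flow z t (c t0) = 0}" if t: "t \<in> S t0" for t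
    proof -
      have "flow z t = 0" if "z \<in> data" "flow z t (c t0) = 0" for z
        by (rule tangent_eqI[OF flow_in[OF that(1) S_ab[OF t]] subspace_0[OF tangent_subspace] cS[OF t]])
          (simp add: that(2))
      then show ?thesis unfolding lag_curve_eq[OF S_ab[OF t]] by (intro Collect_cong) (metis zero_fun_apply)
    qed
    show "(\<lambda>z. flow z t0 (c t0)) ` data = UNIV"
    proof -
      have "u \<in> (\<lambda>z. flow z t0 (c t0)) ` data" for u
      proof -
        obtain J J' where J: "jacobi_on {a..b} J J'" "J t0 = tangent_of A (\<gamma> t0) (c t0) u" "J' t0 = 0"
          using jacobi_exists[OF S_ab[OF t0S] tangent_of_in[OF c] subspace_0[OF tangent_subspace]] .
        have "flow (J a, J' a) t0 (c t0) = u"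
          using flow_unique[OF J(1) S_ab[OF t0S]] J(2) c by simp
        moreover have "(J a, J' a) \<in> data" using jacobi_in[OF J(1) a_in] by (simp add: data_iff)
        ultimately show ?thesis by blast
      qed
      then show ?thesis by blast
    qed
    show "((\<lambda>t. flow z t (c t0)) \<longlongrightarrow> flow z t0 (c t0)) (at t0 within S t0)" if z: "z \<in> data" for z
    proof -
      obtain J' where "jacobi_on {a..b} (flow z) J'" by (rule flow_jacobi[OF z])
      then have "jacobi_in_chart {a..b} (flow z) J' t0 (c t0)"
        using S_ab[OF t0S] c unfolding jacobi_on_def by blast
      then have "continuous (at t0 within {a..b}) (\<lambda>t. flow z t (c t0))"
        unfolding jacobi_in_chart_def using has_vector_derivative_continuous by blast
      then have "continuous (at t0 within S t0) (\<lambda>t. flow z t (c t0))"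
        by (rule continuous_within_subset) (use S_ab in blast)
      then show ?thesis by (simp add: continuous_within)
    qed
  qed
qed

end

section \<open>The Lagrangian of a submanifold\<close>

text \<open>The part \<open>z\<close> of \<open>f' u\<close> orthogonal to \<open>W\<close> is
  orthogonal to \<open>f\<close> along the line, so the derivative of that constant inner product
  shows \<open>z = 0\<close>.\<close>

lemma derivative_in_subspace:
  fixes f :: "'a::real_normed_vector \<Rightarrow> 'b::euclidean_space"
  assumes f: "(f has_derivative f') (at x)" and W: "subspace W"
    and near: "\<delta> > 0" "\<And>t. \<bar>t\<bar> < \<delta> \<Longrightarrow> f (x + t *\<^sub>R u) \<in> W"
  shows "f' u \<in> W"
proof -
  obtain y z where yz: "y \<in> span W" "\<And>w. w \<in> span W \<Longrightarrow> orthogonal z w" "f' u = y + z"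
    using orthogonal_subspace_decomp_exists by metis
  have sp: "span W = W" using W by simp
  have "((\<lambda>t. x + t *\<^sub>R u) has_derivative (\<lambda>t. t *\<^sub>R u)) (at 0)"
    by (auto intro!: derivative_eq_intros)
  moreover have "(f has_derivative f') (at (x + 0 *\<^sub>R u))" using f by simp
  ultimately have "((\<lambda>t. f (x + t *\<^sub>R u)) has_derivative (\<lambda>t. f' (t *\<^sub>R u))) (at 0)"
    by (rule has_derivative_compose)
  then have 1: "((\<lambda>t. z \<bullet> f (x + t *\<^sub>R u)) has_derivative (\<lambda>t. z \<bullet> f' (t *\<^sub>R u))) (at 0)"
    by (rule has_derivative_inner_right)
  have "((\<lambda>t. z \<bullet> f (x + t *\<^sub>R u)) has_derivative (\<lambda>t. 0)) (at 0)"
  proof (rule has_derivative_transform_within_open[of "\<lambda>_. 0" _ _ _ "ball 0 \<delta>"])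
    show "0 = z \<bullet> f (x + t *\<^sub>R u)" if "t \<in> ball 0 \<delta>" for t
      using near(2)[of t] that yz(2) unfolding sp by (simp add: orthogonal_def dist_real_def)
  qed (use near(1) in auto)
  from fun_cong[OF has_derivative_unique[OF 1 this], of 1] have "z \<bullet> f' u = 0" by simp
  moreover have "z \<bullet> y = 0" using yz(1,2) by (simp add: orthogonal_def)
  ultimately have "z = 0" using yz(3) by (simp add: inner_add_right)
  then show ?thesis using yz(1,3) unfolding sp by simp
qed

text \<open>Orthonormal bases of \<open>W\<close> and of its Euclidean complement, put together and
  indexed by \<open>'n\<close> so as to index a symplectic basis later; \<open>K\<close> marks the
  vectors in \<open>W\<close>. The Euclidean product is auxiliary: the metric may be indefinite and
  enters only through dual vectors.\<close>

lemma orthonormal_adapted_basis: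
  fixes W :: "(real ^ 'n) set"
  assumes W: "subspace W"
  obtains d :: "'n \<Rightarrow> real ^ 'n" and K where "card K = dim W" "\<And>i j. d i \<bullet> d j = of_bool (i = j)"
    "\<And>x. x = (\<Sum>i\<in>UNIV. (d i \<bullet> x) *\<^sub>R d i)" "\<And>x. x \<in> W \<longleftrightarrow> (\<forall>i. i \<notin> K \<longrightarrow> d i \<bullet> x = 0)" "\<And>i. i \<in> K \<Longrightarrow> d i \<in> W"
proof -
  have spW: "span W = W" using W by simp
  define W' where "W' = {x. \<forall>w\<in>W. x \<bullet> w = 0}"
  have W': "subspace W'" by (auto simp: W'_def subspace_def inner_add_left)
  obtain B where B: "B \<subseteq> W" "pairwise orthogonal B" "\<And>x. x \<in> B \<Longrightarrow> norm x = 1" "independent B" "card B = dim W" "span B = W"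
    using orthonormal_basis_subspace[OF W] by metis
  obtain B' where B': "B' \<subseteq> W'" "pairwise orthogonal B'" "\<And>x. x \<in> B' \<Longrightarrow> norm x = 1" "independent B'" "card B' = dim W'" "span B' = W'"
    using orthonormal_basis_subspace[OF W'] by metis
  have BB': "x \<bullet> y = 0" "y \<bullet> x = 0" if "x \<in> B" "y \<in> B'" for x y
  proof -
    show "y \<bullet> x = 0" using that B(1) B'(1) unfolding W'_def by blast
    then show "x \<bullet> y = 0" by (simp add: inner_commute)
  qed
  define C where "C = B \<union> B'"
  have orth: "x \<bullet> y = of_bool (x = y)" if "x \<in> C" "y \<in> C" for x y
  proof (cases "x = y")
    case True
    then have "norm x = 1" using that B(3) B'(3) unfolding C_def by blast
    then show ?thesis using True by (simp add: dot_square_norm)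
  next
    case False
    then show ?thesis
      using that BB' B(2) B'(2) unfolding C_def pairwise_def orthogonal_def by auto
  qed
  have "span C = UNIV"
  proof -
    have "x \<in> span C" for x
    proof -
      obtain y z where yz: "y \<in> span W" "\<And>w. w \<in> span W \<Longrightarrow> orthogonal z w" "x = y + z"
        using orthogonal_subspace_decomp_exists by metis
      have "z \<in> span B'" using yz(2) unfolding B'(6) W'_def orthogonal_def by (simp add: span_base)
      moreover have "y \<in> span B" using yz(1) by (simp only: spW B(6))
      ultimately show ?thesis
        unfolding yz(3) C_def by (intro span_add) (meson Un_upper1 Un_upper2 span_mono subsetD)+
    qed
    then show ?thesis by blast
  qed
  moreover have indC: "independent C"
  proof (rule pairwise_orthogonal_independent)
    show "pairwise orthogonal C" using orth by (simp add: pairwise_def orthogonal_def)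
    show "0 \<notin> C" using orth[of 0 0] by auto
  qed
  ultimately have cardC: "card C = CARD('n)"
    using dim_eq_card_independent[of C] dim_span[of C] by simp
  have finC: "finite C" using indC by (rule independent_imp_finite)
  then obtain d where d: "bij_betw d (UNIV :: 'n set) C"
    using finite_same_card_bij[of "UNIV :: 'n set" C] cardC by auto
  define K where "K = {i. d i \<in> B}"
  have dC: "d i \<in> C" for i using d by (auto simp: bij_betw_def)
  have d_inj: "d i = d j \<longleftrightarrow> i = j" for i j using d by (auto simp: bij_betw_def inj_on_def)
  have dd: "d i \<bullet> d j = of_bool (i = j)" for i j using orth[OF dC dC, of i j] d_inj by simp
  have exp: "x = (\<Sum>i\<in>UNIV. (d i \<bullet> x) *\<^sub>R d i)" for x
  proof -
    have "x \<in> span C" using \<open>span C = UNIV\<close> by simp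
    then obtain q where "x = (\<Sum>v\<in>C. q v *\<^sub>R v)" using span_finite[OF finC] by auto
    also have "\<dots> = (\<Sum>i\<in>UNIV. q (d i) *\<^sub>R d i)"
      using sum.reindex_bij_betw[OF d, of "\<lambda>v. q v *\<^sub>R v"] by simp
    finally have x: "x = (\<Sum>i\<in>UNIV. q (d i) *\<^sub>R d i)" .
    have "d j \<bullet> x = q (d j)" for j
      unfolding x inner_sum_right by (simp add: dd if_distrib of_bool_def cong: if_cong)
    then show ?thesis using x by simp
  qed
  have dB': "d i \<in> B'" if "i \<notin> K" for i using dC[of i] that by (auto simp: K_def C_def)
  show thesis
  proof (rule that[of K d, OF _ dd exp])
    have "d ` K = B" using d unfolding K_def bij_betw_def C_def by auto
    moreover have "inj_on d K" using d_inj by (auto simp: inj_on_def)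
    ultimately show "card K = dim W" using card_image[of d K] B(5) by simp
    show "d i \<in> W" if "i \<in> K" for i using that B(1) by (auto simp: K_def)
    show "x \<in> W \<longleftrightarrow> (\<forall>i. i \<notin> K \<longrightarrow> d i \<bullet> x = 0)" for x
    proof
      assume "x \<in> W"
      then show "\<forall>i. i \<notin> K \<longrightarrow> d i \<bullet> x = 0" using dB' B'(1) by (auto simp: W'_def)
    next
      assume *: "\<forall>i. i \<notin> K \<longrightarrow> d i \<bullet> x = 0"
      have "(d i \<bullet> x) *\<^sub>R d i \<in> W" for i
        using * B(1) subspace_scale[OF W] subspace_0[OF W] by (cases "i \<in> K") (auto simp: K_def)
      then have "(\<Sum>i\<in>UNIV. (d i \<bullet> x) *\<^sub>R d i) \<in> W" by (intro subspace_sum[OF W])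
      then show "x \<in> W" using exp[of x] by simp
    qed
  qed
qed

text \<open>Riesz representation for a nondegenerate form: sending \<open>x\<close> to the vector of
  \<open>W\<close> with coefficients \<open>B x v\<close> in an orthonormal basis is an injective
  linear map of \<open>W\<close> into itself, hence onto.\<close>

lemma bilinear_representation:
  fixes B :: "'a::euclidean_space \<Rightarrow> 'a \<Rightarrow> real"
  assumes W: "subspace W" and B: "\<And>y. linear (\<lambda>x. B x y)" "\<And>x. linear (B x)"
    and nondeg: "\<And>x. x \<in> W \<Longrightarrow> (\<And>y. y \<in> W \<Longrightarrow> B x y = 0) \<Longrightarrow> x = 0" and \<phi>: "linear \<phi>"
  obtains s where "s \<in> W" "\<And>y. y \<in> W \<Longrightarrow> B s y = \<phi> y"
proof -
  obtain C where C: "C \<subseteq> W" "pairwise orthogonal C" "\<And>x. x \<in> C \<Longrightarrow> norm x = 1" "independent C" "card C = dim W" "span C = W"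
    using orthonormal_basis_subspace[OF W] by metis
  have finC: "finite C" using C(4) by (rule independent_imp_finite)
  have coeff: "(\<Sum>v\<in>C. q v *\<^sub>R v) \<bullet> v' = q v'" if v': "v' \<in> C" for q v'
  proof -
    have "v \<bullet> v' = of_bool (v = v')" if "v \<in> C" for v
      using C(2,3) that v' unfolding pairwise_def orthogonal_def by (cases "v = v'") (auto simp: dot_square_norm)
    then have "(\<Sum>v\<in>C. q v *\<^sub>R v) \<bullet> v' = (\<Sum>v\<in>C. q v * of_bool (v = v'))"
      by (simp add: inner_sum_left cong: sum.cong)
    then show ?thesis using finC v' by (simp add: of_bool_def if_distrib cong: if_cong)
  qed
  have in_W: "(\<Sum>v\<in>C. q v *\<^sub>R v) \<in> W" for q
    using C(1) by (intro subspace_sum[OF W] subspace_scale[OF W]) auto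
  define f where "f x = (\<Sum>v\<in>C. B x v *\<^sub>R v)" for x
  have lin: "linear f"
    by (rule linearI)
      (simp_all add: f_def linear_add[OF B(1)] linear_cmul[OF B(1)] scaleR_add_left sum.distrib scaleR_sum_right)
  have inj: "inj_on f W"
  proof (subst linear_inj_on_iff_eq_0[OF lin W], intro ballI impI)
    fix x assume x: "x \<in> W" "f x = 0"
    have "B x v = 0" if "v \<in> C" for v using coeff[OF that, of "B x"] x(2) by (simp add: f_def)
    then have "B x y = 0" if "y \<in> W" for y
      using linear_eq_on_span[OF B(2) linear_zero, of C x y] that C(6) by simp
    then show "x = 0" using nondeg x(1) by blast
  qed
  have spW: "span W = W" using W by simp
  have "dim (f ` W) = dim W" by (rule dim_image_eq[OF lin]) (unfold spW, rule inj)
  moreover have "f ` W \<subseteq> W" using in_W by (auto simp: f_def)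
  ultimately have "f ` W = W"
    using subspace_dim_equal[OF linear_subspace_image[OF lin W] W] by simp
  then obtain s where s: "s \<in> W" "f s = (\<Sum>v\<in>C. \<phi> v *\<^sub>R v)" using in_W by (metis imageE)
  have "B s v = \<phi> v" if "v \<in> C" for v
    using coeff[OF that, of "B s"] coeff[OF that, of \<phi>] s(2) by (simp add: f_def)
  then have "B s y = \<phi> y" if "y \<in> W" for y
    using linear_eq_on_span[OF B(2) \<phi>, of C s y] that C(6) by simp
  then show thesis using that s(1) by blast
qed

context semi_riemannian
begin

section \<open>Slice charts and the second fundamental form\<close>

lemma slice_coord_in:
  "slice_chart A P c W \<Longrightarrow> c \<in> charts_at A p \<Longrightarrow> p \<in> P \<Longrightarrow> coord c p \<in> W"
  using charts_at_D(2) unfolding slice_chart_def by blast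

text \<open>The range of the chart is open, so a short segment in \<open>W\<close> consists of
  coordinates of points of \<open>P\<close>. The open set \<open>U\<close> keeps these points where
  a second chart or a vector field is defined.\<close>

lemma slice_points_near:
  assumes sl: "slice_chart A P c W" and p: "p \<in> P" "p \<in> U" and c: "c \<in> charts_at A p"
    and U: "open U" and u: "u \<in> W"
  obtains \<delta> where "\<delta> > 0"
    "\<And>t. \<bar>t\<bar> < \<delta> \<Longrightarrow> \<exists>q. q \<in> dom_of c \<inter> P \<inter> U \<and> coord c p + t *\<^sub>R u = coord c q"
proof -
  have cA: "c \<in> A" and W: "subspace W" and im: "coord c ` (dom_of c \<inter> P) = range_of c \<inter> W"
    using sl unfolding slice_chart_def by blast+
  let ?O = "range_of c \<inter> coord_inv c -` U"
  have "open ?O" by (rule continuous_open_preimage[OF chart(4)[OF cA] chart(2)[OF cA] U])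
  moreover have "coord c p \<in> ?O" using c p chart(5)[OF cA] by (simp add: charts_at_def)
  ultimately obtain r where r: "r > 0" "ball (coord c p) r \<subseteq> ?O" using open_contains_ball by blast
  show thesis
  proof (rule that[of "r / (norm u + 1)"])
    have n: "norm u + 1 > 0" by (smt (verit) norm_ge_zero)
    then show "r / (norm u + 1) > 0" using r(1) by simp
    fix t assume t: "\<bar>t\<bar> < r / (norm u + 1)"
    have "\<bar>t\<bar> * norm u \<le> \<bar>t\<bar> * (norm u + 1)" by (simp add: mult_left_mono)
    also have "\<dots> < r" using t n by (simp add: pos_less_divide_eq)
    finally have "coord c p + t *\<^sub>R u \<in> ball (coord c p) r" by (simp add: dist_norm)
    then have "coord c p + t *\<^sub>R u \<in> ?O" using r(2) by blast
    moreover have "coord c p + t *\<^sub>R u \<in> W"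
      by (intro subspace_add[OF W] subspace_scale[OF W] u slice_coord_in[OF sl c p(1)])
    ultimately have "coord c p + t *\<^sub>R u \<in> coord c ` (dom_of c \<inter> P)" "coord_inv c (coord c p + t *\<^sub>R u) \<in> U"
      unfolding im by blast+
    then obtain q where q: "q \<in> dom_of c \<inter> P" "coord c p + t *\<^sub>R u = coord c q" by blast
    then have "q \<in> U" using \<open>coord_inv c (coord c p + t *\<^sub>R u) \<in> U\<close> chart(5)[OF cA] by simp
    then show "\<exists>q. q \<in> dom_of c \<inter> P \<inter> U \<and> coord c p + t *\<^sub>R u = coord c q" using q by blast
  qed
qed

text \<open>The transition map sends short segments of one slice into the other slice, and
  derivatives stay in the subspace. Hence the slice chart chosen in \<open>subtangent\<close> does
  not matter.\<close>

lemma slice_tangent_change: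
  assumes c: "slice_chart A P c W" "c \<in> charts_at A p" and d: "slice_chart A P d W'" "d \<in> charts_at A p"
    and p: "p \<in> P" and u: "u \<in> W"
  shows "dtrans c d (coord c p) u \<in> W'"
proof -
  note cA = charts_at_D(1)[OF c(2)] and dA = charts_at_D(1)[OF d(2)]
  have W': "subspace W'" using d(1) unfolding slice_chart_def by blast
  obtain \<delta> where \<delta>: "\<delta> > 0"
    "\<And>t. \<bar>t\<bar> < \<delta> \<Longrightarrow> \<exists>q. q \<in> dom_of c \<inter> P \<inter> dom_of d \<and> coord c p + t *\<^sub>R u = coord c q"
    using slice_points_near[OF c(1) p charts_at_D(2)[OF d(2)] c(2) chart(1)[OF dA] u] by metis
  have "coord c p \<in> overlap c d" using charts_at_D(2)[OF c(2)] charts_at_D(2)[OF d(2)] by blast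
  from transition_deriv(1)[OF cA dA this] W' \<delta>(1) show ?thesis
  proof (rule derivative_in_subspace)
    fix t assume "\<bar>t\<bar> < \<delta>"
    then obtain q where q: "q \<in> dom_of c \<inter> P \<inter> dom_of d" "coord c p + t *\<^sub>R u = coord c q" using \<delta>(2) by blast
    then have "transition c d (coord c p + t *\<^sub>R u) = coord d q" by (simp add: transition_coord[OF cA])
    then show "transition c d (coord c p + t *\<^sub>R u) \<in> W'"
      using slice_coord_in[OF d(1) charts_at_I[OF dA]] q(1) by auto
  qed
qed

lemma subtangent_slice:
  assumes c: "slice_chart A P c W" "c \<in> charts_at A p" and p: "p \<in> P"
  shows "subtangent A P p = {v \<in> tangent_space A p. v c \<in> W}"
proof -
  have "v c \<in> W" if v: "v \<in> tangent_space A p" "v d \<in> W'" and d: "d \<in> charts_at A p" "slice_chart A P d W'" for v d W'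
    using slice_tangent_change[OF d(2,1) c p v(2)] tangent_change[OF v(1) d(1) c(2)] by simp
  then show ?thesis using c unfolding subtangent_def by blast
qed

text \<open>As for derivatives along the geodesic, the second derivative of the transition map
  cancels against the inhomogeneous term of \<open>\<Gamma>_transform\<close>, so the coordinate
  expressions form a tangent vector.\<close>

lemma nabla_in:
  assumes X: "smooth_vector_field_on A U X" and U: "open U" "p \<in> U" and v: "v \<in> tangent_space A p"
  shows "nabla A g p v X \<in> tangent_space A p"
    and "c \<in> charts_at A p \<Longrightarrow> nabla A g p v X c =
      frechet_derivative (\<lambda>y. X (coord_inv c y) c) (at (coord c p)) (v c) + \<Gamma> c (coord c p) (v c) (X p c)"
    and "c \<in> charts_at A p \<Longrightarrow> (\<lambda>y. X (coord_inv c y) c) differentiable (at (coord c p))"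
proof -
  have XT: "X q \<in> tangent_space A q" if "q \<in> U" for q using X that unfolding smooth_vector_field_on_def by blast
  have diff: "(\<lambda>y. X (coord_inv c y) c) differentiable (at (coord c p))" if c: "c \<in> charts_at A p" for c
  proof (rule smooth_onD(1))
    show "smooth_on (coord c ` (dom_of c \<inter> U)) (\<lambda>y. X (coord_inv c y) c)"
      using X charts_at_D(1)[OF c] unfolding smooth_vector_field_on_def by blast
    show "coord c p \<in> coord c ` (dom_of c \<inter> U)" using charts_at_D(2)[OF c] U(2) by blast
  qed
  have at: "nabla A g p v X c =
      frechet_derivative (\<lambda>y. X (coord_inv c y) c) (at (coord c p)) (v c) + \<Gamma> c (coord c p) (v c) (X p c)"
    if c: "c \<in> charts_at A p" for c
    using c chart(5)[OF charts_at_D(1)[OF c] charts_at_D(2)[OF c]] by (simp add: nabla_def nabla_coord_def)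
  show "nabla A g p v X \<in> tangent_space A p"
  proof (rule tangentI)
    fix c d assume c: "c \<in> charts_at A p" and d: "d \<in> charts_at A p"
    note cA = charts_at_D(1)[OF c] and dA = charts_at_D(1)[OF d]
    note pc = charts_at_D(2)[OF c] and pd = charts_at_D(2)[OF d]
    let ?y = "coord c p"
    let ?Xc = "\<lambda>y. X (coord_inv c y) c" and ?Xd = "\<lambda>y. X (coord_inv d y) d"
    have y: "?y \<in> overlap c d" using pc pd by blast
    have ty: "transition c d ?y = coord d p" by (rule transition_coord[OF cA pc])
    let ?O = "range_of c \<inter> coord_inv c -` (dom_of d \<inter> U)"
    have O: "open ?O"
      by (rule continuous_open_preimage[OF chart(4)[OF cA] chart(2)[OF cA] open_Int[OF chart(1)[OF dA] U(1)]])
    have yO: "?y \<in> ?O" using pc pd U(2) by (simp add: chart(5)[OF cA])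
    have "((\<lambda>y. ?Xd (transition c d y)) has_derivative
        (\<lambda>h. frechet_derivative ?Xd (at (coord d p)) (dtrans c d ?y h))) (at ?y)"
      by (rule has_derivative_compose[OF transition_deriv(1)[OF cA dA y]])
        (simp add: ty frechet_derivative_works_at[OF diff[OF d]])
    then have 1: "((\<lambda>y. dtrans c d y (?Xc y)) has_derivative
        (\<lambda>h. frechet_derivative ?Xd (at (coord d p)) (dtrans c d ?y h))) (at ?y)"
    proof (rule has_derivative_transform_within_open[OF _ O yO])
      fix z assume z: "z \<in> ?O"
      then have zc: "coord_inv c z \<in> dom_of c" "coord c (coord_inv c z) = z" using coord_inv_in by blast+
      then have q: "c \<in> charts_at A (coord_inv c z)" "d \<in> charts_at A (coord_inv c z)" "coord_inv c z \<in> U"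
        using z cA dA by (auto intro: charts_at_I)
      then have "z \<in> overlap c d" using zc charts_at_D(2) by (metis IntI imageI)
      then show "?Xd (transition c d z) = dtrans c d z (?Xc z)"
        using tangent_change[OF XT[OF q(3)] q(1,2)] zc(2) by (simp add: coord_inv_transition[OF cA dA])
    qed
    have 2: "((\<lambda>y. dtrans c d y (?Xc y)) has_derivative
        (\<lambda>h. d2trans c d ?y (?Xc ?y) h + dtrans c d ?y (frechet_derivative ?Xc (at ?y) h))) (at ?y)"
      by (rule dtrans_linear_derivative[OF cA dA y UNIV_I has_derivative_ident frechet_derivative_works_at[OF diff[OF c]]])
    have "frechet_derivative ?Xd (at (coord d p)) (dtrans c d ?y (v c)) =
        d2trans c d ?y (?Xc ?y) (v c) + dtrans c d ?y (frechet_derivative ?Xc (at ?y) (v c))"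
      by (rule fun_cong[OF has_derivative_unique[OF 1 2]])
    moreover have "?Xc ?y = X p c" by (simp add: chart(5)[OF cA pc])
    moreover have "v d = dtrans c d ?y (v c)" "X p d = dtrans c d ?y (X p c)"
      using tangent_change[OF v c d] tangent_change[OF XT[OF U(2)] c d] .
    ultimately show "nabla A g p v X d = dtrans c d ?y (nabla A g p v X c)"
      using \<Gamma>_transform[OF cA dA y, of "v c" "X p c"] d2trans_sym[OF cA dA y, of "X p c" "v c"]
      unfolding at[OF c] at[OF d] by (simp add: ty linear_add[OF transition_deriv(2)[OF cA dA y]] algebra_simps)
  qed (simp add: nabla_def)
  show "c \<in> charts_at A p \<Longrightarrow> nabla A g p v X c =
      frechet_derivative (\<lambda>y. X (coord_inv c y) c) (at (coord c p)) (v c) + \<Gamma> c (coord c p) (v c) (X p c)"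
    by (rule at)
  show "c \<in> charts_at A p \<Longrightarrow> (\<lambda>y. X (coord_inv c y) c) differentiable (at (coord c p))"
    by (rule diff)
qed

text \<open>In a slice chart the components of a tangential field stay in \<open>W\<close> along
  \<open>P\<close>, so their derivative in a tangential direction is tangential and orthogonal to
  the normal vector. Only the term with \<Gamma> is left, which does not depend on the
  extension.\<close>

lemma second_fundamental_form:
  assumes c: "slice_chart A P c W" "c \<in> charts_at A p" and p: "p \<in> P"
    and \<nu>: "\<nu> \<in> normal_subspace A g P p" and v: "v \<in> subtangent A P p"
    and X: "tangential_extension A P p v' U X"
  shows "g p (nabla A g p v X) \<nu> = G c (coord c p) (\<Gamma> c (coord c p) (v c) (v' c)) (\<nu> c)"
proof -
  note cA = charts_at_D(1)[OF c(2)] and pc = charts_at_D(2)[OF c(2)]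
  let ?y = "coord c p" and ?Xc = "\<lambda>y. X (coord_inv c y) c"
  have U: "open U" "p \<in> U" and Xs: "smooth_vector_field_on A U X" and Xt: "\<And>q. q \<in> P \<inter> U \<Longrightarrow> X q \<in> subtangent A P q"
    and Xp: "X p = v'"
    using X unfolding tangential_extension_def by blast+
  have vT: "v \<in> tangent_space A p" and vW: "v c \<in> W" using v unfolding subtangent_slice[OF c p] by blast+
  have \<nu>T: "\<nu> \<in> tangent_space A p" and \<nu>: "\<And>z. z \<in> subtangent A P p \<Longrightarrow> g p \<nu> z = 0"
    using \<nu> unfolding normal_subspace_def by blast+
  have y: "?y \<in> range_of c" using pc by blast
  have W: "subspace W" using c(1) unfolding slice_chart_def by blast
  let ?D = "frechet_derivative ?Xc (at ?y) (v c)"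
  have "?D \<in> W"
  proof -
    obtain \<delta> where \<delta>: "\<delta> > 0" "\<And>t. \<bar>t\<bar> < \<delta> \<Longrightarrow> \<exists>q. q \<in> dom_of c \<inter> P \<inter> U \<and> ?y + t *\<^sub>R v c = coord c q"
      using slice_points_near[OF c(1) p U(2) c(2) U(1) vW] by metis
    from frechet_derivative_works_at[OF nabla_in(3)[OF Xs U vT c(2)]] W \<delta>(1) show ?thesis
    proof (rule derivative_in_subspace)
      fix t assume "\<bar>t\<bar> < \<delta>"
      then obtain q where q: "q \<in> dom_of c" "q \<in> P" "q \<in> U" "?y + t *\<^sub>R v c = coord c q" using \<delta>(2) by blast
      have "X q c \<in> W"
        using Xt[of q] q subtangent_slice[OF c(1) charts_at_I[OF cA q(1)] q(2)] by blast
      then show "?Xc (?y + t *\<^sub>R v c) \<in> W" by (simp add: q(4) chart(5)[OF cA q(1)])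
    qed
  qed
  then have "tangent_of A p c ?D \<in> subtangent A P p"
    unfolding subtangent_slice[OF c p] using c(2) by simp
  from \<nu>[OF this] have "G c ?y (\<nu> c) ?D = 0"
    using g_coord[OF c(2) \<nu>T tangent_of_in[OF c(2)]] c(2) by simp
  then have "G c ?y ?D (\<nu> c) = 0" using G_sym[OF cA y] by metis
  then show ?thesis
    using g_coord[OF c(2) nabla_in(1)[OF Xs U vT] \<nu>T]
    by (simp add: nabla_in(2)[OF Xs U vT c(2)] linear_add[OF G_linear1[OF cA y]] Xp)
qed

text \<open>Constant components in a slice chart. One extension for every vector is what lets the
  condition over all extensions in \<open>shape_operator\<close> determine the operator.\<close>

lemma tangential_extension_exists:
  assumes c: "slice_chart A P c W" "c \<in> charts_at A p" and p: "p \<in> P" and v: "v \<in> subtangent A P p"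
  shows "tangential_extension A P p v (dom_of c) (\<lambda>q. tangent_of A q c (v c))"
proof -
  note cA = charts_at_D(1)[OF c(2)] and pc = charts_at_D(2)[OF c(2)]
  have vT: "v \<in> tangent_space A p" and vW: "v c \<in> W" using v unfolding subtangent_slice[OF c p] by blast+
  have in_T: "tangent_of A q c (v c) \<in> tangent_space A q" if "q \<in> dom_of c" for q
    by (rule tangent_of_in[OF charts_at_I[OF cA that]])
  have "smooth_vector_field_on A (dom_of c) (\<lambda>q. tangent_of A q c (v c))"
    unfolding smooth_vector_field_on_def
  proof (intro conjI ballI in_T)
    fix d assume dA: "d \<in> A"
    have "smooth_on (overlap d c) (\<lambda>y. dtrans c d (transition d c y) (v c))"
    proof (rule smooth_on_compose[OF overlap_open[OF dA cA] overlap_open[OF cA dA] _ dtrans_smooth[OF cA dA] transition_smooth[OF dA cA]])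
      show "transition d c ` overlap d c \<subseteq> overlap c d" using transition_in[OF dA] by blast
    qed
    moreover have "dtrans c d (transition d c y) (v c) = tangent_of A (coord_inv d y) c (v c) d" if y: "y \<in> overlap d c" for y
    proof -
      obtain q where q: "q \<in> dom_of d" "q \<in> dom_of c" "y = coord d q" using y by blast
      then show ?thesis
        using charts_at_I[OF dA q(1)] by (simp add: tangent_of_def chart(5)[OF dA] transition_coord[OF dA])
    qed
    ultimately show "smooth_on (overlap d c) (\<lambda>y. tangent_of A (coord_inv d y) c (v c) d)"
      using smooth_on_cong[OF overlap_open[OF dA cA]] by (metis (no_types, lifting))
  qed
  moreover have "tangent_of A q c (v c) \<in> subtangent A P q" if "q \<in> P \<inter> dom_of c" for q
    using that vW charts_at_I[OF cA] by (subst subtangent_slice[OF c(1)]) auto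
  ultimately show ?thesis
    using chart(1)[OF cA] pc tangent_of_eq[OF vT c(2)] unfolding tangential_extension_def by blast
qed

text \<open>The definite description picks the vector tangent to \<open>P\<close> that represents
  the functional \<sigma> with respect to the metric; nondegeneracy on the tangent space of
  \<open>P\<close> gives its existence and uniqueness.\<close>

lemma shape_operator_slice:
  assumes c: "slice_chart A P c W" "c \<in> charts_at A p" and p: "p \<in> P"
    and \<nu>: "\<nu> \<in> normal_subspace A g P p" and nondeg: "nondegenerate_on (subtangent A P p) (g p)"
    and v: "v \<in> subtangent A P p"
  shows "shape_operator A g P p \<nu> v \<in> subtangent A P p"
    and "v' \<in> subtangent A P p \<Longrightarrow>
      g p (shape_operator A g P p \<nu> v) v' = G c (coord c p) (\<Gamma> c (coord c p) (v c) (v' c)) (\<nu> c)"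
proof -
  note cA = charts_at_D(1)[OF c(2)] and pc = charts_at_D(2)[OF c(2)]
  let ?y = "coord c p" and ?T = "subtangent A P p"
  have y: "?y \<in> range_of c" using pc by blast
  have W: "subspace W" using c(1) unfolding slice_chart_def by blast
  note T = subtangent_slice[OF c p]
  have TT: "z \<in> tangent_space A p" "z c \<in> W" if "z \<in> ?T" for z using that unfolding T by blast+
  have lift: "tangent_of A p c x \<in> ?T" if "x \<in> W" for x unfolding T using that c(2) by simp
  define \<sigma> where "\<sigma> x = G c ?y (\<Gamma> c ?y (v c) x) (\<nu> c)" for x
  have \<sigma>: "linear \<sigma>"
    unfolding \<sigma>_def using linear_compose[OF \<Gamma>_linear2 G_linear1[OF cA y]] by (simp add: o_def)
  obtain s where s: "s \<in> W" "\<And>x. x \<in> W \<Longrightarrow> G c ?y s x = \<sigma> x"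
  proof (rule bilinear_representation[OF W G_linear1[OF cA y] G_linear2[OF cA y] _ \<sigma>])
    fix x assume x: "x \<in> W" and 0: "\<And>z. z \<in> W \<Longrightarrow> G c ?y x z = 0"
    have "g p (tangent_of A p c x) z = 0" if "z \<in> ?T" for z
      using g_coord[OF c(2) tangent_of_in[OF c(2)] TT(1)[OF that]] 0[OF TT(2)[OF that]] c(2) by simp
    then have "tangent_of A p c x = 0" using nondeg lift[OF x] unfolding nondegenerate_on_def by blast
    then show "x = 0" using tangent_of_at[OF c(2), of x] by simp
  next
    fix s assume "s \<in> W" "\<And>x. x \<in> W \<Longrightarrow> G c ?y s x = \<sigma> x"
    then show thesis by (rule that)
  qed
  define S where "S = tangent_of A p c s"
  have S: "S \<in> ?T" "\<And>v'. v' \<in> ?T \<Longrightarrow> g p S v' = \<sigma> (v' c)"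
    using lift[OF s(1)] g_coord[OF c(2)] TT s(2) c(2) by (simp_all add: S_def)
  have "shape_operator A g P p \<nu> v = S"
    unfolding shape_operator_def
  proof (rule the_equality)
    show "S \<in> ?T \<and> (\<forall>v'\<in>?T. \<forall>U V'. tangential_extension A P p v' U V' \<longrightarrow> g p S v' = g p (nabla A g p v V') \<nu>)"
      using S second_fundamental_form[OF c p \<nu> v] unfolding \<sigma>_def by simp
    fix s' assume s': "s' \<in> ?T \<and> (\<forall>v'\<in>?T. \<forall>U V'. tangential_extension A P p v' U V' \<longrightarrow> g p s' v' = g p (nabla A g p v V') \<nu>)"
    have eq: "g p s' v' = \<sigma> (v' c)" if v': "v' \<in> ?T" for v'
      using s' v' tangential_extension_exists[OF c p v'] second_fundamental_form[OF c p \<nu> v tangential_extension_exists[OF c p v']]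
      unfolding \<sigma>_def by metis
    have "s' + (- 1) *\<^sub>R S = 0"
    proof -
      have "s' c + (- 1) *\<^sub>R S c \<in> W"
        using TT(2) s' S(1) by (intro subspace_add[OF W] subspace_scale[OF W]) blast+
      moreover have "s' + (- 1) *\<^sub>R S \<in> tangent_space A p"
        using TT(1) s' S(1) by (intro subspace_add[OF tangent_subspace] subspace_scale[OF tangent_subspace]) blast+
      ultimately have "s' + (- 1) *\<^sub>R S \<in> ?T" unfolding T by (simp add: scaleR_fun_def)
      moreover have "g p (s' + (- 1) *\<^sub>R S) v' = 0" if "v' \<in> ?T" for v'
        using g_linear1[OF TT(1)[OF that] TT(1) TT(1)[OF S(1)], of s' "- 1"] s' eq[OF that] S(2)[OF that] by simp
      ultimately show ?thesis using nondeg unfolding nondegenerate_on_def by blast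
    qed
    then show "s' = S" by simp
  qed
  then show "shape_operator A g P p \<nu> v \<in> ?T" "v' \<in> ?T \<Longrightarrow>
      g p (shape_operator A g P p \<nu> v) v' = G c ?y (\<Gamma> c ?y (v c) (v' c)) (\<nu> c)"
    using S unfolding \<sigma>_def by simp_all
qed

text \<open>Both Lagrangians become coordinate subspaces of one basis: the Lagrangian of the point
  is spanned by all \<open>e i\<close>, that of the submanifold by the \<open>f i\<close> with index
  in \<open>K\<close> and the remaining \<open>e i\<close>. They thus differ in as many directions
  as the submanifold has dimensions.\<close>

theorem adapted_symplectic_basis:
  assumes P: "submanifold A P k" and p: "p \<in> P"
    and \<nu>: "\<nu> \<in> normal_subspace A g P p" and nondeg: "nondegenerate_on (subtangent A P p) (g p)"
  obtains e f :: "'n \<Rightarrow> ('m, 'n) tangent \<times> ('m, 'n) tangent" and K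
  where "symplectic_basis (symp_space A p) (symp_form g p) e f" "card K = k"
    "annihilator (symp_space A p) (symp_form g p) e = lag_zero A p"
    "annihilator (symp_space A p) (symp_form g p) (\<lambda>i. if i \<in> K then f i else e i) = lag_submanifold A g P p \<nu>"
proof -
  obtain c W where c: "slice_chart A P c W" "c \<in> charts_at A p" and dimW: "dim W = k"
    using P p unfolding submanifold_def by blast
  note cA = charts_at_D(1)[OF c(2)] and pc = charts_at_D(2)[OF c(2)]
  let ?y = "coord c p" and ?V = "symp_space A p" and ?w = "symp_form g p" and ?\<tau> = "tangent_of A p c"
  have y: "?y \<in> range_of c" using pc by blast
  have W: "subspace W" using c(1) unfolding slice_chart_def by blast
  note T = subtangent_slice[OF c p]
  note G1 = G_linear1[OF cA y] and G2 = G_linear2[OF cA y] and Gs = G_sym[OF cA y]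
  have \<nu>T: "\<nu> \<in> tangent_space A p" using \<nu> unfolding normal_subspace_def by blast
  \<comment> \<open>In a slice chart the second fundamental form is the restriction of \<open>\<sigma>\<close>, which is symmetric on the
    whole tangent space; so the basis of the submanifold need not be completed by normal vectors.\<close>
  define \<sigma> where "\<sigma> x z = G c ?y (\<Gamma> c ?y x z) (\<nu> c)" for x z
  have \<sigma>1: "linear (\<lambda>x. \<sigma> x z)" and \<sigma>2: "linear (\<sigma> x)" for x z
    unfolding \<sigma>_def using linear_compose[OF \<Gamma>_linear1 G1] linear_compose[OF \<Gamma>_linear2 G1] by (simp_all add: o_def)
  have \<sigma>s: "\<sigma> x z = \<sigma> z x" for x z unfolding \<sigma>_def by (simp add: \<Gamma>_sym[OF cA y, of x z])
  obtain K and d :: "'n \<Rightarrow> real ^ 'n" where d: "card K = dim W" "\<And>i j. d i \<bullet> d j = of_bool (i = j)" "\<And>x. x = (\<Sum>i\<in>UNIV. (d i \<bullet> x) *\<^sub>R d i)"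
    "\<And>x. x \<in> W \<longleftrightarrow> (\<forall>i. i \<notin> K \<longrightarrow> d i \<bullet> x = 0)" "\<And>i. i \<in> K \<Longrightarrow> d i \<in> W"
    by (rule orthonormal_adapted_basis[OF W], rule that)
  have nondegG: "x = 0" if "\<And>z. G c ?y x z = 0" for x using G_nondegenerate[OF cA y that] .
  have repr: "\<exists>s. \<forall>x. G c ?y s x = \<phi> x" if \<phi>: "linear \<phi>" for \<phi>
  proof (rule bilinear_representation[OF subspace_UNIV G1 G2 _ \<phi>])
    fix x assume "\<And>z. z \<in> UNIV \<Longrightarrow> G c ?y x z = 0"
    then show "x = 0" by (intro nondegG) simp
  next
    fix s assume "\<And>z. z \<in> UNIV \<Longrightarrow> G c ?y s z = \<phi> z"
    then show ?thesis by blast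
  qed
  have "\<exists>s. \<forall>x. G c ?y s x = d i \<bullet> x" for i by (intro repr bounded_linear.linear bounded_linear_inner_right)
  \<comment> \<open>The dual basis of \<open>d\<close> for the metric; for an index outside
    \<open>K\<close> the vector \<open>\<beta> i\<close> is orthogonal to \<open>W\<close>, that is,
    normal to the submanifold.\<close>
  then obtain \<beta> where \<beta>: "\<And>i x. G c ?y (\<beta> i) x = d i \<bullet> x" by metis
  have "\<exists>s. \<forall>x. G c ?y s x = \<sigma> z x" for z by (intro repr \<sigma>2)
  then obtain S where S: "\<And>z x. G c ?y (S z) x = \<sigma> z x" by metis
  have Sneg: "G c ?y z (- S x) = - \<sigma> x z" for x z
    using Gs[of z "- S x"] linear_neg[OF G1, where x = "S x"] by (simp add: S)
  define e where "e i = (0 :: ('m, 'n) tangent, ?\<tau> (\<beta> i))" for i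
  \<comment> \<open>For an index in \<open>K\<close> the component \<open>- S (d i)\<close>
    compensates the shape operator up to normal vectors, as the Lagrangian of the submanifold
    requires. The symmetry of \<sigma> makes the \<open>f i\<close> pairwise orthogonal for the
    symplectic form.\<close>
  define f where "f i = (?\<tau> (d i), ?\<tau> (- S (d i)))" for i
  have wc: "?w x z = G c ?y (fst z c) (snd x c) - G c ?y (fst x c) (snd z c)" if "x \<in> ?V" "z \<in> ?V" for x z
    using that g_coord[OF c(2)] by (auto simp: symp_form_def symp_space_def mem_Times_iff split_beta)
  have ef_in: "e i \<in> ?V" "f i \<in> ?V" for i
    using c(2) subspace_0[OF tangent_subspace] by (simp_all add: e_def f_def symp_space_def)
  have we: "?w (e i) z = d i \<bullet> fst z c" if "z \<in> ?V" for z i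
    using wc[OF ef_in(1) that, of i] c(2) Gs[of "fst z c" "\<beta> i"] linear_0[OF G1]
    by (simp add: e_def \<beta>)
  have wf: "?w (f i) z = - (\<sigma> (d i) (fst z c) + G c ?y (d i) (snd z c))" if "z \<in> ?V" for z i
    using wc[OF ef_in(2) that, of i] c(2) by (simp add: f_def Sneg)
  have basis: "symplectic_basis ?V ?w e f"
  proof
    show "subspace ?V" by (rule symp_space_subspace)
    show "?w (x + y) z = ?w x z + ?w y z" if "x \<in> ?V" "y \<in> ?V" "z \<in> ?V" for x y z
      using symp_form_linear(1)[OF that] .
    show "?w (r *\<^sub>R x) z = r * ?w x z" if "x \<in> ?V" "z \<in> ?V" for r x z
      using symp_form_linear(2)[OF that(1) that(2) that(2)] .
    show sk: "?w x y = - ?w y x" if "x \<in> ?V" "y \<in> ?V" for x y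
      using symp_form_linear(3)[OF that that(2)] .
    show "e i \<in> ?V" "f i \<in> ?V" for i by (rule ef_in)+
    show "?w (e i) (e j) = 0" for i j using we[OF ef_in(1), of i j] by (simp add: e_def)
    show "?w (e i) (f j) = of_bool (i = j)" for i j using we[OF ef_in(2), of i j] c(2) d(2) by (simp add: f_def)
    show "?w (f i) (f j) = 0" for i j
      using wf[OF ef_in(2), of i j] c(2) \<sigma>s[of "d i" "d j"] by (simp add: f_def Sneg)
    fix z assume z: "z \<in> ?V"
    have zT: "fst z \<in> tangent_space A p" "snd z \<in> tangent_space A p"
      using z by (simp_all add: symp_space_def mem_Times_iff)
    have wzf: "?w z (f i) = \<sigma> (d i) (fst z c) + G c ?y (d i) (snd z c)" for i
      using sk[OF z ef_in(2), of i] wf[OF z, of i] by simp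
    let ?a = "\<lambda>i. \<sigma> (d i) (fst z c) + G c ?y (d i) (snd z c)" and ?b = "\<lambda>i. d i \<bullet> fst z c"
    have 1: "fst z c = (\<Sum>i\<in>UNIV. ?b i *\<^sub>R d i)" by (rule d(3))
    have 2: "snd z c = (\<Sum>i\<in>UNIV. ?a i *\<^sub>R \<beta> i - ?b i *\<^sub>R S (d i))"
    proof -
      have expG: "(\<Sum>i\<in>UNIV. (d i \<bullet> x) * h (d i)) = h x" if "linear h" for x and h :: "_ \<Rightarrow> real"
      proof -
        have "h x = h (\<Sum>i\<in>UNIV. (d i \<bullet> x) *\<^sub>R d i)" using d(3)[of x] by (rule arg_cong)
        then show ?thesis by (simp add: linear_sum[OF that] linear_cmul[OF that])
      qed
      have "G c ?y (snd z c - (\<Sum>i\<in>UNIV. ?a i *\<^sub>R \<beta> i - ?b i *\<^sub>R S (d i))) x = 0" for x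
      proof -
        have "G c ?y (\<Sum>i\<in>UNIV. ?a i *\<^sub>R \<beta> i - ?b i *\<^sub>R S (d i)) x
            = (\<Sum>i\<in>UNIV. ?a i * (d i \<bullet> x) - ?b i * \<sigma> (d i) x)"
          by (simp add: linear_sum[OF G1] linear_diff[OF G1] linear_cmul[OF G1] \<beta> S)
        also have "\<dots> = (\<Sum>i\<in>UNIV. (d i \<bullet> x) * \<sigma> (d i) (fst z c)) + (\<Sum>i\<in>UNIV. (d i \<bullet> x) * G c ?y (d i) (snd z c))
            - (\<Sum>i\<in>UNIV. ?b i * \<sigma> (d i) x)"
          by (simp add: sum.distrib sum_subtractf distrib_left mult.commute)
        also have "\<dots> = G c ?y (snd z c) x"
          unfolding expG[OF \<sigma>1] expG[OF G1] using \<sigma>s[of x] Gs[of x] by simp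
        finally show ?thesis by (simp add: linear_diff[OF G1])
      qed
      then have "snd z c - (\<Sum>i\<in>UNIV. ?a i *\<^sub>R \<beta> i - ?b i *\<^sub>R S (d i)) = 0" by (rule nondegG)
      then show ?thesis by (simp only: right_minus_eq)
    qed
    have \<tau>: "linear ?\<tau>" by (rule tangent_of_linear[OF c(2)])
    have 3: "fst z = (\<Sum>i\<in>UNIV. ?b i *\<^sub>R ?\<tau> (d i))"
      using arg_cong[OF 1, of ?\<tau>] tangent_of_eq[OF zT(1) c(2)] by (simp add: linear_sum[OF \<tau>] linear_cmul[OF \<tau>])
    have 4: "snd z = (\<Sum>i\<in>UNIV. ?a i *\<^sub>R ?\<tau> (\<beta> i) + ?b i *\<^sub>R ?\<tau> (- S (d i)))"
      using arg_cong[OF 2, of ?\<tau>] tangent_of_eq[OF zT(2) c(2)]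
      by (simp add: linear_sum[OF \<tau>] linear_cmul[OF \<tau>] linear_diff[OF \<tau>] linear_neg[OF \<tau>])
    show "z = (\<Sum>i\<in>UNIV. ?w z (f i) *\<^sub>R e i + ?w (e i) z *\<^sub>R f i)"
      unfolding wzf we[OF z]
    proof (rule prod_eqI)
      show "fst z = fst (\<Sum>i\<in>UNIV. ?a i *\<^sub>R e i + ?b i *\<^sub>R f i)"
        using 3 by (simp add: fst_sum e_def f_def)
      show "snd z = snd (\<Sum>i\<in>UNIV. ?a i *\<^sub>R e i + ?b i *\<^sub>R f i)"
        using 4 by (simp add: snd_sum e_def f_def)
    qed
  qed
  have zero: "annihilator ?V ?w e = lag_zero A p"
  proof -
    have "(\<forall>i. ?w (e i) z = 0) \<longleftrightarrow> fst z = 0" if z: "z \<in> ?V" for z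
    proof
      assume "\<forall>i. ?w (e i) z = 0"
      then have "fst z c = 0" using d(3)[of "fst z c"] we[OF z] by simp
      then show "fst z = 0"
        using tangent_eqI[OF _ subspace_0[OF tangent_subspace] c(2), of "fst z"] z
        by (simp add: symp_space_def mem_Times_iff)
    qed (simp add: we[OF z])
    note iff = this
    show ?thesis
    proof (rule set_eqI)
      fix z
      have "z \<in> annihilator ?V ?w e \<longleftrightarrow> z \<in> ?V \<and> fst z = 0"
        using iff[of z] unfolding annihilator_def by blast
      also have "\<dots> \<longleftrightarrow> z \<in> lag_zero A p"
        using subspace_0[OF tangent_subspace, of p] by (auto simp: lag_zero_def symp_space_def mem_Times_iff)
      finally show "z \<in> annihilator ?V ?w e \<longleftrightarrow> z \<in> lag_zero A p" .
    qed
  qed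
  have sub: "annihilator ?V ?w (\<lambda>i. if i \<in> K then f i else e i) = lag_submanifold A g P p \<nu>"
  proof -
    let ?S = "shape_operator A g P p \<nu>"
    have "(\<forall>i. ?w (if i \<in> K then f i else e i) z = 0) \<longleftrightarrow>
        fst z \<in> subtangent A P p \<and> snd z + ?S (fst z) \<in> normal_subspace A g P p" if z: "z \<in> ?V" for z
    proof -
      have zT: "fst z \<in> tangent_space A p" "snd z \<in> tangent_space A p"
        using z by (simp_all add: symp_space_def mem_Times_iff)
      \<comment> \<open>The equations with index outside \<open>K\<close> say that the first
        component is tangent to the submanifold; those with index in \<open>K\<close> express the
        normality condition, tested on a basis of \<open>W\<close>.\<close>
      have K: "(\<forall>i. ?w (if i \<in> K then f i else e i) z = 0) \<longleftrightarrow>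
          fst z c \<in> W \<and> (\<forall>i\<in>K. \<sigma> (d i) (fst z c) + G c ?y (d i) (snd z c) = 0)"
        unfolding d(4) using we[OF z] wf[OF z] by (smt (verit))
      have lin: "linear (\<lambda>x. \<sigma> x (fst z c) + G c ?y x (snd z c))" by (intro linear_compose_add \<sigma>1 G1)
      have K': "(\<forall>i\<in>K. \<sigma> (d i) (fst z c) + G c ?y (d i) (snd z c) = 0) \<longleftrightarrow>
          (\<forall>x\<in>W. \<sigma> x (fst z c) + G c ?y x (snd z c) = 0)"
      proof
        assume 0: "\<forall>i\<in>K. \<sigma> (d i) (fst z c) + G c ?y (d i) (snd z c) = 0"
        show "\<forall>x\<in>W. \<sigma> x (fst z c) + G c ?y x (snd z c) = 0"
        proof
          fix x assume "x \<in> W"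
          have "\<sigma> x (fst z c) + G c ?y x (snd z c) =
              (\<lambda>x. \<sigma> x (fst z c) + G c ?y x (snd z c)) (\<Sum>i\<in>UNIV. (d i \<bullet> x) *\<^sub>R d i)"
            using arg_cong[OF d(3)[of x], of "\<lambda>x. \<sigma> x (fst z c) + G c ?y x (snd z c)"] .
          also have "\<dots> = (\<Sum>i\<in>UNIV. (d i \<bullet> x) *\<^sub>R (\<sigma> (d i) (fst z c) + G c ?y (d i) (snd z c)))"
            unfolding linear_sum[OF lin] linear_cmul[OF lin] ..
          also have "\<dots> = 0"
          proof (rule sum.neutral, rule ballI)
            fix i
            show "(d i \<bullet> x) *\<^sub>R (\<sigma> (d i) (fst z c) + G c ?y (d i) (snd z c)) = 0"
              using 0 \<open>x \<in> W\<close> unfolding d(4) by (cases "i \<in> K") simp_all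
          qed
          finally show "\<sigma> x (fst z c) + G c ?y x (snd z c) = 0" .
        qed
      qed (use d(5) in blast)
      have N: "(\<forall>x\<in>W. \<sigma> x (fst z c) + G c ?y x (snd z c) = 0) \<longleftrightarrow> snd z + ?S (fst z) \<in> normal_subspace A g P p"
        if sub: "fst z \<in> subtangent A P p"
      proof -
        note sh = shape_operator_slice[OF c p \<nu> nondeg sub]
        have ST: "?S (fst z) \<in> tangent_space A p" using sh(1) unfolding T by blast
        have eq: "g p (snd z + ?S (fst z)) v = \<sigma> (v c) (fst z c) + G c ?y (v c) (snd z c)" if v: "v \<in> subtangent A P p" for v
        proof -
          have vT: "v \<in> tangent_space A p" using v unfolding T by blast
          have "g p (snd z + ?S (fst z)) v = g p (snd z) v + g p (?S (fst z)) v"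
            using g_linear1[OF vT zT(2) ST, of 1] by simp
          also have "g p (snd z) v = G c ?y (v c) (snd z c)"
            using g_coord[OF c(2) zT(2) vT] Gs by simp
          also have "g p (?S (fst z)) v = \<sigma> (v c) (fst z c)"
            using sh(2)[OF v] \<sigma>s[of "fst z c" "v c"] by (simp add: \<sigma>_def)
          finally show ?thesis by (simp only: add.commute)
        qed
        have "snd z + ?S (fst z) \<in> tangent_space A p" by (intro subspace_add[OF tangent_subspace] zT ST)
        then have "snd z + ?S (fst z) \<in> normal_subspace A g P p \<longleftrightarrow>
            (\<forall>v\<in>subtangent A P p. g p (snd z + ?S (fst z)) v = 0)"
          unfolding normal_subspace_def by blast
        also have "\<dots> \<longleftrightarrow> (\<forall>v\<in>subtangent A P p. \<sigma> (v c) (fst z c) + G c ?y (v c) (snd z c) = 0)"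
          by (rule ball_cong[OF refl]) (simp only: eq)
        also have "\<dots> \<longleftrightarrow> (\<forall>x\<in>W. \<sigma> x (fst z c) + G c ?y x (snd z c) = 0)"
        proof (intro iffI ballI)
          fix x assume 0: "\<forall>v\<in>subtangent A P p. \<sigma> (v c) (fst z c) + G c ?y (v c) (snd z c) = 0" and x: "x \<in> W"
          have "?\<tau> x \<in> subtangent A P p" unfolding T using x c(2) by simp
          from bspec[OF 0 this] show "\<sigma> x (fst z c) + G c ?y x (snd z c) = 0" using c(2) by simp
        next
          fix v assume 0: "\<forall>x\<in>W. \<sigma> x (fst z c) + G c ?y x (snd z c) = 0" and v: "v \<in> subtangent A P p"
          then have "v c \<in> W" unfolding T by blast
          then show "\<sigma> (v c) (fst z c) + G c ?y (v c) (snd z c) = 0" using 0 by blast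
        qed
        finally show ?thesis by (rule sym)
      qed
      have "fst z \<in> subtangent A P p \<longleftrightarrow> fst z c \<in> W" unfolding T using zT(1) by simp
      then show ?thesis using K K' N by blast
    qed
    note iff = this
    have "(v, w) \<in> annihilator ?V ?w (\<lambda>i. if i \<in> K then f i else e i) \<longleftrightarrow> (v, w) \<in> lag_submanifold A g P p \<nu>" for v w
    proof -
      have "(\<forall>i. ?w (if i \<in> K then f i else e i) (v, w) = 0) \<longleftrightarrow>
          v \<in> subtangent A P p \<and> w + ?S v \<in> normal_subspace A g P p" if "(v, w) \<in> ?V"
        using iff[OF that] by (simp only: fst_conv snd_conv)
      then show ?thesis unfolding annihilator_def lag_submanifold_def by blast
    qed
    note eq = this
    show ?thesis
    proof (rule set_eqI)
      fix z
      show "z \<in> annihilator ?V ?w (\<lambda>i. if i \<in> K then f i else e i) \<longleftrightarrow> z \<in> lag_submanifold A g P p \<nu>"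
        using eq[of "fst z" "snd z"] by (simp only: prod.collapse)
    qed
  qed
  show thesis using that[OF basis _ zero sub] d(1) dimW by simp
qed

end

theorem proposition4p5:
  fixes A :: "('m::{t2_space,second_countable_topology}, 'n::finite) chart set"
    and g :: "('m, 'n) metric"
    and \<gamma> :: "real \<Rightarrow> 'm" and a b :: real
    and P :: "'m set" and k :: nat
    and \<mu> :: "(('m, 'n) tangent \<times> ('m, 'n) tangent) set \<Rightarrow> real \<Rightarrow> real \<Rightarrow>
              (real \<Rightarrow> (('m, 'n) tangent \<times> ('m, 'n) tangent) set) \<Rightarrow> int"
  assumes "smooth_structure A" and "semi_riemannian_metric A g"
    and "a < b" and "geodesic A g a b \<gamma>"
    and "submanifold A P k" and "connected P" and "\<gamma> a \<in> P"
    and "velocity A a b \<gamma> a \<in> normal_subspace A g P (\<gamma> a)"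
    and "nondegenerate_on (subtangent A P (\<gamma> a)) (g (\<gamma> a))"
    and "is_maslov_index (symp_space A (\<gamma> a)) (symp_form g (\<gamma> a)) \<mu>"
  shows "((\<forall>t. \<not> conjugate_instant A g a b \<gamma> t) \<longrightarrow>
           (\<forall>\<alpha> \<beta>. \<alpha> \<le> \<beta> \<and> {\<alpha>..\<beta>} \<subseteq> {a<..b} \<longrightarrow>
              \<bar>\<mu> (lag_submanifold A g P (\<gamma> a) (velocity A a b \<gamma> a)) \<alpha> \<beta> (lag_curve A g a b \<gamma>)\<bar>
                \<le> int k))
       \<and> ((\<forall>t. \<not> focal_instant A g P a b \<gamma> t) \<longrightarrow>
           (\<forall>\<alpha> \<beta>. \<alpha> \<le> \<beta> \<and> {\<alpha>..\<beta>} \<subseteq> {a<..b} \<longrightarrow>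
              \<bar>\<mu> (lag_zero A (\<gamma> a)) \<alpha> \<beta> (lag_curve A g a b \<gamma>)\<bar> \<le> int k))"
proof -
  interpret semi_riemannian_geodesic A g a b \<gamma>
    by unfold_locales (rule assms)+
  let ?LP = "lag_submanifold A g P (\<gamma> a) (velocity A a b \<gamma> a)"
  let ?L0 = "lag_zero A (\<gamma> a)"
  let ?w = "symp_form g (\<gamma> a)"
  obtain e f :: "'n \<Rightarrow> ('m, 'n) tangent \<times> ('m, 'n) tangent" and K
    where basis: "symplectic_basis data ?w e f" and card: "card K = k"
      and L0: "annihilator data ?w e = ?L0"
      and LP: "annihilator data ?w (\<lambda>i. if i \<in> K then f i else e i) = ?LP"
    by (rule adapted_symplectic_basis[OF assms(5,7,8,9)], rule that)
  interpret B: symplectic_basis data ?w e f by (rule basis)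
  \<comment> \<open>The second claim is the same bound for the swapped basis, in which the
    annihilator of the first half is \<open>?LP\<close>.\<close>
  let ?e = "\<lambda>i. if i \<in> K then f i else e i" and ?f = "\<lambda>i. if i \<in> K then - e i else f i"
  have swapped: "symplectic_basis data ?w ?e ?f" by (rule B.swap)
  interpret S: symplectic_basis data ?w ?e ?f by (rule swapped)
  \<comment> \<open>Swapping twice returns \<open>- e i\<close> for indices in \<open>K\<close>, and
    the sign does not change the annihilator.\<close>
  have L0': "annihilator data ?w (\<lambda>i. if i \<in> K then ?f i else ?e i) = ?L0"
  proof -
    have "?w (if i \<in> K then ?f i else ?e i) z = 0 \<longleftrightarrow> ?w (e i) z = 0" if "z \<in> data" for i z
      using B.w_minus[OF B.e_in that, of i] by simp
    then show ?thesis unfolding L0[symmetric] annihilator_def by blast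
  qed
  have "\<bar>\<mu> ?LP \<alpha> \<beta> (lag_curve A g a b \<gamma>)\<bar> \<le> int k"
    if free: "\<And>t. \<not> conjugate_instant A g a b \<gamma> t" and \<alpha>\<beta>: "\<alpha> \<le> \<beta>" "{\<alpha>..\<beta>} \<subseteq> {a<..b}" for \<alpha> \<beta>
  proof -
    have sub: "{\<alpha>..\<beta>} \<subseteq> {a..b}" using \<alpha>\<beta>(2) greaterThanAtMost_subseteq_atLeastAtMost_iff[of a b a b] by blast
    have tr: "transverse (lag_curve A g a b \<gamma> t) (annihilator data ?w e)" if "t \<in> {\<alpha>..\<beta>}" for t
      using free[of t] that \<alpha>\<beta>(2) unfolding conjugate_instant_def transverse_def L0 by blast
    show ?thesis
      using B.maslov_index_bound[OF assms(10) \<alpha>\<beta>(1) lag_curve_path[OF sub basis tr] tr, of K]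
      unfolding LP card .
  qed
  moreover have "\<bar>\<mu> ?L0 \<alpha> \<beta> (lag_curve A g a b \<gamma>)\<bar> \<le> int k"
    if free: "\<And>t. \<not> focal_instant A g P a b \<gamma> t" and \<alpha>\<beta>: "\<alpha> \<le> \<beta>" "{\<alpha>..\<beta>} \<subseteq> {a<..b}" for \<alpha> \<beta>
  proof -
    have sub: "{\<alpha>..\<beta>} \<subseteq> {a..b}" using \<alpha>\<beta>(2) greaterThanAtMost_subseteq_atLeastAtMost_iff[of a b a b] by blast
    have tr: "transverse (lag_curve A g a b \<gamma> t) (annihilator data ?w ?e)" if "t \<in> {\<alpha>..\<beta>}" for t
      using free[of t] that \<alpha>\<beta>(2) unfolding focal_instant_def transverse_def LP by blast
    show ?thesis
      using S.maslov_index_bound[OF assms(10) \<alpha>\<beta>(1) lag_curve_path[OF sub swapped tr] tr, of K]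
      unfolding L0' card .
  qed
  ultimately show ?thesis by blast
qed

end
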